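(* Assume $\lambda\ge\mu$. For fixed $\delta\in(0,\delta_0]$, let $\bm u^\delta$ be the exact solution of the nonlocal problem $-\mathcal{L}^S_\delta\bm u^\delta=\bm f$ in $\Omega$, $\bm u^\delta=\bm 0$ on $\Omega_{\mathcal I}$, and assume $\bm u^\delta\in C^4(\overline{\Omega_\delta};\mathbb{R}^d)$. Moreover assume that $|(\bm u^\delta)^{(4)}|_\infty$ is uniformly bounded for every $\delta$. Let $\bm u^{\delta,h}\in S(\square\cap\Omega;\mathbb{R}^d)$ be the numerical solution of the collocation scheme $-r^h_\Omega\mathcal{L}^{S,h}_\delta\bm u^{\delta,h}=r^h_\Omega\bm f$. Then $$\|\bm u^\delta-\bm u^{\delta,h}\|_{L^2(\Omega;\mathbb{R}^d)}\le C\,h_{\max}^2,$$ where $C$ is independent of $h_{\max}$ and $\delta$.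
   Context: Let $d\in\{2,3\}$, $\delta_0>0$, and let $\Omega\subset\mathbb{R}^d$ be open and bounded. For $\delta>0$, $\Omega_{\mathcal I}=\{\bm x\in\mathbb{R}^d\setminus\Omega:\mathrm{dist}(\bm x,\Omega)\le2\delta\}$ and $\Omega_\delta=\Omega\cup\Omega_{\mathcal I}$. The dimension $d$, the Lamé parameters $\lambda,\mu$ (constants, $\mu>0$), the kernel $\rho$ and the vector $\hat{\bm h}$ below are fixed data. Kernel: $\rho(|\bm s|)\ge 0$ is non-increasing in $|\bm s|$, supported in the unit ball $B_1$, with $\int_{B_1}\rho(|\bm s|)|\bm s|^2d\bm s=d$. For $\delta>0$ put $\rho_\delta(|\bm s|)=\delta^{-(d+2)}\rho(|\bm s|/\delta)$, and let $B_\delta$ be the ball of radius $\delta$ centered at $\bm 0$. Nonlocal operators (functions on $\mathbb{R}^d$; functions vanishing on $\Omega_{\mathcal I}$ are extended by zero): $\mathcal{L}^B_\delta \bm u(\bm x)=\int_{B_\delta}\rho_\delta(|\bm s|)\frac{\bm s\otimes\bm s}{|\bm s|^2}(\bm u(\bm x+\bm s)-\bm u(\bm x))d\bm s$, $\mathcal{D}_\delta\bm u(\bm x)=\int_{B_\delta}\rho_\delta(|\bm s|)\,\bm s\cdot(\bm u(\bm x+\bm s)-\bm u(\bm x))d\bm s$, $\mathcal{G}_\delta\theta(\bm x)=\int_{B_\delta}\rho_\delta(|\bm s|)\,\bm s\,(\theta(\bm x+\bm s)-\theta(\bm x))d\bm s$, $\mathcal{L}^S_\delta\bm u=\frac{C_\alpha\mu}{d}\mathcal{L}^B_\delta\bm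 u+\frac{C_\beta(\lambda-\mu)}{d}\mathcal{G}_\delta\mathcal{D}_\delta\bm u$, with $C_\alpha=30,\ C_\beta=3$ if $d=3$; $C_\alpha=16,\ C_\beta=2$ if $d=2$. Grid: $\bm h=(h_1,\dots,h_d)=h_{\max}\hat{\bm h}$ with $h_j>0$, $h_{\max}=\max_jh_j$, where $\hat{\bm h}$ is a fixed vector with maximum component $1$ and components bounded below by a positive constant. $\square=\{\bm x_{\bm k}=(k_1h_1,\dots,k_dh_d):\bm k\in\mathbb{Z}^d\}$. RK (reproducing kernel) basis: $\Psi_{\bm k}(\bm x)=\prod_{j=1}^d\phi(|x_j-k_jh_j|/(2h_j))$, where $\phi(x)=\frac23-4x^2+4x^3$ for $0\le x\le\frac12$, $\phi(x)=\frac43(1-x)^3$ for $\frac12\le x\le1$, and $\phi(x)=0$ otherwise. For a sequence $(u_{\bm k})$, $i^h(u_{\bm k})=\sum_{\bm k\in\mathbb{Z}^d}\Psi_{\bm k}u_{\bm k}$; for continuous $u$, $r^hu=(u(\bm x_{\bm k}))_{\bm k\in\mathbb{Z}^d}$ and $\Pi^h=i^hr^h$; all act componentwise on vector-valued objects. $r^h_\Omega u=(u(\bm x_{\bm k}))_{\bm x_{\bm k}\in\square\cap\Omega}$. $S(\square\cap\Omega;\mathbb{R}^d)$ is the space of functions $i^h(\bm u_{\bm k})$ with $\bm u_{\bm k}\in\mathbb{R}^d$ and $\bm u_{\bm k}=\bm 0$ whenever $\bm x_{\bm k}\notin\Omega$. For $\bm v$ in the trial space, $\mathcal{L}^{S,h}_\delta\bm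 v=\frac{C_\alpha\mu}{d}\mathcal{L}^B_\delta\bm v+\frac{C_\beta(\lambda-\mu)}{d}\mathcal{G}_\delta\Pi^h(\mathcal{D}_\delta\bm v)$. $|\bm u^{(l)}|_\infty=\sup_{1\le j\le d}\sup_{|\bm\beta|=l}\sup_{\bm y}|D^{\bm\beta}u_j(\bm y)|$. *)

theory Defs
  imports "HOL-Analysis.Analysis"
begin

definition Omega_I :: "(real^'d) set \<Rightarrow> real \<Rightarrow> (real^'d) set" where
  "Omega_I \<Omega> \<delta> = {x. x \<notin> \<Omega> \<and> infdist x \<Omega> \<le> 2 * \<delta>}"

definition Omega_delta :: "(real^'d) set \<Rightarrow> real \<Rightarrow> (real^'d) set" where
  "Omega_delta \<Omega> \<delta> = \<Omega> \<union> Omega_I \<Omega> \<delta>"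

text \<open>A derivative \<open>D\<^sup>\<beta>\<close> is indexed by the list of the coordinate directions in which one
  differentiates successively, so that \<open>\<bar>\<beta>\<bar>\<close> is the length of the list.  Lists that are
  permutations of each other represent the same multi-index; on the functions of class \<open>C\<^sup>k\<close>
  below they yield the same derivative.\<close>

definition partial_deriv :: "'d \<Rightarrow> (real^'d \<Rightarrow> real) \<Rightarrow> real^'d \<Rightarrow> real" where
  "partial_deriv i g x = deriv (\<lambda>t. g (x + t *\<^sub>R axis i 1)) 0"

definition has_partial :: "'d \<Rightarrow> (real^'d \<Rightarrow> real) \<Rightarrow> real^'d \<Rightarrow> bool" where
  "has_partial i g x \<longleftrightarrow> (\<lambda>t. g (x + t *\<^sub>R axis i 1)) field_differentiable (at 0)"

primrec D_multi :: "'d list \<Rightarrow> (real^'d \<Rightarrow> real) \<Rightarrow> real^'d \<Rightarrow> real" where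
  "D_multi [] g = g"
| "D_multi (i # \<beta>) g = partial_deriv i (D_multi \<beta> g)"

text \<open>\<open>C\<^sup>k\<close> of the closure of \<open>A\<close>: the function is continuous on the closure, its partial
  derivatives up to order \<open>k\<close> exist in the interior, and they are restrictions of continuous
  functions on the closure.\<close>

definition C_closure :: "nat \<Rightarrow> (real^'d) set \<Rightarrow> (real^'d \<Rightarrow> real) \<Rightarrow> bool" where
  "C_closure k A g \<longleftrightarrow>
     continuous_on (closure A) g \<and>
     (\<forall>\<beta>. length \<beta> < k \<longrightarrow> (\<forall>i. \<forall>x\<in>interior A. has_partial i (D_multi \<beta> g) x)) \<and>
     (\<forall>\<beta>. length \<beta> \<le> k \<longrightarrow>
        (\<exists>G. continuous_on (closure A) G \<and> (\<forall>x\<in>interior A. G x = D_multi \<beta> g x)))"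

definition C_closure_vec :: "nat \<Rightarrow> (real^'d) set \<Rightarrow> (real^'d \<Rightarrow> real^'d) \<Rightarrow> bool" where
  "C_closure_vec k A u \<longleftrightarrow> (\<forall>j. C_closure k A (\<lambda>x. u x $ j))"

text \<open>\<open>\<bar>u\<^sup>(\<^sup>l\<^sup>)\<bar>\<^sub>\<infinity>\<close> over \<open>A\<close>, with values in the extended reals.  For functions of class
  \<open>C\<^sup>l\<close> on the closure the supremum over the interior is that over the closure.\<close>

definition deriv_sup :: "nat \<Rightarrow> (real^'d) set \<Rightarrow> (real^'d \<Rightarrow> real^'d) \<Rightarrow> ereal" where
  "deriv_sup l A u =
     (SUP j. SUP \<beta>\<in>{\<beta>. length \<beta> = l}. SUP y\<in>interior A. ereal \<bar>D_multi \<beta> (\<lambda>x. u x $ j) y\<bar>)"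

definition L2_norm_on :: "(real^'d) set \<Rightarrow> (real^'d \<Rightarrow> real^'d) \<Rightarrow> real" where
  "L2_norm_on \<Omega> g = sqrt (LINT x:\<Omega>|lborel. (norm (g x))\<^sup>2)"

text \<open>Monotonicity and positivity are only required on \<open>(0,\<infinity>)\<close>: the kernel may be
  singular at the origin, and its value at \<open>0\<close> is immaterial.  As \<open>d > 0\<close>, the moment
  condition includes integrability of the integrand.\<close>

definition admissible_kernel :: "'d::finite itself \<Rightarrow> (real \<Rightarrow> real) \<Rightarrow> bool" where
  "admissible_kernel TYPE('d) \<rho> \<longleftrightarrow>
     (\<forall>r>0. 0 \<le> \<rho> r) \<and>
     antimono_on {0<..} \<rho> \<and>
     (\<forall>r>1. \<rho> r = 0) \<and>
     (LINT s:ball (0::real^'d) 1|lborel. \<rho> (norm s) * (norm s)\<^sup>2) = real CARD('d)"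

definition rho_scaled :: "'d::finite itself \<Rightarrow> (real \<Rightarrow> real) \<Rightarrow> real \<Rightarrow> real \<Rightarrow> real" where
  "rho_scaled TYPE('d) \<rho> \<delta> r = \<rho> (r / \<delta>) / \<delta> ^ (CARD('d) + 2)"

text \<open>The integrand of \<open>L\<^sup>B\<close>, with \<open>(s \<otimes> s) w = (s \<bullet> w) s\<close>.\<close>

definition LB_integrand ::
  "(real \<Rightarrow> real) \<Rightarrow> real \<Rightarrow> (real^'d \<Rightarrow> real^'d) \<Rightarrow> real^'d \<Rightarrow> real^'d \<Rightarrow> real^'d" where
  "LB_integrand \<rho> \<delta> u x s =
     (rho_scaled TYPE('d) \<rho> \<delta> (norm s) / (norm s)\<^sup>2) *\<^sub>R ((s \<bullet> (u (x + s) - u x)) *\<^sub>R s)"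

text \<open>Only the second moment of the kernel is finite, so the integrand of \<open>L\<^sup>B\<close>, which is merely
  of order \<open>\<rho>\<^sub>\<delta>(\<bar>s\<bar>) \<bar>s\<bar>\<close> at the origin, need not be absolutely integrable even for smooth
  \<open>u\<close>.  The integral is therefore a principal value; it agrees with the Lebesgue integral when
  the latter exists (see \<open>LB_eq_integral\<close>).  The integrands of \<open>D_op\<close> and \<open>G_op\<close> are of order
  \<open>\<rho>\<^sub>\<delta>(\<bar>s\<bar>) \<bar>s\<bar>\<^sup>2\<close>.\<close>

definition LB :: "(real \<Rightarrow> real) \<Rightarrow> real \<Rightarrow> (real^'d \<Rightarrow> real^'d) \<Rightarrow> real^'d \<Rightarrow> real^'d" where
  "LB \<rho> \<delta> u x =
     Lim (at_right 0) (\<lambda>\<epsilon>. LINT s:ball 0 \<delta> - ball 0 \<epsilon>|lborel. LB_integrand \<rho> \<delta> u x s)"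

definition D_op :: "(real \<Rightarrow> real) \<Rightarrow> real \<Rightarrow> (real^'d \<Rightarrow> real^'d) \<Rightarrow> real^'d \<Rightarrow> real" where
  "D_op \<rho> \<delta> u x =
     (LINT s:ball 0 \<delta>|lborel. rho_scaled TYPE('d) \<rho> \<delta> (norm s) * (s \<bullet> (u (x + s) - u x)))"

definition G_op :: "(real \<Rightarrow> real) \<Rightarrow> real \<Rightarrow> (real^'d \<Rightarrow> real) \<Rightarrow> real^'d \<Rightarrow> real^'d" where
  "G_op \<rho> \<delta> \<theta> x =
     (LINT s:ball 0 \<delta>|lborel.
        (rho_scaled TYPE('d) \<rho> \<delta> (norm s) * (\<theta> (x + s) - \<theta> x)) *\<^sub>R s)"

text \<open>The constants are only meant for \<open>d = 2\<close> and \<open>d = 3\<close>.\<close>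

definition C_alpha :: "nat \<Rightarrow> real" where
  "C_alpha d = (if d = 3 then 30 else 16)"

definition C_beta :: "nat \<Rightarrow> real" where
  "C_beta d = (if d = 3 then 3 else 2)"

definition LS ::
  "real \<Rightarrow> real \<Rightarrow> (real \<Rightarrow> real) \<Rightarrow> real \<Rightarrow> (real^'d \<Rightarrow> real^'d) \<Rightarrow> real^'d \<Rightarrow> real^'d" where
  "LS lam mu \<rho> \<delta> u x =
     (C_alpha CARD('d) * mu / real CARD('d)) *\<^sub>R LB \<rho> \<delta> u x +
     (C_beta CARD('d) * (lam - mu) / real CARD('d)) *\<^sub>R G_op \<rho> \<delta> (D_op \<rho> \<delta> u) x"

definition grid_pt :: "real^'d \<Rightarrow> int^'d \<Rightarrow> real^'d" where
  "grid_pt h k = (\<chi> j. of_int (k $ j) * h $ j)"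

definition phi :: "real \<Rightarrow> real" where
  "phi x = (if 0 \<le> x \<and> x \<le> 1/2 then 2/3 - 4 * x^2 + 4 * x^3
            else if 1/2 \<le> x \<and> x \<le> 1 then 4/3 * (1 - x)^3
            else 0)"

definition Psi :: "real^'d \<Rightarrow> int^'d \<Rightarrow> real^'d \<Rightarrow> real" where
  "Psi h k x = (\<Prod>j\<in>UNIV. phi (\<bar>x $ j - of_int (k $ j) * h $ j\<bar> / (2 * h $ j)))"

text \<open>For positive mesh sizes only finitely many terms of the following sum are nonzero.\<close>

definition i_h :: "real^'d \<Rightarrow> (int^'d \<Rightarrow> 'b::real_normed_vector) \<Rightarrow> real^'d \<Rightarrow> 'b" where
  "i_h h c x = (\<Sum>\<^sub>\<infinity>k. Psi h k x *\<^sub>R c k)"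

definition r_h :: "real^'d \<Rightarrow> (real^'d \<Rightarrow> 'b) \<Rightarrow> int^'d \<Rightarrow> 'b" where
  "r_h h g k = g (grid_pt h k)"

definition Pi_h :: "real^'d \<Rightarrow> (real^'d \<Rightarrow> 'b::real_normed_vector) \<Rightarrow> real^'d \<Rightarrow> 'b" where
  "Pi_h h g = i_h h (r_h h g)"

definition r_h_on :: "real^'d \<Rightarrow> (real^'d) set \<Rightarrow> (real^'d \<Rightarrow> 'b) \<Rightarrow> int^'d \<Rightarrow> 'b" where
  "r_h_on h \<Omega> g = restrict (r_h h g) {k. grid_pt h k \<in> \<Omega>}"

definition trial_space :: "real^'d \<Rightarrow> (real^'d) set \<Rightarrow> (real^'d \<Rightarrow> real^'d) set" where
  "trial_space h \<Omega> = {i_h h c | c :: int^'d \<Rightarrow> real^'d. \<forall>k. grid_pt h k \<notin> \<Omega> \<longrightarrow> c k = 0}"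

definition LSh ::
  "real \<Rightarrow> real \<Rightarrow> (real \<Rightarrow> real) \<Rightarrow> real^'d \<Rightarrow> real \<Rightarrow> (real^'d \<Rightarrow> real^'d) \<Rightarrow> real^'d \<Rightarrow> real^'d"
where
  "LSh lam mu \<rho> h \<delta> v x =
     (C_alpha CARD('d) * mu / real CARD('d)) *\<^sub>R LB \<rho> \<delta> v x +
     (C_beta CARD('d) * (lam - mu) / real CARD('d)) *\<^sub>R
        G_op \<rho> \<delta> (Pi_h h (D_op \<rho> \<delta> v)) x"

lemma LB_eq_integral:
  fixes u :: "real^'d \<Rightarrow> real^'d"
  assumes int: "set_integrable lborel (ball 0 \<delta>) (LB_integrand \<rho> \<delta> u x)"
  shows "LB \<rho> \<delta> u x = (LINT s:ball 0 \<delta>|lborel. LB_integrand \<rho> \<delta> u x s)"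
proof -
  let ?F = "LB_integrand \<rho> \<delta> u x"
  let ?I = "\<lambda>\<epsilon>. LINT s:ball 0 \<delta> - ball 0 \<epsilon>|lborel. ?F s"
  have "(?I \<longlongrightarrow> (LINT s:ball 0 \<delta>|lborel. ?F s)) (at_right 0)"
    unfolding tendsto_at_iff_sequentially comp_def
  proof (intro allI impI)
    fix X :: "nat \<Rightarrow> real"
    assume X: "\<forall>i. X i \<in> {0<..} - {0}" "X \<longlonglongrightarrow> 0"
    show "(\<lambda>n. ?I (X n)) \<longlonglongrightarrow> (LINT s:ball 0 \<delta>|lborel. ?F s)"
      unfolding set_lebesgue_integral_def
    proof (rule integral_dominated_convergence
        [where w = "\<lambda>s. norm (indicat_real (ball 0 \<delta>) s *\<^sub>R ?F s)"])
      show "(\<lambda>s. indicat_real (ball 0 \<delta>) s *\<^sub>R ?F s) \<in> borel_measurable lborel"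
        using int unfolding set_integrable_def by (rule borel_measurable_integrable)
      show "integrable lborel (\<lambda>s. norm (indicat_real (ball 0 \<delta>) s *\<^sub>R ?F s))"
        using int unfolding set_integrable_def by (rule integrable_norm)
      show "(\<lambda>s. indicat_real (ball 0 \<delta> - ball 0 (X n)) s *\<^sub>R ?F s) \<in> borel_measurable lborel" for n
      proof -
        have "set_integrable lborel (ball 0 \<delta> - ball 0 (X n)) ?F"
          by (rule set_integrable_subset[OF int]) auto
        then show ?thesis
          unfolding set_integrable_def by (rule borel_measurable_integrable)
      qed
      show "AE s in lborel. norm (indicat_real (ball 0 \<delta> - ball 0 (X n)) s *\<^sub>R ?F s)
              \<le> norm (indicat_real (ball 0 \<delta>) s *\<^sub>R ?F s)" for n
        by (auto simp: indicator_def)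
      show "AE s in lborel. (\<lambda>n. indicat_real (ball 0 \<delta> - ball 0 (X n)) s *\<^sub>R ?F s)
              \<longlonglongrightarrow> indicat_real (ball 0 \<delta>) s *\<^sub>R ?F s"
      proof (intro AE_I2)
        fix s :: "real^'d"
        show "(\<lambda>n. indicat_real (ball 0 \<delta> - ball 0 (X n)) s *\<^sub>R ?F s)
              \<longlonglongrightarrow> indicat_real (ball 0 \<delta>) s *\<^sub>R ?F s"
        proof (cases "s = 0")
          case True
          then show ?thesis by (simp add: LB_integrand_def)
        next
          case False
          then have "\<forall>\<^sub>F n in sequentially. X n < norm s"
            using X(2) by (intro order_tendstoD(2)) auto
          then have "\<forall>\<^sub>F n in sequentially.
              indicat_real (ball 0 \<delta> - ball 0 (X n)) s *\<^sub>R ?F s = indicat_real (ball 0 \<delta>) s *\<^sub>R ?F s"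
            by eventually_elim (auto simp: indicator_def)
          then show ?thesis by (rule tendsto_eventually)
        qed
      qed
    qed
  qed
  then show ?thesis
    unfolding LB_def by (intro tendsto_Lim) auto
qed

end

theory Submission
  imports Defs
begin

text \<open>The scheme is consistent of second order and stable, uniformly in \<open>\<delta>\<close>.

  Stability: the cubic B-spline is the autocorrelation of the hat function, so collocation with
  \<open>\<Psi>\<close> is a Galerkin method with multilinear elements.  For each \<open>s\<close>, the form of \<open>L\<^sup>B\<close> involves only
  the scalar function \<open>V = s \<bullet> v\<close> and its shift by \<open>s\<close>.  If \<open>n \<bar>s\<bar>\<close> exceeds the diameter of the support,
  then \<open>V\<close> and its shift by \<open>n s\<close> are orthogonal, and \<open>n\<close> shifts by \<open>s\<close> give
  \<open>2 \<parallel>V\<parallel>\<^sup>2 \<le> n\<^sup>2 \<parallel>V(\<cdot> + s) - V\<parallel>\<^sup>2\<close>; integrating over \<open>s\<close> yields a Poincare inequality with a constant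
  independent of \<open>\<delta>\<close>, without any Korn inequality.  The term \<open>G \<Pi> D\<close> has a sign on the grid
  because \<open>G\<close> is minus the adjoint of \<open>D\<close> there.

  Consistency: \<open>\<Pi>\<close> commutes with shifts by grid vectors and maps a quadratic polynomial to itself
  plus a constant.  Splitting a shift \<open>s\<close> into a grid vector and a remainder of mesh size therefore
  bounds first and second differences of \<open>\<Pi> u - u\<close> by \<open>h\<^sup>2 \<bar>s\<bar>\<close> and \<open>h\<^sup>2 \<bar>s\<bar>\<^sup>2\<close>, with third and fourth
  derivatives of \<open>u\<close> as constants.

  Coarse meshes are covered by the stability estimate alone, whose constant grows like \<open>h\<^sup>2\<close>.\<close>

section \<open>The cubic B-spline\<close>

text \<open>Uniformity in \<delta> shapes the consistency proof. Only the second moment of the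
  kernel is under control and \<delta> may lie far below the mesh size, so a bound h^2 on \<Pi> u -
  u itself would still be divided by \<delta>^2. What survives are increments: Lipschitz bounds for
  the arguments of D and G, and bounds on symmetric second differences for L^B, whose integrals
  against the kernel cost only the factor d. Second differences are needed at grid points only.
  There the point reflection preserves the grid and removes the odd Taylor terms, so that
  reproducing quadratics matches four derivatives. The quasi-interpolant of u is a trial function
  because u vanishes off \<Omega>. As \<open>Omega_delta\<close> reaches beyond the closure of
  \<Omega>, the zero extension of u is C^4 on the whole space, and its lower derivatives are bounded
  by the fourth ones along segments that leave the support; these bounds do not depend on \<delta>.
  The stability estimate for the coefficients contains the number of nodes, which the volume of the
  support of a basis function compensates.\<close>

definition bspline :: "real \<Rightarrow> real" where
  "bspline t = phi (\<bar>t\<bar> / 2)"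

lemma bspline_inner: "\<bar>t\<bar> \<le> 1 \<Longrightarrow> bspline t = 2/3 - t\<^sup>2 + \<bar>t\<bar>^3 / 2"
  by (simp add: bspline_def phi_def power_divide)

lemma bspline_outer: "1 \<le> \<bar>t\<bar> \<Longrightarrow> \<bar>t\<bar> \<le> 2 \<Longrightarrow> bspline t = (2 - \<bar>t\<bar>)^3 / 6"
proof -
  assume t: "1 \<le> \<bar>t\<bar>" "\<bar>t\<bar> \<le> 2"
  show ?thesis
  proof (cases "\<bar>t\<bar> = 1")
    case True
    then show ?thesis unfolding bspline_def phi_def by (simp add: power3_eq_cube power2_eq_square)
  next
    case False
    with t show ?thesis unfolding bspline_def phi_def
      by (simp add: power3_eq_cube field_simps)
  qed
qed

lemma bspline_zero: "2 \<le> \<bar>t\<bar> \<Longrightarrow> bspline t = 0"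
  by (auto simp: bspline_def phi_def)

lemma bspline_even: "bspline (- t) = bspline t"
  by (simp add: bspline_def)

lemma bspline_nonneg: "0 \<le> bspline t"
proof -
  consider "\<bar>t\<bar> \<le> 1" | "1 \<le> \<bar>t\<bar>" "\<bar>t\<bar> \<le> 2" | "2 \<le> \<bar>t\<bar>" by linarith
  then show ?thesis
  proof cases
    case 1
    have "2/3 - t\<^sup>2 + \<bar>t\<bar>^3 / 2 = 1/6 + (1 - \<bar>t\<bar>) * (1 + \<bar>t\<bar> - \<bar>t\<bar> * \<bar>t\<bar>) / 2"
      by (simp add: power2_eq_square power3_eq_cube field_simps)
    moreover have "\<bar>t\<bar> * \<bar>t\<bar> \<le> 1" using 1 by (intro mult_le_one) auto
    ultimately show ?thesis using 1 by (simp add: bspline_inner)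
  next
    case 2 then show ?thesis by (simp add: bspline_outer)
  next
    case 3 then show ?thesis by (simp add: bspline_zero)
  qed
qed

text \<open>The integers whose splines can be nonzero at \<open>t\<close>. At an integer
  \<open>t\<close> the last one contributes zero, so there are always exactly four.\<close>

definition spline_idx :: "real \<Rightarrow> int set" where
  "spline_idx t = {\<lfloor>t\<rfloor> - 1..\<lfloor>t\<rfloor> + 2}"

lemma finite_spline_idx [simp]: "finite (spline_idx t)" by (simp add: spline_idx_def)

lemma card_spline_idx [simp]: "card (spline_idx t) = 4" by (simp add: spline_idx_def)

lemma bspline_outside_idx: "i \<notin> spline_idx t \<Longrightarrow> bspline (t - of_int i) = 0"
proof -
  assume "i \<notin> spline_idx t"
  then have "i \<le> \<lfloor>t\<rfloor> - 2 \<or> i \<ge> \<lfloor>t\<rfloor> + 3" by (auto simp: spline_idx_def)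
  then have "2 \<le> \<bar>t - of_int i\<bar>" by linarith
  then show ?thesis by (rule bspline_zero)
qed

lemma spline_idx_close: "i \<in> spline_idx t \<Longrightarrow> \<bar>t - of_int i\<bar> \<le> 2"
  unfolding spline_idx_def atLeastAtMost_iff by linarith

lemma sum_spline_idx: "(\<Sum>i\<in>spline_idx t. f i) = f (\<lfloor>t\<rfloor> - 1) + f \<lfloor>t\<rfloor> + f (\<lfloor>t\<rfloor> + 1) + f (\<lfloor>t\<rfloor> + 2)"
  for f :: "int \<Rightarrow> real"
proof -
  have "spline_idx t = {\<lfloor>t\<rfloor> - 1, \<lfloor>t\<rfloor>, \<lfloor>t\<rfloor> + 1, \<lfloor>t\<rfloor> + 2}" by (auto simp: spline_idx_def)
  then show ?thesis by simp
qed

lemma bspline_idx_values: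
  assumes "r = t - of_int \<lfloor>t\<rfloor>"
  shows "bspline (t - of_int (\<lfloor>t\<rfloor> - 1)) = (1 - r)^3 / 6"
    and "bspline (t - of_int \<lfloor>t\<rfloor>) = 2/3 - r\<^sup>2 + r^3 / 2"
    and "bspline (t - of_int (\<lfloor>t\<rfloor> + 1)) = 2/3 - (1 - r)\<^sup>2 + (1 - r)^3 / 2"
    and "bspline (t - of_int (\<lfloor>t\<rfloor> + 2)) = r^3 / 6"
proof -
  have r: "0 \<le> r" "r \<le> 1" unfolding assms by linarith+
  have e: "t - of_int (\<lfloor>t\<rfloor> - 1) = 1 + r" "t - of_int \<lfloor>t\<rfloor> = r"
    "t - of_int (\<lfloor>t\<rfloor> + 1) = - (1 - r)" "t - of_int (\<lfloor>t\<rfloor> + 2) = - (2 - r)"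
    using assms by auto
  show "bspline (t - of_int (\<lfloor>t\<rfloor> - 1)) = (1 - r)^3 / 6"
    unfolding e using r by (subst bspline_outer) (auto)
  show "bspline (t - of_int \<lfloor>t\<rfloor>) = 2/3 - r\<^sup>2 + r^3 / 2"
    unfolding e using r by (subst bspline_inner) auto
  show "bspline (t - of_int (\<lfloor>t\<rfloor> + 1)) = 2/3 - (1 - r)\<^sup>2 + (1 - r)^3 / 2"
    unfolding e bspline_even using r by (subst bspline_inner) auto
  show "bspline (t - of_int (\<lfloor>t\<rfloor> + 2)) = r^3 / 6"
    unfolding e bspline_even using r by (subst bspline_outer) auto
qed

text \<open>On one cell these are polynomial identities in the fractional part of \<open>t\<close>.
  The value 1/3 is the variance of a sum of four uniform variables of variance 1/12 each; since it
  is independent of \<open>t\<close>, a quadratic is reproduced up to a constant.\<close>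

lemma bspline_moments:
  shows "(\<Sum>i\<in>spline_idx t. bspline (t - of_int i)) = 1"
    and "(\<Sum>i\<in>spline_idx t. bspline (t - of_int i) * (of_int i - t)) = 0"
    and "(\<Sum>i\<in>spline_idx t. bspline (t - of_int i) * (of_int i - t)\<^sup>2) = 1 / 3"
proof -
  define r where "r = t - of_int \<lfloor>t\<rfloor>"
  note v = bspline_idx_values[OF r_def]
  have e: "of_int (\<lfloor>t\<rfloor> - 1) - t = - 1 - r" "of_int \<lfloor>t\<rfloor> - t = - r"
    "of_int (\<lfloor>t\<rfloor> + 1) - t = 1 - r" "of_int (\<lfloor>t\<rfloor> + 2) - t = 2 - r"
    by (auto simp: r_def)
  show "(\<Sum>i\<in>spline_idx t. bspline (t - of_int i)) = 1"
    unfolding sum_spline_idx v by (simp add: field_simps power2_eq_square power3_eq_cube)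
  show "(\<Sum>i\<in>spline_idx t. bspline (t - of_int i) * (of_int i - t)) = 0"
    unfolding sum_spline_idx v e by (simp add: field_simps power2_eq_square power3_eq_cube)
  show "(\<Sum>i\<in>spline_idx t. bspline (t - of_int i) * (of_int i - t)\<^sup>2) = 1 / 3"
    unfolding sum_spline_idx v e by (simp add: field_simps power2_eq_square power3_eq_cube)
qed

lemma bspline_le_1: "bspline t \<le> 1"
proof -
  have "bspline (t - of_int 0) \<le> 1"
  proof (cases "0 \<in> spline_idx t")
    case True
    then have "bspline (t - of_int 0) \<le> (\<Sum>i\<in>spline_idx t. bspline (t - of_int i))"
      by (intro member_le_sum) (auto simp: bspline_nonneg)
    then show ?thesis by (simp only: bspline_moments)
  qed (use bspline_outside_idx[of 0 t] in simp)
  then show ?thesis by simp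
qed

section \<open>Derivatives and difference bounds of the spline\<close>

lemma truncated_cube_deriv:
  "((\<lambda>x::real. max 0 x ^ 3) has_real_derivative 3 * (max 0 x)\<^sup>2) (at x)"
  and truncated_square_deriv:
  "((\<lambda>x::real. (max 0 x)\<^sup>2) has_real_derivative 2 * max 0 x) (at x)"
proof -
  have *: "((\<lambda>x::real. max 0 x ^ Suc n) has_real_derivative real (Suc n) * max 0 x ^ n) (at x)"
    if n: "n > 0" for n
  proof -
    consider "x > 0" | "x < 0" | "x = 0" by linarith
    then show ?thesis
    proof cases
      case 1
      have "((\<lambda>x::real. x ^ Suc n) has_real_derivative real (Suc n) * x ^ n) (at x)"
        by (rule derivative_eq_intros refl | simp)+
      moreover have "max 0 x = x" using 1 by simp
      ultimately have "((\<lambda>x::real. x ^ Suc n) has_real_derivative real (Suc n) * max 0 x ^ n) (at x)" by simp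
      then show ?thesis
        by (rule DERIV_cong_ev[THEN iffD1, rotated -1])
          (use 1 in \<open>auto intro!: eventually_mono[OF eventually_nhds_in_open[of "{0<..}"]]\<close>)
    next
      case 2
      have "((\<lambda>x::real. 0) has_real_derivative real (Suc n) * max 0 x ^ n) (at x)"
        using 2 n by (simp add: max_def zero_power)
      then show ?thesis
        by (rule DERIV_cong_ev[THEN iffD1, rotated -1])
          (use 2 in \<open>auto intro!: eventually_mono[OF eventually_nhds_in_open[of "{..<0}"]]\<close>)
    next
      case 3
      have "((\<lambda>h. (max 0 (0 + h) ^ Suc n - max 0 0 ^ Suc n) / h) \<longlongrightarrow> 0) (at (0::real))"
      proof (rule Lim_null_comparison)
        have "\<bar>max 0 h ^ Suc n / h\<bar> \<le> \<bar>h\<bar> ^ n" for h :: real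
          by (cases "h > 0") (auto simp: max_def)
        then show "\<forall>\<^sub>F h in at 0. norm ((max 0 (0 + h) ^ Suc n - max 0 0 ^ Suc n) / h) \<le> \<bar>h::real\<bar> ^ n"
          by (auto intro!: always_eventually)
        show "((\<lambda>h::real. \<bar>h\<bar> ^ n) \<longlongrightarrow> 0) (at 0)"
          using n by (auto intro!: tendsto_eq_intros)
      qed
      then show ?thesis using 3 n by (simp add: DERIV_def zero_power)
    qed
  qed
  show "((\<lambda>x::real. max 0 x ^ 3) has_real_derivative 3 * (max 0 x)\<^sup>2) (at x)"
    using *[of 2] by (simp add: eval_nat_numeral)
  show "((\<lambda>x::real. (max 0 x)\<^sup>2) has_real_derivative 2 * max 0 x) (at x)"
    using *[of 1] by (simp add: eval_nat_numeral)
qed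

text \<open>The spline is one sixth of the fourth central difference of the truncated cube, hence
  the weights 1, -4, 6, -4, 1. Truncated powers are differentiable across the knots, so no pieces
  have to be glued.\<close>

lemma bspline_truncated:
  "bspline t = (max 0 (t + 2) ^ 3 - 4 * max 0 (t + 1) ^ 3 + 6 * max 0 t ^ 3
     - 4 * max 0 (t - 1) ^ 3 + max 0 (t - 2) ^ 3) / 6"
proof -
  consider "t \<le> -2" | "-2 \<le> t" "t \<le> -1" | "-1 \<le> t" "t \<le> 0" | "0 \<le> t" "t \<le> 1"
    | "1 \<le> t" "t \<le> 2" | "2 \<le> t" by linarith
  then show ?thesis
    by cases (auto simp: bspline_zero bspline_inner bspline_outer max_def field_simps power2_eq_square power3_eq_cube)
qed

definition bspline' :: "real \<Rightarrow> real" where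
  "bspline' t = ((max 0 (t + 2))\<^sup>2 - 4 * (max 0 (t + 1))\<^sup>2 + 6 * (max 0 t)\<^sup>2
     - 4 * (max 0 (t - 1))\<^sup>2 + (max 0 (t - 2))\<^sup>2) / 2"

definition bspline'' :: "real \<Rightarrow> real" where
  "bspline'' t = max 0 (t + 2) - 4 * max 0 (t + 1) + 6 * max 0 t
     - 4 * max 0 (t - 1) + max 0 (t - 2)"

lemma bspline_deriv: "(bspline has_real_derivative bspline' t) (at t)"
proof -
  have c: "((\<lambda>t. max 0 (t + a) ^ 3) has_real_derivative 3 * (max 0 (t + a))\<^sup>2) (at t)" for a :: real
    using truncated_cube_deriv[of "t + a"] by (simp add: DERIV_shift)
  have "((\<lambda>t. (max 0 (t + 2) ^ 3 - 4 * max 0 (t + 1) ^ 3 + 6 * max 0 (t + 0) ^ 3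
     - 4 * max 0 (t + (- 1)) ^ 3 + max 0 (t + (- 2)) ^ 3) / 6) has_real_derivative bspline' t) (at t)"
    unfolding bspline'_def by (rule derivative_eq_intros c refl | simp)+
  then show ?thesis unfolding bspline_truncated[abs_def] by simp
qed

lemma bspline'_deriv: "(bspline' has_real_derivative bspline'' t) (at t)"
proof -
  have c: "((\<lambda>t. (max 0 (t + a))\<^sup>2) has_real_derivative 2 * max 0 (t + a)) (at t)" for a :: real
    using truncated_square_deriv[of "t + a"] by (simp add: DERIV_shift)
  have "((\<lambda>t. ((max 0 (t + 2))\<^sup>2 - 4 * (max 0 (t + 1))\<^sup>2 + 6 * (max 0 (t + 0))\<^sup>2
     - 4 * (max 0 (t + (- 1)))\<^sup>2 + (max 0 (t + (- 2)))\<^sup>2) / 2) has_real_derivative bspline'' t) (at t)"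
    unfolding bspline''_def by (rule derivative_eq_intros c refl | simp)+
  then show ?thesis unfolding bspline'_def[abs_def] by simp
qed

lemma bspline''_bound: "\<bar>bspline'' t\<bar> \<le> 2"
  unfolding bspline''_def max_def by (auto simp: abs_le_iff)

lemma bspline'_bound: "\<bar>bspline' t\<bar> \<le> 1"
proof -
  consider "t \<le> -2" | "-2 \<le> t" "t \<le> -1" | "-1 \<le> t" "t \<le> 0" | "0 \<le> t" "t \<le> 1"
    | "1 \<le> t" "t \<le> 2" | "2 \<le> t" by linarith
  then show ?thesis
  proof cases
    case 1
    then have "max 0 (t + 2) = 0" "max 0 (t + 1) = 0" "max 0 t = 0" "max 0 (t - 1) = 0" "max 0 (t - 2) = 0" by auto
    then show ?thesis by (simp add: bspline'_def)
  next
    case 2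
    have "(t+2)\<^sup>2 \<le> 1" using 2 by (simp add: power_le_one)
    moreover have "max 0 (t + 1) = 0" "max 0 (t + 2) = t + 2" using 2 by auto
    ultimately show ?thesis using 2 by (simp add: bspline'_def)
  next
    case 3
    have "bspline' t = - 2 * t - 3/2 * t\<^sup>2" using 3 by (auto simp: bspline'_def max_def power2_eq_square field_simps)
    \<comment> \<open>Completing the square at the vertex t = -2/3 shows that the values lie between
      0 and 2/3.\<close>
    also have "\<dots> = 2/3 - 3/2 * (t + 2/3)\<^sup>2" by (simp add: power2_eq_square field_simps)
    moreover have "\<bar>t + 2/3\<bar>\<^sup>2 \<le> (2/3)\<^sup>2" using 3 by (intro power_mono; linarith)
    moreover have "(2/3)\<^sup>2 = (4/9::real)" by (simp add: power2_eq_square)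
    ultimately show ?thesis using zero_le_power2[of "t + 2/3"] by (simp only: power2_abs abs_le_iff) linarith
  next
    case 4
    have "bspline' t = - 2 * t + 3/2 * t\<^sup>2" using 4 by (auto simp: bspline'_def max_def power2_eq_square field_simps)
    also have "\<dots> = 3/2 * (t - 2/3)\<^sup>2 - 2/3" by (simp add: power2_eq_square field_simps)
    moreover have "\<bar>t - 2/3\<bar>\<^sup>2 \<le> (2/3)\<^sup>2" using 4 by (intro power_mono; linarith)
    moreover have "(2/3)\<^sup>2 = (4/9::real)" by (simp add: power2_eq_square)
    ultimately show ?thesis using zero_le_power2[of "t - 2/3"] by (simp only: power2_abs abs_le_iff) linarith
  next
    case 5
    have "bspline' t = - (2 - t)\<^sup>2 / 2" using 5 by (auto simp: bspline'_def max_def power2_eq_square field_simps)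
    moreover have "(2-t)\<^sup>2 \<le> 1" using 5 by (simp add: power_le_one)
    ultimately show ?thesis by simp
  next
    case 6
    then show ?thesis by (simp add: bspline'_def max_def power2_eq_square field_simps)
  qed
qed

lemma bspline_lipschitz: "\<bar>bspline x - bspline y\<bar> \<le> \<bar>x - y\<bar>"
  using field_differentiable_bound[of UNIV bspline bspline' 1 x y] bspline_deriv bspline'_bound by auto

text \<open>The derivative in \<open>r\<close> is a difference of \<open>bspline'\<close> over the
  distance 2|r|. The Lipschitz constant 2 of \<open>bspline'\<close> bounds it by 4|r|.\<close>

lemma bspline_second_diff: "\<bar>bspline (x + r) + bspline (x - r) - 2 * bspline x\<bar> \<le> 4 * r\<^sup>2"
proof -
  have L: "\<bar>bspline' x - bspline' y\<bar> \<le> 2 * \<bar>x - y\<bar>" for x y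
    using field_differentiable_bound[of UNIV bspline' bspline'' 2 x y] bspline'_deriv bspline''_bound by auto
  let ?f = "\<lambda>t. bspline (x + t) + bspline (x - t)"
  have d: "(?f has_real_derivative bspline' (x + t) - bspline' (x - t)) (at t within S)" for t S
    by (rule derivative_eq_intros DERIV_chain2[OF bspline_deriv] refl | simp)+
  have "norm (?f r - ?f 0) \<le> 4 * \<bar>r\<bar> * norm (r - 0)"
  proof (rule field_differentiable_bound[of "closed_segment 0 r"])
    show "norm (bspline' (x + t) - bspline' (x - t)) \<le> 4 * \<bar>r\<bar>" if "t \<in> closed_segment 0 r" for t
      using L[of "x+t" "x-t"] that by (auto simp: closed_segment_eq_real_ivl split: if_splits)
  qed (auto intro: d)
  then show ?thesis by (simp add: power2_eq_square)
qed

section \<open>The reproducing kernel basis\<close>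

lemma Psi_bspline:
  fixes h :: "real^'d"
  assumes "\<And>j. 0 < h $ j"
  shows "Psi h k x = (\<Prod>j\<in>UNIV. bspline (x $ j / h $ j - of_int (k $ j)))"
  unfolding Psi_def bspline_def
proof (rule prod.cong[OF refl])
  fix j :: 'd
  have "\<bar>x $ j - of_int (k $ j) * h $ j\<bar> = \<bar>x $ j / h $ j - of_int (k $ j)\<bar> * h $ j"
    using assms[of j] by (simp add: abs_mult_pos' field_simps)
  then show "phi (\<bar>x $ j - of_int (k $ j) * h $ j\<bar> / (2 * h $ j)) =
      phi (\<bar>x $ j / h $ j - of_int (k $ j)\<bar> / 2)"
    using assms[of j] by simp
qed

definition nodes :: "real^'d \<Rightarrow> real^'d \<Rightarrow> (int^'d) set" where
  "nodes h x = {k. \<forall>j. k $ j \<in> spline_idx (x $ j / h $ j)}"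

text \<open>Exhibits the active nodes as a product set, so that sums of products over them factor
  into one-dimensional sums.\<close>

lemma nodes_image: "nodes h x = (\<lambda>g. \<chi> j. g j) ` (\<Pi>\<^sub>E j\<in>UNIV. spline_idx (x $ j / h $ j))"
proof (intro equalityI subsetI)
  fix k assume "k \<in> nodes h x"
  then have "(\<lambda>j. k $ j) \<in> (\<Pi>\<^sub>E j\<in>UNIV. spline_idx (x $ j / h $ j))" by (auto simp: nodes_def)
  then show "k \<in> (\<lambda>g. \<chi> j. g j) ` (\<Pi>\<^sub>E j\<in>UNIV. spline_idx (x $ j / h $ j))"
    by (rule rev_image_eqI) simp
qed (auto simp: nodes_def PiE_iff)

lemma inj_vec_lambda_PiE: "inj_on (\<lambda>g. \<chi> j. g j) S"
  by (auto simp: inj_on_def vec_eq_iff)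

lemma finite_nodes [simp]: "finite (nodes h x)"
  unfolding nodes_image by (intro finite_imageI finite_PiE) auto

lemma card_nodes: "card (nodes h x) = 4 ^ CARD('d)" for h :: "real^'d::finite"
  unfolding nodes_image by (simp add: card_image[OF inj_vec_lambda_PiE] card_PiE)

lemma sum_nodes_prod:
  fixes f :: "'d::finite \<Rightarrow> int \<Rightarrow> real" and x :: "real^'d"
  shows "(\<Sum>k\<in>nodes h x. \<Prod>j\<in>UNIV. f j (k $ j)) = (\<Prod>j\<in>UNIV. \<Sum>i\<in>spline_idx (x $ j / h $ j). f j i)"
proof -
  have "(\<Prod>j\<in>UNIV. \<Sum>i\<in>spline_idx (x $ j / h $ j). f j i) =
      (\<Sum>g\<in>(\<Pi>\<^sub>E j\<in>UNIV. spline_idx (x $ j / h $ j)). \<Prod>j\<in>UNIV. f j (g j))"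
    by (rule prod_sum_PiE) auto
  then show ?thesis
    unfolding nodes_image by (simp add: sum.reindex[OF inj_vec_lambda_PiE])
qed

lemma nodes_close:
  assumes "\<And>j. 0 < h $ j" "k \<in> nodes h x"
  shows "\<bar>grid_pt h k $ j - x $ j\<bar> \<le> 2 * h $ j"
proof -
  have "\<bar>x $ j / h $ j - of_int (k $ j)\<bar> \<le> 2"
    using assms(2) spline_idx_close by (auto simp: nodes_def)
  moreover have "grid_pt h k $ j - x $ j = - (x $ j / h $ j - of_int (k $ j)) * h $ j"
    using assms(1)[of j] by (simp add: grid_pt_def field_simps)
  ultimately show ?thesis using assms(1)[of j] by (simp add: abs_mult mult_right_mono)
qed

lemma norm_le_card:
  fixes x :: "real^'d"
  assumes "\<And>j. \<bar>x $ j\<bar> \<le> B"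
  shows "norm x \<le> real CARD('d) * B"
proof -
  have "norm x \<le> (\<Sum>j\<in>UNIV. \<bar>x $ j\<bar>)" by (rule norm_le_l1_cart)
  also have "\<dots> \<le> (\<Sum>j\<in>(UNIV::'d set). B)" by (intro sum_mono assms)
  finally show ?thesis by simp
qed

lemma sum_abs_le_norm: "(\<Sum>j\<in>UNIV. \<bar>x $ j\<bar>) \<le> real CARD('d) * norm x" for x :: "real^'d::finite"
proof -
  have "(\<Sum>j\<in>UNIV. \<bar>x $ j\<bar>) \<le> (\<Sum>j\<in>(UNIV::'d set). norm x)"
    by (intro sum_mono component_le_norm_cart)
  then show ?thesis by simp
qed

lemma nodes_dist:
  fixes h :: "real^'d" and H :: real
  assumes "\<And>j. 0 < h $ j" "\<And>j. h $ j \<le> H" "k \<in> nodes h x"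
  shows "norm (grid_pt h k - x) \<le> real CARD('d) * (2 * H)"
proof (rule norm_le_card)
  fix j show "\<bar>(grid_pt h k - x) $ j\<bar> \<le> 2 * H"
    using nodes_close[OF assms(1,3), of j] assms(2)[of j] by simp
qed

lemma Psi_inactive:
  assumes "\<And>j. 0 < h $ j" "k \<notin> nodes h x"
  shows "Psi h k x = 0"
proof -
  obtain j where "k $ j \<notin> spline_idx (x $ j / h $ j)" using assms(2) by (auto simp: nodes_def)
  then have "bspline (x $ j / h $ j - of_int (k $ j)) = 0" by (rule bspline_outside_idx)
  then show ?thesis unfolding Psi_bspline[OF assms(1)] by (intro prod_zero) auto
qed

lemma Psi_nonneg: "(\<And>j. 0 < h $ j) \<Longrightarrow> 0 \<le> Psi h k x"
  by (simp add: Psi_bspline prod_nonneg bspline_nonneg)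

lemma Psi_le_1: "(\<And>j. 0 < h $ j) \<Longrightarrow> Psi h k x \<le> 1"
  by (simp add: Psi_bspline prod_le_1 bspline_nonneg bspline_le_1)

lemma i_h_eq_sum:
  assumes "finite F" "\<And>k. k \<notin> F \<Longrightarrow> Psi h k x *\<^sub>R c k = 0"
  shows "i_h h c x = (\<Sum>k\<in>F. Psi h k x *\<^sub>R c k)"
proof -
  have "i_h h c x = (\<Sum>\<^sub>\<infinity>k\<in>F. Psi h k x *\<^sub>R c k)"
    unfolding i_h_def by (rule infsum_cong_neutral) (use assms in auto)
  then show ?thesis using assms(1) by simp
qed

lemma i_h_nodes: "(\<And>j. 0 < h $ j) \<Longrightarrow> i_h h c x = (\<Sum>k\<in>nodes h x. Psi h k x *\<^sub>R c k)"
  by (rule i_h_eq_sum) (auto simp: Psi_inactive)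

lemma Pi_h_nodes:
  "(\<And>j. 0 < h $ j) \<Longrightarrow> Pi_h h g x = (\<Sum>k\<in>nodes h x. Psi h k x *\<^sub>R g (grid_pt h k))"
  by (simp add: Pi_h_def i_h_nodes r_h_def)

lemma Pi_h_superset:
  "(\<And>j. 0 < h $ j) \<Longrightarrow> finite F \<Longrightarrow> nodes h x \<subseteq> F \<Longrightarrow>
    Pi_h h g x = (\<Sum>k\<in>F. Psi h k x *\<^sub>R g (grid_pt h k))"
  unfolding Pi_h_def r_h_def by (rule i_h_eq_sum) (auto intro: Psi_inactive)

section \<open>Discrete moments and interpolation of quadratics\<close>

lemma sum_Psi:
  assumes "\<And>j. 0 < h $ j"
  shows "(\<Sum>k\<in>nodes h x. Psi h k x) = 1"
  unfolding Psi_bspline[OF assms]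
  using sum_nodes_prod[of "\<lambda>j i. bspline (x $ j / h $ j - of_int i)" h x] by (simp add: bspline_moments)

text \<open>The linear factor is absorbed into the factor of coordinate \<open>a\<close>. The sum
  then factors, and this factor becomes a vanishing one-dimensional first moment.\<close>

lemma Psi_first_moment:
  assumes "\<And>j. 0 < h $ j"
  shows "(\<Sum>k\<in>nodes h x. Psi h k x * (grid_pt h k $ a - x $ a)) = 0"
proof -
  let ?t = "\<lambda>j. x $ j / h $ j"
  let ?f = "\<lambda>j i. bspline (?t j - of_int i) * (if j = a then (of_int i - ?t a) * h $ a else 1)"
  have "Psi h k x * (grid_pt h k $ a - x $ a) = (\<Prod>j\<in>UNIV. ?f j (k $ j))" for k
    using assms[of a] unfolding Psi_bspline[OF assms] prod.distrib
    by (simp add: grid_pt_def field_simps)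
  then have "(\<Sum>k\<in>nodes h x. Psi h k x * (grid_pt h k $ a - x $ a)) = (\<Prod>j\<in>UNIV. \<Sum>i\<in>spline_idx (?t j). ?f j i)"
    by (simp only: sum_nodes_prod[of ?f])
  also have "\<dots> = 0"
  proof (rule prod_zero)
    have "(\<Sum>i\<in>spline_idx (?t a). ?f a i) = (\<Sum>i\<in>spline_idx (?t a). bspline (?t a - of_int i) * (of_int i - ?t a)) * h $ a"
      by (simp add: sum_distrib_right mult.assoc)
    then show "\<exists>j\<in>UNIV. (\<Sum>i\<in>spline_idx (?t j). ?f j i) = 0" by (auto simp: bspline_moments intro!: exI[of _ a])
  qed simp
  finally show ?thesis .
qed

text \<open>The sum factors as for the first moment. Off the diagonal a vanishing first moment
  appears; on the diagonal both linear factors meet in one coordinate and give the moment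
  1/3.\<close>

lemma Psi_second_moment:
  assumes "\<And>j. 0 < h $ j"
  shows "(\<Sum>k\<in>nodes h x. Psi h k x * ((grid_pt h k $ a - x $ a) * (grid_pt h k $ b - x $ b))) =
    (if a = b then (h $ a)\<^sup>2 / 3 else 0)"
proof -
  let ?t = "\<lambda>j. x $ j / h $ j"
  let ?f = "\<lambda>j i. bspline (?t j - of_int i) * (if j = a then (of_int i - ?t a) * h $ a else 1)
     * (if j = b then (of_int i - ?t b) * h $ b else 1)"
  have "Psi h k x * ((grid_pt h k $ a - x $ a) * (grid_pt h k $ b - x $ b)) = (\<Prod>j\<in>UNIV. ?f j (k $ j))" for k
    using assms[of a] assms[of b] unfolding Psi_bspline[OF assms] prod.distrib
    by (simp add: grid_pt_def field_simps)
  then have *: "(\<Sum>k\<in>nodes h x. Psi h k x * ((grid_pt h k $ a - x $ a) * (grid_pt h k $ b - x $ b)))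
      = (\<Prod>j\<in>UNIV. \<Sum>i\<in>spline_idx (?t j). ?f j i)"
    by (simp only: sum_nodes_prod[of ?f])
  show ?thesis
  proof (cases "a = b")
    case True
    have "(\<Sum>i\<in>spline_idx (?t j). ?f j i) = (if j = a then (h $ a)\<^sup>2 / 3 else 1)" for j
    proof (cases "j = a")
      case True
      have "(\<Sum>i\<in>spline_idx (?t a). ?f a i) = (\<Sum>i\<in>spline_idx (?t a). bspline (?t a - of_int i) * (of_int i - ?t a)\<^sup>2) * (h $ a)\<^sup>2"
        using \<open>a = b\<close> by (simp add: sum_distrib_left sum_distrib_right power2_eq_square mult_ac)
      then show ?thesis using True by (simp add: bspline_moments)
    qed (use True in \<open>simp add: bspline_moments\<close>)
    then show ?thesis unfolding * using True by simp
  next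
    case False
    have "(\<Sum>i\<in>spline_idx (?t a). ?f a i) = (\<Sum>i\<in>spline_idx (?t a). bspline (?t a - of_int i) * (of_int i - ?t a)) * h $ a"
      using False by (simp add: sum_distrib_right mult.assoc)
    then have "(\<Sum>i\<in>spline_idx (?t a). ?f a i) = 0" by (simp only: bspline_moments mult_zero_left)
    then have "(\<Prod>j\<in>UNIV. \<Sum>i\<in>spline_idx (?t j). ?f j i) = 0" by (intro prod_zero bexI[of _ a]) simp_all
    then show ?thesis unfolding * using False by simp
  qed
qed

text \<open>\<open>Q\<close> need not be symmetric, so Taylor polynomials of families without
  symmetry of mixed derivatives fit directly.\<close>

definition quad :: "real \<Rightarrow> ('d::finite \<Rightarrow> real) \<Rightarrow> ('d \<Rightarrow> 'd \<Rightarrow> real) \<Rightarrow> real^'d \<Rightarrow> real" where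
  "quad c l Q y = c + (\<Sum>a\<in>UNIV. l a * y $ a) + (\<Sum>a\<in>UNIV. \<Sum>b\<in>UNIV. Q a b * (y $ a * y $ b))"

text \<open>Expanding about \<open>x\<close> reduces everything to the moments. The surplus involves
  neither \<open>x\<close> nor \<open>x0\<close>, so differences of the interpolation error do not
  see quadratic polynomials.\<close>

lemma sum_Psi_quad:
  fixes h :: "real^'d"
  assumes "\<And>j. 0 < h $ j"
  shows "(\<Sum>k\<in>nodes h x. Psi h k x * quad c l Q (grid_pt h k - x0)) =
    quad c l Q (x - x0) + (\<Sum>a\<in>UNIV. Q a a * (h $ a)\<^sup>2 / 3)"
proof -
  let ?S = "\<lambda>f. \<Sum>k\<in>nodes h x. Psi h k x * f k"
  have 1: "?S (\<lambda>k. (grid_pt h k - x0) $ a) = (x - x0) $ a" for a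
  proof -
    have "?S (\<lambda>k. (grid_pt h k - x0) $ a) =
        ?S (\<lambda>k. grid_pt h k $ a - x $ a) + (\<Sum>k\<in>nodes h x. Psi h k x) * (x $ a - x0 $ a)"
      unfolding sum_distrib_right sum.distrib[symmetric] by (intro sum.cong refl) (simp add: algebra_simps)
    then show ?thesis by (simp add: Psi_first_moment[OF assms] sum_Psi[OF assms])
  qed
  have 2: "?S (\<lambda>k. (grid_pt h k - x0) $ a * (grid_pt h k - x0) $ b) =
      (x - x0) $ a * (x - x0) $ b + (if a = b then (h $ a)\<^sup>2 / 3 else 0)" for a b
  proof -
    have "?S (\<lambda>k. (grid_pt h k - x0) $ a * (grid_pt h k - x0) $ b) =
        ?S (\<lambda>k. (grid_pt h k $ a - x $ a) * (grid_pt h k $ b - x $ b))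
        + ?S (\<lambda>k. grid_pt h k $ a - x $ a) * (x $ b - x0 $ b)
        + ?S (\<lambda>k. grid_pt h k $ b - x $ b) * (x $ a - x0 $ a)
        + (\<Sum>k\<in>nodes h x. Psi h k x) * ((x $ a - x0 $ a) * (x $ b - x0 $ b))"
      unfolding sum_distrib_right sum.distrib[symmetric] by (intro sum.cong refl) (simp add: algebra_simps)
    then show ?thesis
      by (simp add: Psi_first_moment[OF assms] Psi_second_moment[OF assms] sum_Psi[OF assms])
  qed
  have "?S (\<lambda>k. quad c l Q (grid_pt h k - x0)) = (\<Sum>k\<in>nodes h x. Psi h k x) * c
      + (\<Sum>a\<in>UNIV. l a * ?S (\<lambda>k. (grid_pt h k - x0) $ a))
      + (\<Sum>a\<in>UNIV. \<Sum>b\<in>UNIV. Q a b * ?S (\<lambda>k. (grid_pt h k - x0) $ a * (grid_pt h k - x0) $ b))"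
  proof -
    have l: "(\<Sum>a\<in>UNIV. l a * ?S (\<lambda>k. (grid_pt h k - x0) $ a)) =
        ?S (\<lambda>k. \<Sum>a\<in>UNIV. l a * (grid_pt h k - x0) $ a)"
      unfolding sum_distrib_left by (subst sum.swap) (simp add: mult_ac)
    have q: "(\<Sum>a\<in>UNIV. \<Sum>b\<in>UNIV. Q a b * ?S (\<lambda>k. (grid_pt h k - x0) $ a * (grid_pt h k - x0) $ b)) =
        ?S (\<lambda>k. \<Sum>a\<in>UNIV. \<Sum>b\<in>UNIV. Q a b * ((grid_pt h k - x0) $ a * (grid_pt h k - x0) $ b))"
    proof -
      have "(\<Sum>b\<in>UNIV. Q a b * ?S (\<lambda>k. (grid_pt h k - x0) $ a * (grid_pt h k - x0) $ b)) =
          ?S (\<lambda>k. \<Sum>b\<in>UNIV. Q a b * ((grid_pt h k - x0) $ a * (grid_pt h k - x0) $ b))" for a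
        unfolding sum_distrib_left by (subst sum.swap) (simp add: mult_ac)
      then show ?thesis
        by (simp only:) (subst sum.swap, simp add: sum_distrib_left)
    qed
    show ?thesis unfolding l q quad_def by (simp add: sum_distrib_right sum.distrib ring_distribs)
  qed
  also have "\<dots> = quad c l Q (x - x0) + (\<Sum>a\<in>UNIV. Q a a * (h $ a)\<^sup>2 / 3)"
    unfolding 1 2 sum_Psi[OF assms] quad_def
    by (simp add: ring_distribs sum.distrib if_distrib[of "\<lambda>y. _ * y"] cong: if_cong)
  finally show ?thesis .
qed

lemma Pi_h_quad:
  fixes h :: "real^'d"
  assumes "\<And>j. 0 < h $ j"
  shows "Pi_h h (\<lambda>y. quad c l Q (y - x0)) x = quad c l Q (x - x0) + (\<Sum>a\<in>UNIV. Q a a * (h $ a)\<^sup>2 / 3)"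
  using sum_Psi_quad[OF assms] by (simp add: Pi_h_nodes[OF assms])

section \<open>Grid symmetries and linearity of the quasi-interpolant\<close>

lemma grid_pt_simps:
  "grid_pt h (k + m) = grid_pt h k + grid_pt h m"
  "grid_pt h (k - m) = grid_pt h k - grid_pt h m"
  by (simp_all add: grid_pt_def vec_eq_iff algebra_simps)

lemma Psi_shift: "Psi h k (x + grid_pt h m) = Psi h (k - m) x"
  by (simp add: Psi_def grid_pt_def algebra_simps)

text \<open>The reflection in a grid point maps the grid to itself, and the one-dimensional factors
  are even.\<close>

lemma Psi_reflect: "Psi h k (2 *\<^sub>R grid_pt h m - x) = Psi h (m + m - k) x"
proof -
  have "\<bar>2 * (of_int (m $ j) * h $ j) - x $ j - of_int (k $ j) * h $ j\<bar> =
        \<bar>x $ j - of_int ((m + m - k) $ j) * h $ j\<bar>" for j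
    by (subst abs_minus_cancel[symmetric]) (simp add: algebra_simps)
  then show ?thesis by (simp add: Psi_def grid_pt_def)
qed

lemma Pi_h_shift:
  "Pi_h h g (x + grid_pt h m) = Pi_h h (\<lambda>y. g (y + grid_pt h m)) x"
proof -
  have b: "bij_betw (\<lambda>k. k + m) UNIV UNIV"
    by (rule bij_betw_byWitness[where f' = "\<lambda>k. k - m"]) auto
  show ?thesis
    unfolding Pi_h_def i_h_def r_h_def
    by (subst infsum_reindex_bij_betw[OF b, symmetric]) (simp add: Psi_shift grid_pt_simps)
qed

lemma Pi_h_reflect:
  "Pi_h h g (2 *\<^sub>R grid_pt h m - x) = Pi_h h (\<lambda>y. g (2 *\<^sub>R grid_pt h m - y)) x"
proof -
  have b: "bij_betw (\<lambda>k. m + m - k) UNIV UNIV"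
    by (rule bij_betw_byWitness[where f' = "\<lambda>k. m + m - k"]) auto
  have e: "grid_pt h (m + m - k) = 2 *\<^sub>R grid_pt h m - grid_pt h k" for k
    unfolding grid_pt_simps scaleR_2 ..
  show ?thesis
    unfolding Pi_h_def i_h_def r_h_def
    by (subst infsum_reindex_bij_betw[OF b, symmetric], unfold Psi_reflect e) simp
qed

lemma Pi_h_add: "(\<And>j. 0 < h $ j) \<Longrightarrow> Pi_h h (\<lambda>y. f y + g y) x = Pi_h h f x + Pi_h h g x"
  by (simp add: Pi_h_nodes scaleR_right_distrib sum.distrib)

lemma Pi_h_diff: "(\<And>j. 0 < h $ j) \<Longrightarrow> Pi_h h (\<lambda>y. f y - g y) x = Pi_h h f x - Pi_h h g x"
  by (simp add: Pi_h_nodes scaleR_right_diff_distrib sum_subtractf)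

lemma Pi_h_component:
  "(\<And>j. 0 < h $ j) \<Longrightarrow> Pi_h h g x $ a = Pi_h h (\<lambda>y. g y $ a) x"
  by (simp add: Pi_h_nodes)

text \<open>The value is a convex combination of the coefficients at the active nodes.\<close>

lemma i_h_bound:
  assumes h: "\<And>j. 0 < h $ j" and B: "\<And>k. k \<in> nodes h x \<Longrightarrow> norm (c k) \<le> B"
  shows "norm (i_h h c x) \<le> B"
proof -
  have "norm (i_h h c x) \<le> (\<Sum>k\<in>nodes h x. Psi h k x * B)"
    unfolding i_h_nodes[OF h]
    by (intro sum_norm_le) (simp add: Psi_nonneg[OF h] B mult_left_mono)
  also have "\<dots> = B" by (simp add: sum_distrib_right[symmetric] sum_Psi[OF h])
  finally show ?thesis .
qed

section \<open>First and second differences of the basis functions\<close>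

lemma Psi_lipschitz:
  fixes h :: "real^'d" and m :: real
  assumes "\<And>j. 0 < h $ j" "0 < m" "\<And>j. m \<le> h $ j"
  shows "\<bar>Psi h k (x + s) - Psi h k x\<bar> \<le> real CARD('d) * norm s / m"
proof -
  have "norm (Psi h k (x + s) - Psi h k x) \<le>
      (\<Sum>j\<in>UNIV. norm (bspline ((x + s) $ j / h $ j - of_int (k $ j)) - bspline (x $ j / h $ j - of_int (k $ j))))"
    unfolding Psi_bspline[OF assms(1)]
    by (rule norm_prod_diff) (auto simp: bspline_nonneg bspline_le_1)
  also have "\<dots> \<le> (\<Sum>j\<in>UNIV. \<bar>s $ j\<bar> / m)"
  proof (rule sum_mono)
    fix j :: 'd
    have "norm (bspline ((x + s) $ j / h $ j - of_int (k $ j)) - bspline (x $ j / h $ j - of_int (k $ j)))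
        \<le> \<bar>s $ j / h $ j\<bar>"
      using bspline_lipschitz[of "(x + s) $ j / h $ j - of_int (k $ j)" "x $ j / h $ j - of_int (k $ j)"]
      by (simp add: add_divide_distrib)
    also have "\<dots> \<le> \<bar>s $ j\<bar> / m"
      using assms(1)[of j] assms(2) assms(3)[of j] by (simp add: frac_le)
    finally show "norm (bspline ((x + s) $ j / h $ j - of_int (k $ j)) - bspline (x $ j / h $ j - of_int (k $ j)))
        \<le> \<bar>s $ j\<bar> / m" .
  qed
  also have "\<dots> \<le> real CARD('d) * norm s / m"
    using sum_abs_le_norm[of s] assms(2) by (simp add: sum_divide_distrib[symmetric] divide_right_mono)
  finally show ?thesis by simp
qed

text \<open>A discrete Leibniz rule: the second difference of a product splits into second
  differences of the factors and products of two first differences, so every term is quadratic in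
  the \<open>r j\<close>.\<close>

lemma prod_second_diff:
  fixes p q z r :: "'i \<Rightarrow> real"
  assumes "finite J"
    and b: "\<And>j. j \<in> J \<Longrightarrow> \<bar>p j\<bar> \<le> 1 \<and> \<bar>q j\<bar> \<le> 1 \<and> \<bar>z j\<bar> \<le> 1"
    and l: "\<And>j. j \<in> J \<Longrightarrow> \<bar>p j - z j\<bar> \<le> r j \<and> \<bar>q j - z j\<bar> \<le> r j"
    and d: "\<And>j. j \<in> J \<Longrightarrow> \<bar>p j + q j - 2 * z j\<bar> \<le> 4 * (r j)\<^sup>2"
  shows "\<bar>prod p J + prod q J - 2 * prod z J\<bar> \<le> 4 * (sum r J)\<^sup>2"
  using assms
proof (induction J)
  case empty then show ?case by simp
next
  case (insert i J)
  let ?P = "prod p J" and ?M = "prod q J" and ?Z = "prod z J" and ?S = "sum r J"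
  have r: "0 \<le> r j" if "j \<in> insert i J" for j using insert.prems(2)[OF that] by linarith
  then have S: "0 \<le> ?S" by (intro sum_nonneg) auto
  have P: "\<bar>?P - ?Z\<bar> \<le> ?S"
  proof -
    have "norm (?P - ?Z) \<le> (\<Sum>j\<in>J. norm (p j - z j))" using insert.prems(1) by (intro norm_prod_diff) auto
    also have "\<dots> \<le> ?S" using insert.prems(2) by (intro sum_mono) auto
    finally show ?thesis by simp
  qed
  have M: "\<bar>?M - ?Z\<bar> \<le> ?S"
  proof -
    have "norm (?M - ?Z) \<le> (\<Sum>j\<in>J. norm (q j - z j))" using insert.prems(1) by (intro norm_prod_diff) auto
    also have "\<dots> \<le> ?S" using insert.prems(2) by (intro sum_mono) auto
    finally show ?thesis by simp
  qed
  have Z: "\<bar>?Z\<bar> \<le> 1" unfolding abs_prod using insert.prems(1) by (intro prod_le_1) auto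
  have IH: "\<bar>?P + ?M - 2 * ?Z\<bar> \<le> 4 * ?S\<^sup>2" using insert.prems by (intro insert.IH) auto
  have "prod p (insert i J) + prod q (insert i J) - 2 * prod z (insert i J) =
      z i * (?P + ?M - 2 * ?Z) + (p i - z i) * (?P - ?Z) + (q i - z i) * (?M - ?Z) + (p i + q i - 2 * z i) * ?Z"
    using insert.hyps by (simp add: algebra_simps)
  also have "\<bar>\<dots>\<bar> \<le> \<bar>z i * (?P + ?M - 2 * ?Z)\<bar> + \<bar>(p i - z i) * (?P - ?Z)\<bar> + \<bar>(q i - z i) * (?M - ?Z)\<bar> + \<bar>(p i + q i - 2 * z i) * ?Z\<bar>"
    by linarith
  also have "\<dots> \<le> 1 * (4 * ?S\<^sup>2) + r i * ?S + r i * ?S + 4 * (r i)\<^sup>2 * 1"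
    unfolding abs_mult using insert.prems[of i] P M Z IH r[of i]
    by (intro add_mono mult_mono) auto
  \<comment> \<open>The cross terms need 2 r S, and the square provides 8 r S.\<close>
  also have "\<dots> \<le> 4 * (r i + ?S)\<^sup>2"
    using mult_nonneg_nonneg[OF r[of i] S] by (simp add: power2_eq_square algebra_simps)
  finally show ?case using insert.hyps by simp
qed

lemma Psi_second_diff:
  fixes h :: "real^'d" and m :: real
  assumes "\<And>j. 0 < h $ j" "0 < m" "\<And>j. m \<le> h $ j"
  shows "\<bar>Psi h k (x + s) + Psi h k (x - s) - 2 * Psi h k x\<bar> \<le> 4 * (real CARD('d) * norm s / m)\<^sup>2"
proof -
  let ?t = "\<lambda>j. x $ j / h $ j - of_int (k $ j)" and ?r = "\<lambda>j. s $ j / h $ j"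
  have e: "(x + s) $ j / h $ j - of_int (k $ j) = ?t j + ?r j"
    "(x - s) $ j / h $ j - of_int (k $ j) = ?t j - ?r j" for j
    by (simp_all add: add_divide_distrib diff_divide_distrib)
  have "\<bar>Psi h k (x + s) + Psi h k (x - s) - 2 * Psi h k x\<bar> \<le> 4 * (\<Sum>j\<in>UNIV. \<bar>?r j\<bar>)\<^sup>2"
    unfolding Psi_bspline[OF assms(1)] e
  proof (rule prod_second_diff)
    fix j :: 'd
    show "\<bar>bspline (?t j + ?r j)\<bar> \<le> 1 \<and> \<bar>bspline (?t j - ?r j)\<bar> \<le> 1 \<and> \<bar>bspline (?t j)\<bar> \<le> 1"
      by (simp add: bspline_nonneg bspline_le_1)
    show "\<bar>bspline (?t j + ?r j) - bspline (?t j)\<bar> \<le> \<bar>?r j\<bar> \<and> \<bar>bspline (?t j - ?r j) - bspline (?t j)\<bar> \<le> \<bar>?r j\<bar>"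
      using bspline_lipschitz[of "?t j + ?r j" "?t j"] bspline_lipschitz[of "?t j - ?r j" "?t j"] by simp
    show "\<bar>bspline (?t j + ?r j) + bspline (?t j - ?r j) - 2 * bspline (?t j)\<bar> \<le> 4 * \<bar>?r j\<bar>\<^sup>2"
      using bspline_second_diff[of "?t j" "?r j"] by (simp only: power2_abs)
  qed simp
  also have "\<dots> \<le> 4 * (real CARD('d) * norm s / m)\<^sup>2"
  proof -
    have "(\<Sum>j\<in>UNIV. \<bar>?r j\<bar>) \<le> (\<Sum>j\<in>UNIV. \<bar>s $ j\<bar> / m)"
    proof (rule sum_mono)
      fix j :: 'd
      show "\<bar>?r j\<bar> \<le> \<bar>s $ j\<bar> / m" using assms(1)[of j] assms(2) assms(3)[of j] by (simp add: frac_le)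
    qed
    also have "\<dots> \<le> real CARD('d) * norm s / m"
      using sum_abs_le_norm[of s] assms(2) by (simp add: sum_divide_distrib[symmetric] divide_right_mono)
    finally show ?thesis by (intro mult_left_mono power_mono) (auto intro: sum_nonneg)
  qed
  finally show ?thesis .
qed

section \<open>The error of the quasi-interpolant\<close>

text \<open>The family \<open>G\<close> collects derivatives indexed by lists, each level being the
  gradient of the previous one. Keeping it existential makes the notion easy to transfer to
  increments of \<open>g\<close>. Only the top order is bounded, since only that order enters the
  remainders.\<close>

definition bounded_partials :: "nat \<Rightarrow> real \<Rightarrow> (real^'d \<Rightarrow> real) \<Rightarrow> bool" where
  "bounded_partials p K g \<longleftrightarrow> (\<exists>G. G [] = g \<and>
     (\<forall>\<beta> x. length \<beta> < p \<longrightarrow> (G \<beta> has_derivative (\<lambda>v. \<Sum>i\<in>UNIV. v $ i * G (i # \<beta>) x)) (at x)) \<and>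
     (\<forall>\<beta> x. length \<beta> = p \<longrightarrow> \<bar>G \<beta> x\<bar> \<le> K))"

lemma lipschitz_of_partials:
  fixes f :: "real^'d \<Rightarrow> real" and K :: real
  assumes d: "\<And>x. (f has_derivative (\<lambda>v. \<Sum>i\<in>UNIV. v $ i * D i x)) (at x)"
    and b: "\<And>i x. \<bar>D i x\<bar> \<le> (K::real)"
  shows "\<bar>f (x + z) - f x\<bar> \<le> real CARD('d) * K * norm z"
proof -
  have K: "0 \<le> K" using b[of undefined undefined] by linarith
  have "norm (f (x + z) - f x) \<le> real CARD('d) * K * norm ((x + z) - x)"
  proof (rule differentiable_bound[of UNIV f])
    fix y :: "real^'d"
    show "onorm (\<lambda>v. \<Sum>i\<in>UNIV. v $ i * D i y) \<le> real CARD('d) * K"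
    proof (rule onorm_le)
      fix v :: "real^'d"
      have "norm (\<Sum>i\<in>UNIV. v $ i * D i y) \<le> (\<Sum>i\<in>UNIV. \<bar>v $ i\<bar> * K)"
        by (rule sum_norm_le) (simp add: abs_mult b mult_left_mono)
      also have "\<dots> \<le> real CARD('d) * norm v * K"
        unfolding sum_distrib_right[symmetric] by (intro mult_right_mono sum_abs_le_norm K)
      finally show "norm (\<Sum>i\<in>UNIV. v $ i * D i y) \<le> real CARD('d) * K * norm v" by (simp add: mult_ac)
    qed
  qed (use d in auto)
  then show ?thesis by simp
qed

lemma bounded_partials_lipschitz:
  fixes g :: "real^'d \<Rightarrow> real"
  assumes "bounded_partials 1 K g" shows "\<bar>g (x + z) - g x\<bar> \<le> real CARD('d) * K * norm z"
proof -
  obtain G where G: "G [] = g" "\<And>x. (G [] has_derivative (\<lambda>v. \<Sum>i\<in>UNIV. v $ i * G [i] x)) (at x)"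
    "\<And>\<beta> x. length \<beta> = 1 \<Longrightarrow> \<bar>G \<beta> x\<bar> \<le> K"
    using assms unfolding bounded_partials_def by fastforce
  show ?thesis
    using lipschitz_of_partials[OF G(2), of K x z] G(3) by (simp add: G(1))
qed

lemma bounded_partials_nonneg: "bounded_partials p K g \<Longrightarrow> 0 \<le> K" for g :: "real^'d \<Rightarrow> real"
proof -
  assume "bounded_partials p K g"
  then obtain G :: "'d list \<Rightarrow> real^'d \<Rightarrow> real" where "\<And>\<beta> x. length \<beta> = p \<Longrightarrow> \<bar>G \<beta> x\<bar> \<le> K"
    unfolding bounded_partials_def by blast
  from this[of "replicate p undefined" undefined] show ?thesis by simp
qed

text \<open>An increment over \<open>z\<close> trades one order of smoothness for a factor |z|. This
  is the source of the powers of |s| in the consistency bounds.\<close>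

lemma bounded_partials_diff:
  fixes g :: "real^'d \<Rightarrow> real"
  assumes "bounded_partials (Suc p) K g"
  shows "bounded_partials p (real CARD('d) * K * norm z) (\<lambda>x. g (x + z) - g x)"
proof -
  obtain G where G: "G [] = g"
    "\<And>\<beta> x. length \<beta> < Suc p \<Longrightarrow> (G \<beta> has_derivative (\<lambda>v. \<Sum>i\<in>UNIV. v $ i * G (i # \<beta>) x)) (at x)"
    "\<And>\<beta> x. length \<beta> = Suc p \<Longrightarrow> \<bar>G \<beta> x\<bar> \<le> K"
    using assms unfolding bounded_partials_def by blast
  let ?G = "\<lambda>\<beta> x. G \<beta> (x + z) - G \<beta> x"
  have "(?G \<beta> has_derivative (\<lambda>v. \<Sum>i\<in>UNIV. v $ i * ?G (i # \<beta>) x)) (at x)" if "length \<beta> < p" for \<beta> x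
  proof -
    have "((\<lambda>x. G \<beta> (x + z)) has_derivative (\<lambda>v. \<Sum>i\<in>UNIV. v $ i * G (i # \<beta>) (x + z))) (at x)"
      using G(2)[of \<beta> "x + z"] that
      by (intro has_derivative_compose[of "\<lambda>x. x + z" "\<lambda>v. v", where g = "G \<beta>"]) (auto intro!: derivative_eq_intros)
    from has_derivative_diff[OF this G(2)[of \<beta> x]] that
    show ?thesis by (simp add: sum_subtractf[symmetric] right_diff_distrib)
  qed
  moreover have "\<bar>?G \<beta> x\<bar> \<le> real CARD('d) * K * norm z" if "length \<beta> = p" for \<beta> x
    using that G(2,3) by (intro lipschitz_of_partials[of "G \<beta>" "\<lambda>i. G (i # \<beta>)"]) auto
  ultimately show ?thesis unfolding bounded_partials_def using G(1) by (intro exI[of _ ?G]) auto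
qed

text \<open>The \<open>m\<close>-fold directional derivative of \<open>G \<beta>\<close> along
  \<open>y\<close>, written as a sum over all words of \<open>m\<close> coordinates.\<close>

primrec line_sum :: "('d::finite list \<Rightarrow> real^'d \<Rightarrow> real) \<Rightarrow> real^'d \<Rightarrow> nat \<Rightarrow> 'd list \<Rightarrow> real^'d \<Rightarrow> real" where
  "line_sum G y 0 \<beta> x = G \<beta> x"
| "line_sum G y (Suc m) \<beta> x = (\<Sum>i\<in>UNIV. y $ i * line_sum G y m (i # \<beta>) x)"

lemma line_sum_deriv:
  assumes "\<And>\<beta> x. length \<beta> < p \<Longrightarrow> (G \<beta> has_derivative (\<lambda>v. \<Sum>i\<in>UNIV. v $ i * G (i # \<beta>) x)) (at x)"
    and "length \<beta> + m < p"
  shows "((\<lambda>t. line_sum G y m \<beta> (x + t *\<^sub>R y)) has_real_derivative line_sum G y (Suc m) \<beta> (x + t *\<^sub>R y)) (at t)"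
  using assms(2)
proof (induction m arbitrary: \<beta>)
  case 0
  have "((\<lambda>t. G \<beta> (x + t *\<^sub>R y)) has_derivative
      (\<lambda>s. \<Sum>i\<in>UNIV. (s *\<^sub>R y) $ i * G (i # \<beta>) (x + t *\<^sub>R y))) (at t)"
    using assms(1)[of \<beta> "x + t *\<^sub>R y"] 0
    by (intro has_derivative_compose[where g = "G \<beta>" and f = "\<lambda>t. x + t *\<^sub>R y"])
      (auto intro!: derivative_eq_intros)
  moreover have "(\<lambda>s. \<Sum>i\<in>UNIV. (s *\<^sub>R y) $ i * G (i # \<beta>) (x + t *\<^sub>R y)) = (*) (line_sum G y (Suc 0) \<beta> (x + t *\<^sub>R y))"
    by (simp add: fun_eq_iff sum_distrib_left mult_ac)
  ultimately show ?case unfolding has_field_derivative_def by simp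
next
  case (Suc m)
  have "((\<lambda>t. \<Sum>i\<in>UNIV. y $ i * line_sum G y m (i # \<beta>) (x + t *\<^sub>R y)) has_real_derivative
      (\<Sum>i\<in>UNIV. y $ i * line_sum G y (Suc m) (i # \<beta>) (x + t *\<^sub>R y))) (at t)"
    using Suc by (intro DERIV_sum DERIV_cmult) auto
  then show ?case by simp
qed

lemma line_sum_bound:
  assumes "\<And>\<gamma>. length \<gamma> = length \<beta> + m \<Longrightarrow> \<bar>G \<gamma> x\<bar> \<le> K"
  shows "\<bar>line_sum G y m \<beta> x\<bar> \<le> (\<Sum>i\<in>UNIV. \<bar>y $ i\<bar>) ^ m * K"
  using assms
proof (induction m arbitrary: \<beta>)
  case (Suc m)
  have "\<bar>line_sum G y (Suc m) \<beta> x\<bar> \<le> (\<Sum>i\<in>UNIV. \<bar>y $ i\<bar> * \<bar>line_sum G y m (i # \<beta>) x\<bar>)"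
    using sum_abs[of "\<lambda>i. y $ i * line_sum G y m (i # \<beta>) x" UNIV] by (simp add: abs_mult)
  also have "\<dots> \<le> (\<Sum>i\<in>UNIV. \<bar>y $ i\<bar> * ((\<Sum>i\<in>UNIV. \<bar>y $ i\<bar>) ^ m * K))"
    using Suc.prems by (intro sum_mono mult_left_mono Suc.IH) auto
  also have "\<dots> = (\<Sum>i\<in>UNIV. \<bar>y $ i\<bar>) ^ Suc m * K"
    unfolding sum_distrib_right[symmetric] by (simp add: mult_ac)
  finally show ?case .
qed simp

lemma line_sum_minus: "line_sum G (- y) m \<beta> x = (- 1) ^ m * line_sum G y m \<beta> x"
  by (induction m arbitrary: \<beta>) (simp_all add: sum_distrib_left mult_ac sum_negf)

text \<open>Maclaurin's theorem for t -> g (x + t y), with g = \<open>G []\<close>; the factorial in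
  the remainder is dropped.\<close>

lemma taylor_line:
  fixes G :: "'d::finite list \<Rightarrow> real^'d \<Rightarrow> real"
  assumes d: "\<And>\<beta> x. length \<beta> < p \<Longrightarrow> (G \<beta> has_derivative (\<lambda>v. \<Sum>i\<in>UNIV. v $ i * G (i # \<beta>) x)) (at x)"
    and b: "\<And>\<beta> x. length \<beta> = p \<Longrightarrow> \<bar>G \<beta> x\<bar> \<le> K" and p: "0 < p"
  shows "\<bar>G [] (x + y) - (\<Sum>m<p. line_sum G y m [] x / fact m)\<bar> \<le> (real CARD('d) * norm y) ^ p * K"
proof -
  let ?F = "\<lambda>m t. line_sum G y m [] (x + t *\<^sub>R y)"
  have "\<exists>t>0. t < 1 \<and> ?F 0 1 = (\<Sum>m<p. ?F m 0 / fact m * 1 ^ m) + ?F p t / fact p * 1 ^ p"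
    by (rule Maclaurin) (use p line_sum_deriv[OF d] in auto)
  then obtain t where "G [] (x + y) - (\<Sum>m<p. line_sum G y m [] x / fact m) = ?F p t / fact p" by auto
  moreover have "\<bar>?F p t / fact p\<bar> \<le> \<bar>?F p t\<bar> / 1"
    unfolding abs_divide by (intro divide_left_mono) auto
  moreover have "\<bar>?F p t\<bar> \<le> (\<Sum>i\<in>UNIV. \<bar>y $ i\<bar>) ^ p * K" by (rule line_sum_bound) (use b in auto)
  moreover have "(\<Sum>i\<in>UNIV. \<bar>y $ i\<bar>) ^ p * K \<le> (real CARD('d) * norm y) ^ p * K"
    using b[of "replicate p undefined" undefined]
    by (intro mult_right_mono power_mono sum_abs_le_norm) (auto intro: sum_nonneg)
  ultimately show ?thesis by linarith
qed

lemma taylor_linear: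
  fixes g :: "real^'d \<Rightarrow> real"
  assumes "bounded_partials 2 K g"
  obtains l where "\<And>y. \<bar>g (x + y) - quad (g x) l (\<lambda>_ _. 0) y\<bar> \<le> (real CARD('d) * norm y)\<^sup>2 * K"
proof -
  obtain G where G: "G [] = g"
    "\<And>\<beta> x. length \<beta> < 2 \<Longrightarrow> (G \<beta> has_derivative (\<lambda>v. \<Sum>i\<in>UNIV. v $ i * G (i # \<beta>) x)) (at x)"
    "\<And>\<beta> x. length \<beta> = 2 \<Longrightarrow> \<bar>G \<beta> x\<bar> \<le> K"
    using assms unfolding bounded_partials_def by blast
  have "\<bar>G [] (x + y) - (\<Sum>m<2. line_sum G y m [] x / fact m)\<bar> \<le> (real CARD('d) * norm y)\<^sup>2 * K" for y
    by (rule taylor_line) (use G in auto)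
  moreover have "(\<Sum>m<2. line_sum G y m [] x / fact m) = quad (g x) (\<lambda>i. G [i] x) (\<lambda>_ _. 0) y" for y
    by (simp add: numeral_2_eq_2 quad_def G(1) mult.commute)
  ultimately show thesis
    by (intro that[of "\<lambda>i. G [i] x"]) (simp add: G(1))
qed

lemma taylor_quadratic:
  fixes g :: "real^'d \<Rightarrow> real"
  assumes "bounded_partials 3 K g"
  obtains l Q where "\<And>y. \<bar>g (x + y) - quad (g x) l Q y\<bar> \<le> (real CARD('d) * norm y) ^ 3 * K"
proof -
  obtain G where G: "G [] = g"
    "\<And>\<beta> x. length \<beta> < 3 \<Longrightarrow> (G \<beta> has_derivative (\<lambda>v. \<Sum>i\<in>UNIV. v $ i * G (i # \<beta>) x)) (at x)"
    "\<And>\<beta> x. length \<beta> = 3 \<Longrightarrow> \<bar>G \<beta> x\<bar> \<le> K"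
    using assms unfolding bounded_partials_def by blast
  have "(\<Sum>m<3. line_sum G y m [] x / fact m) = quad (g x) (\<lambda>i. G [i] x) (\<lambda>i j. G [j, i] x / 2) y" for y
    by (simp add: numeral_3_eq_3 quad_def G(1) sum_distrib_left sum_divide_distrib mult_ac)
  moreover have "\<bar>G [] (x + y) - (\<Sum>m<3. line_sum G y m [] x / fact m)\<bar> \<le> (real CARD('d) * norm y) ^ 3 * K" for y
    by (rule taylor_line) (use G in auto)
  ultimately show thesis
    by (intro that[of "\<lambda>i. G [i] x" "\<lambda>i j. G [j, i] x / 2"]) (simp add: G(1))
qed

text \<open>In g (x + y) + g (x - y) the terms of degree one and three cancel, so a quadratic
  polynomial already leaves a fourth-order remainder.\<close>

lemma taylor_even:
  fixes g :: "real^'d \<Rightarrow> real"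
  assumes "bounded_partials 4 K g"
  obtains Q where "\<And>y. \<bar>g (x + y) + g (x - y) - quad (2 * g x) (\<lambda>_. 0) Q y\<bar> \<le> 2 * ((real CARD('d) * norm y) ^ 4 * K)"
proof -
  obtain G where G: "G [] = g"
    "\<And>\<beta> x. length \<beta> < 4 \<Longrightarrow> (G \<beta> has_derivative (\<lambda>v. \<Sum>i\<in>UNIV. v $ i * G (i # \<beta>) x)) (at x)"
    "\<And>\<beta> x. length \<beta> = 4 \<Longrightarrow> \<bar>G \<beta> x\<bar> \<le> K"
    using assms unfolding bounded_partials_def by blast
  let ?T = "\<lambda>y. \<Sum>m<4. line_sum G y m [] x / fact m"
  have T: "?T y = line_sum G y 0 [] x + line_sum G y 1 [] x + line_sum G y 2 [] x / 2 + line_sum G y 3 [] x / 6" for y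
    by (simp add: eval_nat_numeral)
  have m: "line_sum G (- y) 1 [] x = - line_sum G y 1 [] x" "line_sum G (- y) 2 [] x = line_sum G y 2 [] x"
    "line_sum G (- y) 3 [] x = - line_sum G y 3 [] x" for y
    by (simp_all only: line_sum_minus) simp_all
  have q: "?T y + ?T (- y) = quad (2 * g x) (\<lambda>_. 0) (\<lambda>i j. G [j, i] x) y" for y
    unfolding T m by (simp add: numeral_2_eq_2 quad_def G(1) sum_distrib_left mult_ac)
  show thesis
  proof (rule that)
    fix y
    have T: "\<bar>G [] (x + y) - ?T y\<bar> \<le> (real CARD('d) * norm y) ^ 4 * K" for y
      by (rule taylor_line) (use G in auto)
    have "\<bar>g (x + y) - ?T y\<bar> \<le> (real CARD('d) * norm y) ^ 4 * K"
      using T[of y] by (simp add: G(1))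
    moreover have "\<bar>g (x - y) - ?T (- y)\<bar> \<le> (real CARD('d) * norm y) ^ 4 * K"
      using T[of "- y"] by (simp add: G(1))
    ultimately show "\<bar>g (x + y) + g (x - y) - quad (2 * g x) (\<lambda>_. 0) (\<lambda>i j. G [j, i] x) y\<bar> \<le> 2 * ((real CARD('d) * norm y) ^ 4 * K)"
      unfolding q[symmetric] by linarith
  qed
qed

lemma abs_combine: "2 * a = P - p - q + 2 * r \<Longrightarrow> 2 * \<bar>a\<bar> \<le> \<bar>P\<bar> + \<bar>p\<bar> + \<bar>q\<bar> + 2 * \<bar>r\<bar>" for a :: real
  by linarith

text \<open>\<open>H\<close> is the mesh width and \<open>c\<close> the shape-regularity constant.
  The constants defined in this locale depend on \<open>c\<close> and the dimension, besides their
  explicit arguments, but never on \<open>h\<close> or \<open>H\<close>; this is what lets a single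
  constant serve all meshes.\<close>

locale mesh =
  fixes h :: "real^'d" and c H :: real
  assumes c_pos: "0 < c" and H_pos: "0 < H"
    and h_ge: "\<And>j. c * H \<le> h $ j" and h_le: "\<And>j. h $ j \<le> H"
begin

lemma cH_pos: "0 < c * H" using c_pos H_pos by simp

lemma h_pos: "0 < h $ j" using cH_pos h_ge[of j] by linarith

lemma d_ge_1: "1 \<le> real CARD('d)" by (simp add: Suc_leI)

definition interp_error :: "(real^'d \<Rightarrow> real) \<Rightarrow> real^'d \<Rightarrow> real" where
  "interp_error g x = Pi_h h g x - g x"

text \<open>An inverse estimate: differencing the basis costs |s| / (c H). It pays off when the
  nodal values are small, as Taylor remainders near \<open>x\<close> are. The factor 2 * 4^d counts
  the nodes active at the two points.\<close>

lemma Pi_first_diff: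
  assumes "\<And>k. k \<in> nodes h x \<union> nodes h (x + s) \<Longrightarrow> \<bar>f (grid_pt h k)\<bar> \<le> B"
  shows "\<bar>Pi_h h f (x + s) - Pi_h h f x\<bar> \<le> 2 * 4 ^ CARD('d) * (real CARD('d) * norm s / (c * H)) * B"
proof -
  let ?F = "nodes h x \<union> nodes h (x + s)"
  have B: "0 \<le> B"
  proof -
    have "nodes h x \<noteq> {}" using card_nodes[of h x] by auto
    then show ?thesis using assms by fastforce
  qed
  have cF: "real (card ?F) \<le> 2 * 4 ^ CARD('d)"
    using card_Un_le[of "nodes h x" "nodes h (x + s)"] by (simp add: card_nodes flip: of_nat_le_iff[where 'a=real])
  have "Pi_h h f (x + s) - Pi_h h f x = (\<Sum>k\<in>?F. (Psi h k (x + s) - Psi h k x) * f (grid_pt h k))"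
    by (simp add: Pi_h_superset[OF h_pos, of ?F] sum_subtractf left_diff_distrib)
  also have "\<bar>\<dots>\<bar> \<le> (\<Sum>k\<in>?F. (real CARD('d) * norm s / (c * H)) * B)"
    unfolding real_norm_def[symmetric]
  proof (rule sum_norm_le)
    fix k assume k: "k \<in> ?F"
    show "norm ((Psi h k (x + s) - Psi h k x) * f (grid_pt h k)) \<le> (real CARD('d) * norm s / (c * H)) * B"
      unfolding norm_mult using Psi_lipschitz[OF h_pos cH_pos h_ge, of k x s] assms[OF k]
      by (intro mult_mono) (auto simp: B)
  qed
  also have "\<dots> \<le> 2 * 4 ^ CARD('d) * ((real CARD('d) * norm s / (c * H)) * B)"
    using cF B cH_pos by (simp only: sum_constant) (intro mult_right_mono, auto)
  finally show ?thesis by (simp add: mult_ac)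
qed

lemma Pi_second_diff:
  assumes "\<And>k. k \<in> nodes h x \<union> nodes h (x + s) \<union> nodes h (x - s) \<Longrightarrow> \<bar>f (grid_pt h k)\<bar> \<le> B"
  shows "\<bar>Pi_h h f (x + s) + Pi_h h f (x - s) - 2 * Pi_h h f x\<bar> \<le>
    3 * 4 ^ CARD('d) * (4 * (real CARD('d) * norm s / (c * H))\<^sup>2) * B"
proof -
  let ?F = "nodes h x \<union> nodes h (x + s) \<union> nodes h (x - s)"
  have B: "0 \<le> B"
  proof -
    have "nodes h x \<noteq> {}" using card_nodes[of h x] by auto
    then show ?thesis using assms by fastforce
  qed
  have cF: "real (card ?F) \<le> 3 * 4 ^ CARD('d)"
    using card_Un_le[of "nodes h x" "nodes h (x + s)"] card_Un_le[of "nodes h x \<union> nodes h (x + s)" "nodes h (x - s)"]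
    by (simp add: card_nodes flip: of_nat_le_iff[where 'a=real])
  have "Pi_h h f (x + s) + Pi_h h f (x - s) - 2 * Pi_h h f x =
      (\<Sum>k\<in>?F. (Psi h k (x + s) + Psi h k (x - s) - 2 * Psi h k x) * f (grid_pt h k))"
    by (subst (1 2 3) Pi_h_superset[OF h_pos, of ?F])
      (auto simp: sum_subtractf sum.distrib sum_distrib_left algebra_simps)
  also have "\<bar>\<dots>\<bar> \<le> (\<Sum>k\<in>?F. (4 * (real CARD('d) * norm s / (c * H))\<^sup>2) * B)"
    unfolding real_norm_def[symmetric]
  proof (rule sum_norm_le)
    fix k assume k: "k \<in> ?F"
    show "norm ((Psi h k (x + s) + Psi h k (x - s) - 2 * Psi h k x) * f (grid_pt h k)) \<le> (4 * (real CARD('d) * norm s / (c * H))\<^sup>2) * B"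
      unfolding norm_mult using Psi_second_diff[OF h_pos cH_pos h_ge, of k x s] assms[OF k]
      by (intro mult_mono) (auto simp: B)
  qed
  also have "\<dots> \<le> 3 * 4 ^ CARD('d) * ((4 * (real CARD('d) * norm s / (c * H))\<^sup>2) * B)"
    using cF B by (simp only: sum_constant) (intro mult_right_mono, auto)
  finally show ?thesis by (simp add: mult_ac)
qed

lemma nodes_norm: "k \<in> nodes h x \<Longrightarrow> norm (grid_pt h k - x) \<le> 2 * real CARD('d) * H"
  using nodes_dist[OF h_pos h_le, of k x] by simp

text \<open>Since \<Pi> commutes with grid shifts, the increment of the error is the error of the
  increment, which gains a factor |x_m| by \<open>bounded_partials_diff\<close>.\<close>

lemma interp_error_shift: "interp_error g (x + grid_pt h m) - interp_error g x = interp_error (\<lambda>y. g (y + grid_pt h m) - g y) x"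
  by (simp add: interp_error_def Pi_h_shift Pi_h_diff[OF h_pos])

lemma interp_error_add: "interp_error (\<lambda>y. f y + g y) x = interp_error f x + interp_error g x"
  by (simp add: interp_error_def Pi_h_add[OF h_pos])

lemma interp_error_second_diff_eq:
  "interp_error f (x + s) + interp_error f (x - s) - 2 * interp_error f x =
    (Pi_h h f (x + s) + Pi_h h f (x - s) - 2 * Pi_h h f x) - f (x + s) - f (x - s) + 2 * f x"
  by (simp add: interp_error_def)

lemma interp_error_quad: "interp_error (\<lambda>y. quad a l Q (y - x0)) x = (\<Sum>a\<in>UNIV. Q a a * (h $ a)\<^sup>2 / 3)"
  by (simp add: interp_error_def Pi_h_quad[OF h_pos])

text \<open>The linear Taylor polynomial at \<open>x\<close> is reproduced exactly, and active nodes
  lie within 2 d H of \<open>x\<close>; hence the constant (d * 2 d)^2 = 4 d^4.\<close>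

lemma interp_error_bound:
  assumes "bounded_partials 2 K g"
  shows "\<bar>interp_error g x\<bar> \<le> 4 * real CARD('d) ^ 4 * H\<^sup>2 * K"
proof -
  note K = bounded_partials_nonneg[OF assms]
  obtain l where l: "\<And>y. \<bar>g (x + y) - quad (g x) l (\<lambda>_ _. 0) y\<bar> \<le> (real CARD('d) * norm y)\<^sup>2 * K"
    using taylor_linear[OF assms, of x] by blast
  let ?q = "\<lambda>y. quad (g x) l (\<lambda>_ _. 0) (y - x)"
  have "Pi_h h ?q x = g x" unfolding Pi_h_quad[OF h_pos] by (simp add: quad_def)
  then have "interp_error g x = Pi_h h (\<lambda>y. g y - ?q y) x" by (simp add: interp_error_def Pi_h_diff[OF h_pos])
  moreover have "norm (Pi_h h (\<lambda>y. g y - ?q y) x) \<le> (real CARD('d) * (2 * real CARD('d) * H))\<^sup>2 * K"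
    unfolding Pi_h_def
  proof (rule i_h_bound[OF h_pos])
    fix k assume "k \<in> nodes h x"
    then have "(real CARD('d) * norm (grid_pt h k - x))\<^sup>2 * K \<le> (real CARD('d) * (2 * real CARD('d) * H))\<^sup>2 * K"
      using nodes_norm K by (intro mult_right_mono power_mono mult_left_mono) auto
    then show "norm (r_h h (\<lambda>y. g y - ?q y) k) \<le> (real CARD('d) * (2 * real CARD('d) * H))\<^sup>2 * K"
      using l[of "grid_pt h k - x"] by (simp add: r_h_def)
  qed
  moreover have "(real CARD('d) * (2 * real CARD('d) * H))\<^sup>2 * K = 4 * real CARD('d) ^ 4 * H\<^sup>2 * K" by (simp add: power_mult_distrib power_add[symmetric] eval_nat_numeral)
  ultimately show ?thesis by simp
qed

text \<open>54 = 2 * 3^3 combines the two node sets with nodes within 3 d H; the summand d^5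
  accounts for the Taylor remainder at the shifted point itself.\<close>

definition lip_const_near :: real where "lip_const_near = 54 * 4 ^ CARD('d) * real CARD('d) ^ 7 / c + real CARD('d) ^ 5"

text \<open>The error of the quadratic Taylor polynomial is constant and drops out. The remainder is
  of order H^3 at the nodes involved, and the inverse estimate turns one factor H into |s|.\<close>

lemma interp_error_lipschitz_near:
  assumes "bounded_partials 3 K g" "norm s \<le> real CARD('d) * H"
  shows "\<bar>interp_error g (x + s) - interp_error g x\<bar> \<le> lip_const_near * H\<^sup>2 * norm s * K"
proof -
  note K = bounded_partials_nonneg[OF assms(1)]
  obtain l Q where q: "\<And>y. \<bar>g (x + y) - quad (g x) l Q y\<bar> \<le> (real CARD('d) * norm y) ^ 3 * K"
    using taylor_quadratic[OF assms(1), of x] by blast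
  let ?q = "\<lambda>y. quad (g x) l Q (y - x)" and ?R = "\<lambda>y. g y - quad (g x) l Q (y - x)"
  have R: "\<bar>?R y\<bar> \<le> (real CARD('d) * norm (y - x)) ^ 3 * K" for y using q[of "y - x"] by simp
  have "interp_error g y = interp_error ?R y + interp_error ?q y" for y unfolding interp_error_add[symmetric] by simp
  then have "interp_error g (x + s) - interp_error g x = interp_error ?R (x + s) - interp_error ?R x" by (simp add: interp_error_quad)
  \<comment> \<open>The remainder vanishes at the expansion point \<open>x\<close>, so only its
    value at x + s is left.\<close>
  also have "\<dots> = (Pi_h h ?R (x + s) - Pi_h h ?R x) - ?R (x + s)"
    unfolding interp_error_def by (simp add: quad_def)
  finally have e: "\<bar>interp_error g (x + s) - interp_error g x\<bar> \<le> \<bar>Pi_h h ?R (x + s) - Pi_h h ?R x\<bar> + \<bar>?R (x + s)\<bar>" by linarith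
  have "\<bar>Pi_h h ?R (x + s) - Pi_h h ?R x\<bar> \<le> 2 * 4 ^ CARD('d) * (real CARD('d) * norm s / (c * H)) * ((real CARD('d) * (3 * real CARD('d) * H)) ^ 3 * K)"
  proof (rule Pi_first_diff)
    fix k assume "k \<in> nodes h x \<union> nodes h (x + s)"
    then have "norm (grid_pt h k - x) \<le> 2 * real CARD('d) * H \<or> norm (grid_pt h k - (x + s)) \<le> 2 * real CARD('d) * H"
      using nodes_norm by blast
    moreover have "norm (grid_pt h k - x) \<le> norm (grid_pt h k - (x + s)) + norm s"
      using norm_triangle_ineq[of "grid_pt h k - (x + s)" s] by simp
    moreover have "0 \<le> real CARD('d) * H" using H_pos by simp
    ultimately have "norm (grid_pt h k - x) \<le> 3 * real CARD('d) * H" using assms(2) by linarith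
    then have "(real CARD('d) * norm (grid_pt h k - x)) ^ 3 * K \<le> (real CARD('d) * (3 * real CARD('d) * H)) ^ 3 * K"
      using K by (intro mult_right_mono power_mono mult_left_mono) auto
    with R[of "grid_pt h k"] show "\<bar>?R (grid_pt h k)\<bar> \<le> (real CARD('d) * (3 * real CARD('d) * H)) ^ 3 * K" by linarith
  qed
  also have "\<dots> = 54 * 4 ^ CARD('d) * real CARD('d) ^ 7 / c * H\<^sup>2 * norm s * K"
    using c_pos H_pos by (simp add: field_simps eval_nat_numeral)
  finally have p: "\<bar>Pi_h h ?R (x + s) - Pi_h h ?R x\<bar> \<le> 54 * 4 ^ CARD('d) * real CARD('d) ^ 7 / c * H\<^sup>2 * norm s * K" .
  have "\<bar>?R (x + s)\<bar> \<le> (real CARD('d) * norm s) ^ 3 * K" using R[of "x + s"] by simp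
  also have "(real CARD('d) * norm s) ^ 3 * K = real CARD('d) ^ 3 * norm s * K * (norm s)\<^sup>2" by (simp add: power_mult_distrib eval_nat_numeral)
  also have "\<dots> \<le> real CARD('d) ^ 3 * norm s * K * (real CARD('d) * H)\<^sup>2"
    using assms(2) K by (intro mult_left_mono power_mono) auto
  also have "\<dots> = real CARD('d) ^ 5 * H\<^sup>2 * norm s * K" by (simp add: power_mult_distrib eval_nat_numeral)
  finally show ?thesis using e p unfolding lip_const_near_def by (simp add: algebra_simps)
qed

text \<open>For |s| \<le> H the grid part is 0: rounding down could leave a remainder of size H that
  |s| does not control, for instance for a slightly negative coordinate. Longer shifts are rounded
  down coordinatewise. The near estimates need |r| of order H, the gain in |s| needs |r| of order
  |s|.\<close>

lemma grid_decomp: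
  obtains m r where "s = grid_pt h m + r" "norm r \<le> real CARD('d) * H" "norm r \<le> real CARD('d) * norm s" "norm (grid_pt h m) \<le> (real CARD('d) + 1) * norm s"
proof (cases "norm s \<le> H")
  case True
  have "s = grid_pt h 0 + s" by (simp add: grid_pt_def vec_eq_iff)
  moreover have "norm s \<le> real CARD('d) * H"
    using mult_mono[OF d_ge_1 True] H_pos by (simp only: mult_1) auto
  moreover have "norm s \<le> real CARD('d) * norm s"
    using mult_right_mono[OF d_ge_1, of "norm s"] by (simp only: mult_1) auto
  moreover have "grid_pt h 0 = 0" by (simp add: grid_pt_def vec_eq_iff)
  ultimately show thesis using that[of 0 s] by simp
next
  case False
  define m :: "int^'d" where "m = (\<chi> j. \<lfloor>s $ j / h $ j\<rfloor>)"
  define r where "r = s - grid_pt h m"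
  have r: "norm r \<le> real CARD('d) * H"
  proof (rule norm_le_card)
    fix j
    have "r $ j = (s $ j / h $ j - of_int \<lfloor>s $ j / h $ j\<rfloor>) * h $ j"
      using h_pos[of j] by (simp add: r_def m_def grid_pt_def field_simps)
    moreover have "\<bar>s $ j / h $ j - of_int \<lfloor>s $ j / h $ j\<rfloor>\<bar> \<le> 1" by linarith
    ultimately have "\<bar>r $ j\<bar> \<le> 1 * h $ j" using h_pos[of j] by (simp add: abs_mult mult_right_mono)
    with h_le[of j] show "\<bar>r $ j\<bar> \<le> H" by simp
  qed
  moreover have "norm r \<le> real CARD('d) * norm s"
  proof -
    have "real CARD('d) * H \<le> real CARD('d) * norm s" using False by (intro mult_left_mono) auto
    with r show ?thesis by linarith
  qed
  moreover have "norm (grid_pt h m) \<le> norm s + norm r"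
    using norm_triangle_ineq4[of s r] by (simp add: r_def)
  moreover have "s = grid_pt h m + r" by (simp add: r_def)
  ultimately show thesis using that[of m r] by (simp add: algebra_simps)
qed

definition lip_const :: real where "lip_const = 4 * real CARD('d) ^ 5 * (real CARD('d) + 1) + lip_const_near * real CARD('d)"

lemma lip_const_near_nonneg: "0 \<le> lip_const_near" using c_pos by (simp add: lip_const_near_def)
lemma lip_const_nonneg: "0 \<le> lip_const" using lip_const_near_nonneg by (simp add: lip_const_def)

text \<open>The grid part of the shift is moved onto \<open>g\<close>, whose increment has small
  second derivatives; the remainder of mesh size is left to the near estimate. The two summands of
  \<open>lip_const\<close> are these two contributions.\<close>

lemma interp_error_lipschitz:
  assumes "bounded_partials 3 K g"
  shows "\<bar>interp_error g (x + s) - interp_error g x\<bar> \<le> lip_const * H\<^sup>2 * norm s * K"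
proof -
  note K = bounded_partials_nonneg[OF assms]
  obtain m r where r: "s = grid_pt h m + r" "norm r \<le> real CARD('d) * H" "norm r \<le> real CARD('d) * norm s" "norm (grid_pt h m) \<le> (real CARD('d) + 1) * norm s"
    by (rule grid_decomp)
  have "bounded_partials 2 (real CARD('d) * K * norm (grid_pt h m)) (\<lambda>y. g (y + grid_pt h m) - g y)"
    using bounded_partials_diff[of 2 K g] assms by (simp add: eval_nat_numeral)
  then have "\<bar>interp_error g (x + r + grid_pt h m) - interp_error g (x + r)\<bar> \<le> 4 * real CARD('d) ^ 4 * H\<^sup>2 * (real CARD('d) * K * norm (grid_pt h m))"
    unfolding interp_error_shift by (rule interp_error_bound)
  also have "\<dots> \<le> 4 * real CARD('d) ^ 4 * H\<^sup>2 * (real CARD('d) * K * ((real CARD('d) + 1) * norm s))"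
    using r(4) K by (intro mult_left_mono) auto
  finally have 1: "\<bar>interp_error g (x + s) - interp_error g (x + r)\<bar> \<le> 4 * real CARD('d) ^ 4 * H\<^sup>2 * (real CARD('d) * K * ((real CARD('d) + 1) * norm s))"
    by (simp add: r(1) add_ac)
  have "\<bar>interp_error g (x + r) - interp_error g x\<bar> \<le> lip_const_near * H\<^sup>2 * norm r * K"
    by (rule interp_error_lipschitz_near[OF assms r(2)])
  also have "\<dots> \<le> lip_const_near * H\<^sup>2 * (real CARD('d) * norm s) * K"
    using r(3) K lip_const_near_nonneg by (intro mult_left_mono mult_right_mono) auto
  finally have "\<bar>interp_error g (x + s) - interp_error g x\<bar> \<le> 4 * real CARD('d) ^ 4 * H\<^sup>2 * (real CARD('d) * K * ((real CARD('d) + 1) * norm s)) + lip_const_near * H\<^sup>2 * (real CARD('d) * norm s) * K"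
    using 1 by linarith
  also have "\<dots> = lip_const * H\<^sup>2 * norm s * K" by (simp add: lip_const_def algebra_simps eval_nat_numeral)
  finally show ?thesis .
qed

text \<open>972 is half of 3 * 4 * 2 * 3^4: three node sets, the 4 of the second difference of the
  basis, the 2 of the even Taylor remainder, and nodes within 3 d H. The halving undoes the
  symmetrisation.\<close>

definition second_diff_const_near :: real where "second_diff_const_near = 972 * 4 ^ CARD('d) * real CARD('d) ^ 10 / c\<^sup>2 + 2 * real CARD('d) ^ 6"

lemma second_diff_const_near_nonneg: "0 \<le> second_diff_const_near" by (simp add: second_diff_const_near_def)

text \<open>At a grid point \<open>x\<close> the reflection y -> 2 x - y commutes with \<Pi>, so
  \<open>g\<close> may be replaced by its even part about \<open>x\<close>. That part agrees with a
  quadratic up to fourth order, and two factors H are then traded for |s|^2 by differencing the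
  basis.\<close>

lemma interp_error_second_diff_near:
  assumes "bounded_partials 4 K g" "norm s \<le> real CARD('d) * H" and x: "x = grid_pt h m"
  shows "\<bar>interp_error g (x + s) + interp_error g (x - s) - 2 * interp_error g x\<bar> \<le> second_diff_const_near * H\<^sup>2 * (norm s)\<^sup>2 * K"
proof -
  note K = bounded_partials_nonneg[OF assms(1)]
  obtain Q where q: "\<And>y. \<bar>g (x + y) + g (x - y) - quad (2 * g x) (\<lambda>_. 0) Q y\<bar> \<le> 2 * ((real CARD('d) * norm y) ^ 4 * K)"
    using taylor_even[OF assms(1), of x] by blast
  let ?u = "\<lambda>y. g y + g (2 *\<^sub>R x - y)" and ?q = "\<lambda>y. quad (2 * g x) (\<lambda>_. 0) Q (y - x)"
  let ?R = "\<lambda>y. ?u y - ?q y"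
  have R: "\<bar>?R y\<bar> \<le> 2 * ((real CARD('d) * norm (y - x)) ^ 4 * K)" for y
  proof -
    have "x + (y - x) = y" "x - (y - x) = 2 *\<^sub>R x - y" by (simp_all add: scaleR_2)
    with q[of "y - x"] show ?thesis by simp
  qed
  have u: "interp_error ?u y = interp_error g y + interp_error g (2 *\<^sub>R x - y)" for y
    unfolding interp_error_add by (simp add: interp_error_def x Pi_h_reflect)
  have e: "2 *\<^sub>R x - (x + s) = x - s" "2 *\<^sub>R x - (x - s) = x + s" "2 *\<^sub>R x - x = x" by (simp_all add: scaleR_2)
  have "interp_error ?u y = interp_error ?R y + interp_error ?q y" for y unfolding interp_error_add[symmetric] by simp
  \<comment> \<open>The symmetrised function takes the same error at x + s and at x - s, so the
    second difference is counted twice.\<close>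
  then have "2 * (interp_error g (x + s) + interp_error g (x - s) - 2 * interp_error g x) = interp_error ?R (x + s) + interp_error ?R (x - s) - 2 * interp_error ?R x"
    using u[of "x + s"] u[of "x - s"] u[of x] unfolding e by (simp add: interp_error_quad)
  also have "\<dots> = (Pi_h h ?R (x + s) + Pi_h h ?R (x - s) - 2 * Pi_h h ?R x) - ?R (x + s) - ?R (x - s) + 2 * ?R x"
    by (rule interp_error_second_diff_eq)
  finally have e: "2 * \<bar>interp_error g (x + s) + interp_error g (x - s) - 2 * interp_error g x\<bar> \<le>
      \<bar>Pi_h h ?R (x + s) + Pi_h h ?R (x - s) - 2 * Pi_h h ?R x\<bar> + \<bar>?R (x + s)\<bar> + \<bar>?R (x - s)\<bar> + 2 * \<bar>?R x\<bar>" by (rule abs_combine)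
  have "\<bar>Pi_h h ?R (x + s) + Pi_h h ?R (x - s) - 2 * Pi_h h ?R x\<bar> \<le>
      3 * 4 ^ CARD('d) * (4 * (real CARD('d) * norm s / (c * H))\<^sup>2) * (2 * ((real CARD('d) * (3 * real CARD('d) * H)) ^ 4 * K))"
  proof (rule Pi_second_diff)
    fix k assume "k \<in> nodes h x \<union> nodes h (x + s) \<union> nodes h (x - s)"
    then have "norm (grid_pt h k - x) \<le> 2 * real CARD('d) * H \<or> norm (grid_pt h k - (x + s)) \<le> 2 * real CARD('d) * H
        \<or> norm (grid_pt h k - (x - s)) \<le> 2 * real CARD('d) * H"
      using nodes_norm by blast
    moreover have "norm (grid_pt h k - x) \<le> norm (grid_pt h k - (x + s)) + norm s"
      using norm_triangle_ineq[of "grid_pt h k - (x + s)" s] by simp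
    moreover have "norm (grid_pt h k - x) \<le> norm (grid_pt h k - (x - s)) + norm s"
      using norm_triangle_ineq4[of "grid_pt h k - (x - s)" s] by simp
    moreover have "0 \<le> real CARD('d) * H" using H_pos by simp
    ultimately have "norm (grid_pt h k - x) \<le> 3 * real CARD('d) * H" using assms(2) by linarith
    then have "2 * ((real CARD('d) * norm (grid_pt h k - x)) ^ 4 * K) \<le> 2 * ((real CARD('d) * (3 * real CARD('d) * H)) ^ 4 * K)"
      using K by (intro mult_left_mono mult_right_mono power_mono mult_left_mono) auto
    with R[of "grid_pt h k"] show "\<bar>?R (grid_pt h k)\<bar> \<le> 2 * ((real CARD('d) * (3 * real CARD('d) * H)) ^ 4 * K)" by linarith
  qed
  also have "\<dots> = 2 * (972 * 4 ^ CARD('d) * real CARD('d) ^ 10 / c\<^sup>2 * H\<^sup>2 * (norm s)\<^sup>2 * K)"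
    using c_pos H_pos by (simp add: field_simps eval_nat_numeral)
  finally have p: "\<bar>Pi_h h ?R (x + s) + Pi_h h ?R (x - s) - 2 * Pi_h h ?R x\<bar> \<le>
     2 * (972 * 4 ^ CARD('d) * real CARD('d) ^ 10 / c\<^sup>2 * H\<^sup>2 * (norm s)\<^sup>2 * K)" .
  have s4: "(real CARD('d) * norm s) ^ 4 * K \<le> real CARD('d) ^ 6 * H\<^sup>2 * (norm s)\<^sup>2 * K"
  proof -
    have "(real CARD('d) * norm s) ^ 4 * K = real CARD('d) ^ 4 * (norm s)\<^sup>2 * K * (norm s)\<^sup>2" by (simp add: power_mult_distrib eval_nat_numeral)
    also have "\<dots> \<le> real CARD('d) ^ 4 * (norm s)\<^sup>2 * K * (real CARD('d) * H)\<^sup>2"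
      using assms(2) K by (intro mult_left_mono power_mono) auto
    also have "\<dots> = real CARD('d) ^ 6 * H\<^sup>2 * (norm s)\<^sup>2 * K" by (simp add: power_mult_distrib eval_nat_numeral)
    finally show ?thesis .
  qed
  have "\<bar>?R (x + s)\<bar> \<le> 2 * ((real CARD('d) * norm s) ^ 4 * K)" "\<bar>?R (x - s)\<bar> \<le> 2 * ((real CARD('d) * norm s) ^ 4 * K)" "\<bar>?R x\<bar> \<le> 0"
    using R[of "x + s"] R[of "x - s"] R[of x] by simp_all
  with e p s4 have "2 * \<bar>interp_error g (x + s) + interp_error g (x - s) - 2 * interp_error g x\<bar> \<le>
     2 * (972 * 4 ^ CARD('d) * real CARD('d) ^ 10 / c\<^sup>2 * H\<^sup>2 * (norm s)\<^sup>2 * K) + 4 * (real CARD('d) ^ 6 * H\<^sup>2 * (norm s)\<^sup>2 * K)"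
    by linarith
  also have "\<dots> = 2 * (second_diff_const_near * H\<^sup>2 * (norm s)\<^sup>2 * K)"
    unfolding second_diff_const_near_def by (simp add: algebra_simps)
  finally show ?thesis by simp
qed

definition second_diff_const :: real where "second_diff_const = second_diff_const_near * (real CARD('d))\<^sup>2 + lip_const * (3 * real CARD('d) + 1) * real CARD('d) * (real CARD('d) + 1)"

lemma second_diff_const_nonneg: "0 \<le> second_diff_const" using second_diff_const_near_nonneg lip_const_nonneg by (simp add: second_diff_const_def)

text \<open>With s = z + r, \<open>z\<close> a grid vector, the second difference over
  \<open>s\<close> is the one over \<open>r\<close> plus a difference, over z + 2 r, of the error of
  the increment of \<open>g\<close> by \<open>z\<close>. The first is the near case at a grid point;
  the second is of order |s| * |z| by the Lipschitz estimate.\<close>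

lemma interp_error_second_diff:
  assumes "bounded_partials 4 K g" and x: "x = grid_pt h m0"
  shows "\<bar>interp_error g (x + s) + interp_error g (x - s) - 2 * interp_error g x\<bar> \<le> second_diff_const * H\<^sup>2 * (norm s)\<^sup>2 * K"
proof -
  note K = bounded_partials_nonneg[OF assms(1)]
  obtain m r where r: "s = grid_pt h m + r" "norm r \<le> real CARD('d) * H" "norm r \<le> real CARD('d) * norm s" "norm (grid_pt h m) \<le> (real CARD('d) + 1) * norm s"
    by (rule grid_decomp)
  \<comment> \<open>\<open>?y\<close> is x - s; moving it by z + 2 r leads to x + r, and adding
    \<open>z\<close> once more to x + s.\<close>
  let ?z = "grid_pt h m" and ?y = "x - grid_pt h m - r"
  let ?g = "\<lambda>y. g (y + ?z) - g y"
  have "bounded_partials 3 (real CARD('d) * K * norm ?z) ?g"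
    using bounded_partials_diff[of 3 K g] assms by (simp add: eval_nat_numeral)
  then have "\<bar>interp_error ?g (?y + (?z + 2 *\<^sub>R r)) - interp_error ?g ?y\<bar> \<le> lip_const * H\<^sup>2 * norm (?z + 2 *\<^sub>R r) * (real CARD('d) * K * norm ?z)"
    by (rule interp_error_lipschitz)
  also have "\<dots> \<le> lip_const * H\<^sup>2 * ((3 * real CARD('d) + 1) * norm s) * (real CARD('d) * K * ((real CARD('d) + 1) * norm s))"
  proof (intro mult_mono)
    have "norm (?z + 2 *\<^sub>R r) \<le> norm ?z + 2 * norm r"
      using norm_triangle_ineq[of ?z "2 *\<^sub>R r"] by simp
    also have "\<dots> \<le> (3 * real CARD('d) + 1) * norm s" using r(3,4) by (simp add: algebra_simps)
    finally show "norm (?z + 2 *\<^sub>R r) \<le> (3 * real CARD('d) + 1) * norm s" .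
  qed (use r(4) K lip_const_nonneg in auto)
  finally have 1: "\<bar>(interp_error g (x + s) - interp_error g (x + r)) - (interp_error g (x - r) - interp_error g (x - s))\<bar> \<le>
      lip_const * H\<^sup>2 * ((3 * real CARD('d) + 1) * norm s) * (real CARD('d) * K * ((real CARD('d) + 1) * norm s))"
    by (simp add: interp_error_shift[symmetric] r(1) scaleR_2 algebra_simps)
  have "\<bar>interp_error g (x + r) + interp_error g (x - r) - 2 * interp_error g x\<bar> \<le> second_diff_const_near * H\<^sup>2 * (norm r)\<^sup>2 * K"
    by (rule interp_error_second_diff_near[OF assms(1) r(2) x])
  also have "\<dots> \<le> second_diff_const_near * H\<^sup>2 * (real CARD('d) * norm s)\<^sup>2 * K"
    using r(3) K second_diff_const_near_nonneg by (intro mult_left_mono mult_right_mono power_mono) auto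
  finally have "\<bar>interp_error g (x + s) + interp_error g (x - s) - 2 * interp_error g x\<bar> \<le>
     lip_const * H\<^sup>2 * ((3 * real CARD('d) + 1) * norm s) * (real CARD('d) * K * ((real CARD('d) + 1) * norm s)) + second_diff_const_near * H\<^sup>2 * (real CARD('d) * norm s)\<^sup>2 * K"
    using 1 by linarith
  also have "\<dots> = second_diff_const * H\<^sup>2 * (norm s)\<^sup>2 * K" by (simp add: second_diff_const_def algebra_simps eval_nat_numeral)
  finally show ?thesis .
qed

definition interp_lip_const :: real where "interp_lip_const = (real CARD('d) + 1) + 10 * 4 ^ CARD('d) * real CARD('d) ^ 3 / c"

lemma interp_lip_const_nonneg: "0 \<le> interp_lip_const" using c_pos by (simp add: interp_lip_const_def)

text \<open>Turns a Lipschitz bound between grid points into one everywhere. A grid shift acts on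
  the nodal values; for a shift of mesh size one nodal value is subtracted first, so that the
  remaining ones are of order H and absorb the 1 / H of the inverse estimate.\<close>

lemma Pi_lipschitz_of_grid:
  assumes g: "\<And>k m. \<bar>g (grid_pt h k + grid_pt h m) - g (grid_pt h k)\<bar> \<le> K * norm (grid_pt h m)"
    and K: "0 \<le> K"
  shows "\<bar>Pi_h h g (x + s) - Pi_h h g x\<bar> \<le> interp_lip_const * norm s * K"
proof -
  obtain m r where r: "s = grid_pt h m + r" "norm r \<le> real CARD('d) * H" "norm r \<le> real CARD('d) * norm s" "norm (grid_pt h m) \<le> (real CARD('d) + 1) * norm s"
    by (rule grid_decomp)
  have "norm (Pi_h h (\<lambda>y. g (y + grid_pt h m) - g y) (x + r)) \<le> K * norm (grid_pt h m)"
    unfolding Pi_h_def by (rule i_h_bound[OF h_pos]) (simp add: r_h_def g)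
  also have "\<dots> \<le> K * ((real CARD('d) + 1) * norm s)" using r(4) K by (intro mult_left_mono)
  finally have 1: "\<bar>Pi_h h g (x + s) - Pi_h h g (x + r)\<bar> \<le> K * ((real CARD('d) + 1) * norm s)"
    by (simp add: Pi_h_diff[OF h_pos] Pi_h_shift[symmetric] r(1) add_ac)
  have "nodes h x \<noteq> {}" using card_nodes[of h x] by auto
  then obtain k0 where k0: "k0 \<in> nodes h x" by blast
  \<comment> \<open>All nodes involved lie within 3 d H of \<open>x\<close> and \<open>k0\<close>
    within 2 d H, which gives the distance 5 d H below.\<close>
  let ?f = "\<lambda>y. g y - g (grid_pt h k0)"
  have "\<bar>Pi_h h ?f (x + r) - Pi_h h ?f x\<bar> \<le> 2 * 4 ^ CARD('d) * (real CARD('d) * norm r / (c * H)) * (K * (5 * real CARD('d) * H))"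
  proof (rule Pi_first_diff)
    fix k assume "k \<in> nodes h x \<union> nodes h (x + r)"
    then have "norm (grid_pt h k - x) \<le> 2 * real CARD('d) * H \<or> norm (grid_pt h k - (x + r)) \<le> 2 * real CARD('d) * H"
      using nodes_norm by blast
    moreover have "norm (grid_pt h k - x) \<le> norm (grid_pt h k - (x + r)) + norm r"
      using norm_triangle_ineq[of "grid_pt h k - (x + r)" r] by simp
    moreover have "norm (grid_pt h k - grid_pt h k0) \<le> norm (grid_pt h k - x) + norm (grid_pt h k0 - x)"
      using norm_triangle_ineq4[of "grid_pt h k - x" "grid_pt h k0 - x"] by simp
    moreover have "norm (grid_pt h k0 - x) \<le> 2 * real CARD('d) * H" using k0 by (rule nodes_norm)
    moreover have "0 \<le> real CARD('d) * H" using H_pos by simp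
    ultimately have "norm (grid_pt h k - grid_pt h k0) \<le> 5 * real CARD('d) * H" using r(2) by linarith
    then have "K * norm (grid_pt h (k - k0)) \<le> K * (5 * real CARD('d) * H)"
      using K by (intro mult_left_mono) (auto simp: grid_pt_simps)
    with g[of k0 "k - k0"] show "\<bar>?f (grid_pt h k)\<bar> \<le> K * (5 * real CARD('d) * H)" by (simp add: grid_pt_simps)
  qed
  also have "\<dots> = 10 * 4 ^ CARD('d) * (real CARD('d))\<^sup>2 / c * K * norm r"
    using c_pos H_pos by (simp add: field_simps eval_nat_numeral)
  also have "\<dots> \<le> 10 * 4 ^ CARD('d) * (real CARD('d))\<^sup>2 / c * K * (real CARD('d) * norm s)"
    using r(3) K c_pos by (intro mult_left_mono) auto
  finally have 2: "\<bar>Pi_h h ?f (x + r) - Pi_h h ?f x\<bar> \<le> 10 * 4 ^ CARD('d) * (real CARD('d))\<^sup>2 / c * K * (real CARD('d) * norm s)" .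
  have "Pi_h h ?f y = Pi_h h g y - g (grid_pt h k0)" for y
  proof -
    have "Pi_h h (\<lambda>_. g (grid_pt h k0)) y = g (grid_pt h k0)"
      by (simp add: Pi_h_nodes[OF h_pos] sum_distrib_right[symmetric] sum_Psi[OF h_pos])
    then show ?thesis by (simp add: Pi_h_diff[OF h_pos])
  qed
  from 2[unfolded this] have "\<bar>Pi_h h g (x + r) - Pi_h h g x\<bar> \<le>
    10 * 4 ^ CARD('d) * (real CARD('d))\<^sup>2 / c * K * (real CARD('d) * norm s)" by simp
  with 1 have "\<bar>Pi_h h g (x + s) - Pi_h h g x\<bar> \<le> K * ((real CARD('d) + 1) * norm s) + 10 * 4 ^ CARD('d) * (real CARD('d))\<^sup>2 / c * K * (real CARD('d) * norm s)"
    by linarith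
  also have "\<dots> = interp_lip_const * norm s * K" by (simp add: interp_lip_const_def algebra_simps eval_nat_numeral)
  finally show ?thesis .
qed

end

section \<open>Coercivity of the spline Gram form\<close>

definition hat :: "real \<Rightarrow> real" where "hat t = max 0 (1 - \<bar>t\<bar>)"

text \<open>A dual function of the hat: on [0, 1) only t and 1 - t are active among the integer
  translates of \<open>hat\<close>, and 4 - 6 t is orthogonal to the former and has integral one
  against the latter. Its translates are biorthogonal to those of \<open>hat\<close> and mutually
  orthogonal with squared norm 4, which yields the lower Riesz bound without Fourier
  analysis.\<close>

definition chi :: "real \<Rightarrow> real" where "chi t = (if 0 \<le> t \<and> t < 1 then 4 - 6 * t else 0)"

lemma integrable_bounded_support:
  fixes f :: "real \<Rightarrow> real"
  assumes "f \<in> borel_measurable borel" "\<And>x. \<bar>f x\<bar> \<le> B" "\<And>x. x \<notin> {a..b} \<Longrightarrow> f x = 0"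
  shows "integrable lborel f"
proof (rule Bochner_Integration.integrable_bound)
  show "integrable lborel (\<lambda>x. B * indicat_real {a..b} x)"
    by (intro integrable_mult_right integrable_real_indicator) (auto simp: emeasure_lborel_Icc_eq)
  show "AE x in lborel. norm (f x) \<le> norm (B * indicat_real {a..b} x)"
    using assms(2,3) abs_ge_self[of B] by (auto simp: indicator_def intro: order_trans)
qed (use assms(1) in simp)

lemma has_integral_quadratic:
  fixes f :: "real \<Rightarrow> real"
  assumes "a \<le> b" "\<And>x. a < x \<Longrightarrow> x < b \<Longrightarrow> f x = p + q * x + r * x\<^sup>2"
  shows "(f has_integral (p * b + q * b\<^sup>2 / 2 + r * b ^ 3 / 3 - (p * a + q * a\<^sup>2 / 2 + r * a ^ 3 / 3))) {a..b}"
proof (rule has_integral_spike_finite[of "{a, b}"])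
  show "((\<lambda>x. p + q * x + r * x\<^sup>2) has_integral (p * b + q * b\<^sup>2 / 2 + r * b ^ 3 / 3 - (p * a + q * a\<^sup>2 / 2 + r * a ^ 3 / 3))) {a..b}"
    by (rule fundamental_theorem_of_calculus[OF assms(1)])
      (auto intro!: derivative_eq_intros simp flip: has_real_derivative_iff_has_vector_derivative)
qed (use assms(2) in auto)

lemma integral_lborel_interval:
  fixes f :: "real \<Rightarrow> real"
  assumes "integrable lborel f" "(f has_integral I) {a..b}" "\<And>x. x \<notin> {a..b} \<Longrightarrow> f x = 0"
  shows "integral\<^sup>L lborel f = I"
proof -
  have "(f has_integral I) UNIV"
    using assms(2,3) by (rule has_integral_on_superset) auto
  with has_integral_integral_lborel[OF assms(1)] show ?thesis by (rule has_integral_unique)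
qed

lemma integral_lborel_zero: "(\<And>x. f x = 0) \<Longrightarrow> integral\<^sup>L lborel f = 0" for f :: "real \<Rightarrow> real"
proof -
  assume "\<And>x. f x = 0"
  then have "f = (\<lambda>_. 0)" by auto
  then show ?thesis by simp
qed

lemma hat_bounds: "0 \<le> hat t" "hat t \<le> 1" by (auto simp: hat_def)

lemma hat_measurable [measurable]: "hat \<in> borel_measurable borel"
  unfolding hat_def[abs_def] by measurable

lemma chi_measurable [measurable]: "chi \<in> borel_measurable borel"
  unfolding chi_def[abs_def] by measurable

lemma chi_bound: "\<bar>chi t\<bar> \<le> 4" by (auto simp: chi_def abs_if)

lemma integrable_compact_support_prod:
  fixes f g :: "real \<Rightarrow> real"
  assumes [measurable]: "f \<in> borel_measurable borel" "g \<in> borel_measurable borel"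
    and b: "\<And>x. \<bar>f x\<bar> \<le> 4" "\<And>x. \<bar>g x\<bar> \<le> 4" and z: "\<And>x. x \<notin> {-1..1} \<Longrightarrow> f x = 0"
  shows "integrable lborel (\<lambda>t. f (t + a) * g (t + b))"
proof (rule integrable_bounded_support[of _ "4 * 4" "- 1 - a" "1 - a"])
  show "\<bar>f (t + a) * g (t + b)\<bar> \<le> 4 * 4" for t
    unfolding abs_mult using b by (intro mult_mono) auto
  show "f (t + a) * g (t + b) = 0" if "t \<notin> {- 1 - a..1 - a}" for t
    using that by (subst z) auto
qed measurable

lemma hat_supp: "x \<notin> {-1..1} \<Longrightarrow> hat x = 0" by (auto simp: hat_def)
lemma chi_supp: "x \<notin> {-1..1} \<Longrightarrow> chi x = 0" by (auto simp: chi_def)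
lemma hat_bound4: "\<bar>hat x\<bar> \<le> 4" using hat_bounds[of x] by simp

lemma integrable_hat_hat: "integrable lborel (\<lambda>t. hat (t + a) * hat (t + b))"
  by (rule integrable_compact_support_prod) (simp_all only: hat_measurable hat_bound4 chi_bound hat_supp not_False_eq_True)

lemma integrable_hat_chi: "integrable lborel (\<lambda>t. hat (t + a) * chi (t + b))"
  by (rule integrable_compact_support_prod) (simp_all only: hat_measurable chi_measurable hat_bound4 chi_bound hat_supp not_False_eq_True)

lemma integrable_chi_chi: "integrable lborel (\<lambda>t. chi (t + a) * chi (t + b))"
  by (rule integrable_compact_support_prod) (simp_all only: chi_measurable hat_bound4 chi_bound chi_supp not_False_eq_True)

text \<open>The integrand is piecewise quadratic: for s \<le> 1 with breakpoints -1, -s, 0, 1 - s,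
  and for 1 \<le> s \<le> 2 with the single piece from -1 to 1 - s.\<close>

lemma hat_autocorrelation_nonneg:
  assumes "0 \<le> s" shows "(\<integral>x. hat x * hat (x + s) \<partial>lborel) = bspline s"
proof -
  let ?f = "\<lambda>x. hat x * hat (x + s)"
  have i: "integrable lborel ?f" using integrable_hat_hat[of 0 s] by simp
  consider "s \<le> 1" | "1 \<le> s" "s \<le> 2" | "2 \<le> s" by linarith
  then show ?thesis
  proof cases
    case 1
    have 1: "(?f has_integral ((1 + s) * (- s) + (2 + s) * (- s)\<^sup>2 / 2 + 1 * (- s) ^ 3 / 3
         - ((1 + s) * (- 1) + (2 + s) * (- 1)\<^sup>2 / 2 + 1 * (- 1) ^ 3 / 3))) {- 1..- s}"
      by (rule has_integral_quadratic) (use 1 assms in \<open>auto simp: hat_def power2_eq_square algebra_simps\<close>)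
    have 2: "(?f has_integral ((1 - s) * 0 + (- s) * 0\<^sup>2 / 2 + (- 1) * 0 ^ 3 / 3
         - ((1 - s) * (- s) + (- s) * (- s)\<^sup>2 / 2 + (- 1) * (- s) ^ 3 / 3))) {- s..0}"
      by (rule has_integral_quadratic) (use \<open>s \<le> 1\<close> assms in \<open>auto simp: hat_def power2_eq_square algebra_simps\<close>)
    have 3: "(?f has_integral ((1 - s) * (1 - s) + (s - 2) * (1 - s)\<^sup>2 / 2 + 1 * (1 - s) ^ 3 / 3
         - ((1 - s) * 0 + (s - 2) * 0\<^sup>2 / 2 + 1 * 0 ^ 3 / 3))) {0..1 - s}"
      by (rule has_integral_quadratic) (use \<open>s \<le> 1\<close> assms in \<open>auto simp: hat_def power2_eq_square algebra_simps\<close>)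
    have "integral\<^sup>L lborel ?f = (((1 + s) * (- s) + (2 + s) * (- s)\<^sup>2 / 2 + 1 * (- s) ^ 3 / 3
         - ((1 + s) * (- 1) + (2 + s) * (- 1)\<^sup>2 / 2 + 1 * (- 1) ^ 3 / 3))
       + ((1 - s) * 0 + (- s) * 0\<^sup>2 / 2 + (- 1) * 0 ^ 3 / 3
         - ((1 - s) * (- s) + (- s) * (- s)\<^sup>2 / 2 + (- 1) * (- s) ^ 3 / 3)))
       + ((1 - s) * (1 - s) + (s - 2) * (1 - s)\<^sup>2 / 2 + 1 * (1 - s) ^ 3 / 3
         - ((1 - s) * 0 + (s - 2) * 0\<^sup>2 / 2 + 1 * 0 ^ 3 / 3))"
    proof (rule integral_lborel_interval[OF i has_integral_combine[OF _ _ has_integral_combine[OF _ _ 1 2] 3]])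
    qed (use \<open>s \<le> 1\<close> assms in \<open>auto simp: hat_def\<close>)
    also have "\<dots> = bspline s"
      using \<open>s \<le> 1\<close> assms by (simp add: bspline_inner power2_eq_square power3_eq_cube field_simps)
    finally show ?thesis .
  next
    case 2
    have "integral\<^sup>L lborel ?f = ((1 - s) * (1 - s) + (- s) * (1 - s)\<^sup>2 / 2 + (- 1) * (1 - s) ^ 3 / 3
         - ((1 - s) * (- 1) + (- s) * (- 1)\<^sup>2 / 2 + (- 1) * (- 1) ^ 3 / 3))"
    proof (rule integral_lborel_interval[OF i])
      show "(?f has_integral ((1 - s) * (1 - s) + (- s) * (1 - s)\<^sup>2 / 2 + (- 1) * (1 - s) ^ 3 / 3
         - ((1 - s) * (- 1) + (- s) * (- 1)\<^sup>2 / 2 + (- 1) * (- 1) ^ 3 / 3))) {- 1..1 - s}"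
        by (rule has_integral_quadratic) (use 2 in \<open>auto simp: hat_def power2_eq_square algebra_simps\<close>)
    qed (use 2 in \<open>auto simp: hat_def\<close>)
    also have "\<dots> = bspline s"
      using 2 by (simp add: bspline_outer power2_eq_square power3_eq_cube field_simps)
    finally show ?thesis .
  next
    case 3
    then have "hat x * hat (x + s) = 0" for x by (auto simp: hat_def max_def)
    then show ?thesis using 3 integral_lborel_zero[of "\<lambda>x. hat x * hat (x + s)"] by (simp only: bspline_zero)
  qed
qed

lemma hat_even: "hat (- x) = hat x" by (simp add: hat_def)

lemma hat_autocorrelation: "(\<integral>x. hat x * hat (x + s) \<partial>lborel) = bspline s"
proof (cases "0 \<le> s")
  case False
  have "(\<integral>x. hat x * hat (x + s) \<partial>lborel) = (\<integral>x. hat (0 + - 1 * x) * hat (0 + - 1 * x + s) \<partial>lborel)"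
    using lborel_integral_real_affine[of "- 1" "\<lambda>x. hat x * hat (x + s)" 0] by simp
  also have "\<dots> = (\<integral>x. hat x * hat (x + - s) \<partial>lborel)"
  proof (rule Bochner_Integration.integral_cong[OF refl])
    fix x :: real
    show "hat (0 + - 1 * x) * hat (0 + - 1 * x + s) = hat x * hat (x + - s)"
      using hat_even[of x] hat_even[of "x - s"] by simp
  qed
  also have "\<dots> = bspline (- s)" using False by (intro hat_autocorrelation_nonneg) auto
  finally show ?thesis by (simp add: bspline_even)
qed (rule hat_autocorrelation_nonneg)

lemma integral_shift: "(\<integral>t. f (t + a) * g (t + b) \<partial>lborel) = (\<integral>x. f x * g (x + (b - a)) \<partial>lborel)"
  for f g :: "real \<Rightarrow> real"
  using lborel_integral_real_affine[of 1 "\<lambda>t. f (t + a) * g (t + b)" "- a"] by (simp add: algebra_simps)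

lemma hat_chi: "(\<integral>t. hat (t - of_int i) * chi (t - of_int m) \<partial>lborel) = (if i = m then 1 else 0)"
proof -
  have "(\<integral>t. hat (t - of_int i) * chi (t - of_int m) \<partial>lborel) = (\<integral>x. chi x * hat (x + of_int (m - i)) \<partial>lborel)"
    using integral_shift[where f = chi and a = "- of_int m" and g = hat and b = "- of_int i"] by (simp add: mult.commute)
  also have "\<dots> = (if i = m then 1 else 0)"
  proof -
    define n where "n = m - i"
    let ?f = "\<lambda>x. chi x * hat (x + of_int n)"
    have i: "integrable lborel ?f" using integrable_hat_chi[of "of_int n" 0] by (simp add: mult.commute)
    have o: "?f x = 0" if "x \<notin> {0..1}" for x using that by (auto simp: chi_def)
    consider "n = 0" | "n = - 1" | "n \<ge> 1" | "n \<le> - 2" by linarith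
    then have "integral\<^sup>L lborel ?f = (if n = 0 then 1 else 0)"
    proof cases
      case 1
      have "(?f has_integral (4 * 1 + (- 10) * 1\<^sup>2 / 2 + 6 * 1 ^ 3 / 3 - (4 * 0 + (- 10) * 0\<^sup>2 / 2 + 6 * 0 ^ 3 / 3))) {0..1}"
        by (rule has_integral_quadratic) (auto simp: 1 chi_def hat_def power2_eq_square algebra_simps)
      from integral_lborel_interval[OF i this o] show ?thesis using 1 by simp
    next
      case 2
      have "(?f has_integral (0 * 1 + 4 * 1\<^sup>2 / 2 + (- 6) * 1 ^ 3 / 3 - (0 * 0 + 4 * 0\<^sup>2 / 2 + (- 6) * 0 ^ 3 / 3))) {0..1}"
        by (rule has_integral_quadratic) (auto simp: 2 chi_def hat_def power2_eq_square algebra_simps)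
      from integral_lborel_interval[OF i this o] show ?thesis using 2 by simp
    next
      case 3
      then have "real_of_int n \<ge> 1" by linarith
      then have "?f x = 0" for x by (auto simp: chi_def hat_def)
      with 3 show ?thesis by (subst integral_lborel_zero) auto
    next
      case 4
      then have "real_of_int n \<le> - 2" by linarith
      then have "?f x = 0" for x by (auto simp: chi_def hat_def)
      with 4 show ?thesis by (subst integral_lborel_zero) auto
    qed
    then show ?thesis by (auto simp: n_def)
  qed
  finally show ?thesis .
qed

lemma chi_chi: "(\<integral>t. chi (t - of_int i) * chi (t - of_int m) \<partial>lborel) = (if i = m then 4 else 0)"
proof (cases "i = m")
  case True
  have "(\<integral>t. chi (t - of_int i) * chi (t - of_int m) \<partial>lborel) = (\<integral>x. chi x * chi x \<partial>lborel)"
    using integral_shift[where f = chi and a = "- of_int i" and g = chi and b = "- of_int m"] True by simp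
  also have "\<dots> = 4"
  proof -
    have i: "integrable lborel (\<lambda>x. chi x * chi x)" using integrable_chi_chi[of 0 0] by simp
    have "((\<lambda>x. chi x * chi x) has_integral (16 * 1 + (- 48) * 1\<^sup>2 / 2 + 36 * 1 ^ 3 / 3 - (16 * 0 + (- 48) * 0\<^sup>2 / 2 + 36 * 0 ^ 3 / 3))) {0..1}"
      by (rule has_integral_quadratic) (auto simp: chi_def power2_eq_square algebra_simps)
    then have "(\<integral>x. chi x * chi x \<partial>lborel) = 16 * 1 + (- 48) * 1\<^sup>2 / 2 + 36 * 1 ^ 3 / 3 - (16 * 0 + (- 48) * 0\<^sup>2 / 2 + 36 * 0 ^ 3 / 3)"
      by (rule integral_lborel_interval[OF i]) (auto simp: chi_def)
    then show ?thesis by simp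
  qed
  finally show ?thesis using True by simp
next
  case False
  then have "\<bar>real_of_int i - of_int m\<bar> \<ge> 1" by linarith
  then have "chi (t - of_int i) * chi (t - of_int m) = 0" for t by (auto simp: chi_def)
  with False show ?thesis by (subst integral_lborel_zero) auto
qed

text \<open>Lebesgue measure on vectors is the image of a product measure over \<open>Basis\<close>,
  here the axis vectors; Fubini is transported along this indexing.\<close>

lemma integral_prod_vec:
  fixes f :: "'d::finite \<Rightarrow> real \<Rightarrow> real"
  assumes i: "\<And>j. integrable lborel (f j)"
  shows "integrable lborel (\<lambda>x::real^'d. \<Prod>j\<in>UNIV. f j (x $ j))" (is ?A)
    and "(\<integral>x. (\<Prod>j\<in>UNIV. f j (x $ j)) \<partial>(lborel :: (real^'d) measure)) = (\<Prod>j\<in>UNIV. \<integral>t. f j t \<partial>lborel)" (is ?B)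
proof -
  interpret product_sigma_finite "\<lambda>_::real^'d. lborel :: real measure" by standard
  let ?P = "\<Pi>\<^sub>M b\<in>(Basis::(real^'d) set). (lborel::real measure)"
  let ?T = "\<lambda>z::real^'d \<Rightarrow> real. \<Sum>b\<in>Basis. z b *\<^sub>R b"
  let ?ax = "\<lambda>j::'d. axis j (1::real)"
  let ?g = "\<lambda>b::real^'d. f (axis_index b)"
  have B: "Basis = range ?ax" by (auto simp: Basis_vec_def)
  have inj: "inj ?ax" by (auto simp: inj_on_def axis_eq_axis)
  have spline_idx: "axis_index (?ax j) = j" for j by (simp add: axis_index_axis)
  have T: "?T z $ j = z (?ax j)" for z j
  proof -
    have "?T z $ j = ?T z \<bullet> ?ax j" by (simp add: inner_axis)
    also have "\<dots> = z (?ax j)" by (rule inner_sum_left_Basis) (auto simp: B)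
    finally show ?thesis .
  qed
  have P: "(\<Prod>j\<in>UNIV. f j (?T z $ j)) = (\<Prod>b\<in>Basis. ?g b (z b))" for z
  proof -
    have "(\<Prod>b\<in>Basis. ?g b (z b)) = (\<Prod>j\<in>UNIV. f j (z (?ax j)))"
      unfolding B by (subst prod.reindex[OF inj]) (simp add: spline_idx)
    then show ?thesis by (simp only: T)
  qed
  have [measurable]: "f j \<in> borel_measurable borel" for j using borel_measurable_integrable[OF i[of j]] by simp
  have TM: "?T \<in> measurable ?P borel" by measurable
  have fM: "(\<lambda>x::real^'d. \<Prod>j\<in>UNIV. f j (x $ j)) \<in> borel_measurable borel" by measurable
  have "integrable ?P (\<lambda>z. \<Prod>b\<in>Basis. ?g b (z b))"
    by (rule product_integrable_prod) (auto intro: i)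
  then show ?A
    unfolding lborel_eq[where 'a="real^'d"] by (subst integrable_distr_eq[OF TM fM]) (simp only: P)
  have "(\<integral>x. (\<Prod>j\<in>UNIV. f j (x $ j)) \<partial>(lborel :: (real^'d) measure)) = (\<integral>z. (\<Prod>b\<in>Basis. ?g b (z b)) \<partial>?P)"
    unfolding lborel_eq[where 'a="real^'d"] by (subst integral_distr[OF TM fM]) (simp only: P)
  also have "\<dots> = (\<Prod>b\<in>Basis. \<integral>t. ?g b t \<partial>lborel)"
    by (rule product_integral_prod) (auto intro: i)
  also have "\<dots> = (\<Prod>j\<in>UNIV. \<integral>t. f j t \<partial>lborel)"
    unfolding B by (subst prod.reindex[OF inj]) (simp add: spline_idx)
  finally show ?B .
qed

definition tensor :: "(real \<Rightarrow> real) \<Rightarrow> real^'d \<Rightarrow> real^'d \<Rightarrow> real" where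
  "tensor f a y = (\<Prod>j\<in>UNIV. f (y $ j + a $ j))"

lemma tensor_gram:
  fixes a b :: "real^'d"
  assumes "\<And>a b. integrable lborel (\<lambda>t. f (t + a) * g (t + b))"
  shows "integrable lborel (\<lambda>y. tensor f a y * tensor g b y)"
    and "(\<integral>y. tensor f a y * tensor g b y \<partial>lborel) = (\<Prod>j\<in>UNIV. \<integral>t. f (t + a $ j) * g (t + b $ j) \<partial>lborel)"
  unfolding tensor_def prod.distrib[symmetric]
  using integral_prod_vec[of "\<lambda>j t. f (t + a $ j) * g (t + b $ j)"] assms by auto

lemma combination_gram:
  fixes A :: "'k \<Rightarrow> real^'d" and B :: "'l \<Rightarrow> real^'d"
  assumes i: "\<And>a b. integrable lborel (\<lambda>t. f (t + a) * g (t + b))"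
  shows "integrable lborel (\<lambda>y. (\<Sum>k\<in>F. v k * tensor f (A k) y) * (\<Sum>m\<in>E. w m * tensor g (B m) y))"
    and "(\<integral>y. (\<Sum>k\<in>F. v k * tensor f (A k) y) * (\<Sum>m\<in>E. w m * tensor g (B m) y) \<partial>lborel) =
      (\<Sum>k\<in>F. \<Sum>m\<in>E. v k * w m * (\<Prod>j\<in>UNIV. \<integral>t. f (t + A k $ j) * g (t + B m $ j) \<partial>lborel))"
proof -
  have e: "(\<Sum>k\<in>F. v k * tensor f (A k) y) * (\<Sum>m\<in>E. w m * tensor g (B m) y) =
      (\<Sum>k\<in>F. \<Sum>m\<in>E. v k * w m * (tensor f (A k) y * tensor g (B m) y))" for y
    unfolding sum_product by (simp add: mult_ac)
  note t = tensor_gram[OF i]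
  show "integrable lborel (\<lambda>y. (\<Sum>k\<in>F. v k * tensor f (A k) y) * (\<Sum>m\<in>E. w m * tensor g (B m) y))"
    unfolding e by (intro Bochner_Integration.integrable_sum integrable_mult_right t)
  show "(\<integral>y. (\<Sum>k\<in>F. v k * tensor f (A k) y) * (\<Sum>m\<in>E. w m * tensor g (B m) y) \<partial>lborel) =
      (\<Sum>k\<in>F. \<Sum>m\<in>E. v k * w m * (\<Prod>j\<in>UNIV. \<integral>t. f (t + A k $ j) * g (t + B m $ j) \<partial>lborel))"
    unfolding e by (simp add: t Bochner_Integration.integral_sum Bochner_Integration.integrable_sum)
qed

definition vec_int :: "int^'d \<Rightarrow> real^'d" where "vec_int k = (\<chi> j. of_int (k $ j))"

text \<open>The collocation form in mesh units: the product is the value of the basis function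
  \<open>m\<close> at node \<open>k\<close> moved by \<open>s\<close>, where \<open>s\<close> is
  measured in multiples of the mesh sizes.\<close>

definition gram :: "(int^'d) set \<Rightarrow> (int^'d \<Rightarrow> real) \<Rightarrow> real^'d \<Rightarrow> real" where
  "gram F w s = (\<Sum>k\<in>F. \<Sum>m\<in>F. w k * w m * (\<Prod>j\<in>UNIV. bspline (s $ j + of_int (k $ j) - of_int (m $ j))))"

text \<open>The translate by \<open>a\<close> of the multilinear function with nodal values
  \<open>w\<close>. \<open>gram\<close> is the inner product of two such translates.\<close>

definition hat_comb :: "(int^'d) set \<Rightarrow> (int^'d \<Rightarrow> real) \<Rightarrow> real^'d \<Rightarrow> real^'d \<Rightarrow> real" where
  "hat_comb F w a y = (\<Sum>k\<in>F. w k * tensor hat (a - vec_int k) y)"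

lemma hat_comb_gram:
  fixes a b :: "real^'d"
  shows "integrable lborel (\<lambda>y. hat_comb F w a y * hat_comb F w b y)"
    and "(\<integral>y. hat_comb F w a y * hat_comb F w b y \<partial>lborel) = gram F w (b - a)"
proof -
  show "integrable lborel (\<lambda>y. hat_comb F w a y * hat_comb F w b y)"
    unfolding hat_comb_def by (rule combination_gram[OF integrable_hat_hat])
  show "(\<integral>y. hat_comb F w a y * hat_comb F w b y \<partial>lborel) = gram F w (b - a)"
  proof -
    have e: "(\<integral>t. hat (t + (a - vec_int k) $ j) * hat (t + (b - vec_int m) $ j) \<partial>lborel) =
        bspline ((b - a) $ j + of_int (k $ j) - of_int (m $ j))" for k m :: "int^'d" and j
      unfolding integral_shift[where f = hat and g = hat] hat_autocorrelation
      by (simp add: vec_int_def algebra_simps)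
    show ?thesis unfolding hat_comb_def gram_def by (subst combination_gram(2)[OF integrable_hat_hat]) (simp only: e)
  qed
qed

lemma hat_comb_diff:
  shows "integrable lborel (\<lambda>y. (hat_comb F w b y - hat_comb F w a y)\<^sup>2)" (is ?A)
    and "(\<integral>y. (hat_comb F w b y - hat_comb F w a y)\<^sup>2 \<partial>lborel) = 2 * (gram F w 0 - gram F w (b - a))" (is ?B)
proof -
  have e: "(hat_comb F w b y - hat_comb F w a y)\<^sup>2 = hat_comb F w b y * hat_comb F w b y
     + hat_comb F w a y * hat_comb F w a y - 2 * (hat_comb F w a y * hat_comb F w b y)" for y
    by (simp add: power2_eq_square algebra_simps)
  show ?A unfolding e by (intro Bochner_Integration.integrable_diff Bochner_Integration.integrable_add integrable_mult_right hat_comb_gram)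
  show ?B unfolding e
    by (simp add: hat_comb_gram Bochner_Integration.integral_diff Bochner_Integration.integral_add Bochner_Integration.integrable_add)
qed

text \<open>Telescoping \<open>V(y + n s) - V(y)\<close> into \<open>n\<close> steps and Cauchy--Schwarz; the gram form is an
  \<open>L\<^sup>2\<close> inner product of translates, since the cubic spline is the autocorrelation of the hat
  function.\<close>

lemma gram_steps: "gram F w 0 - gram F w (real n *\<^sub>R s) \<le> (real n)\<^sup>2 * (gram F w 0 - gram F w s)"
proof -
  let ?V = "\<lambda>i. hat_comb F w (real i *\<^sub>R s)"
  have "2 * (gram F w 0 - gram F w (real n *\<^sub>R s)) = (\<integral>y. (?V n y - ?V 0 y)\<^sup>2 \<partial>lborel)"
    by (simp add: hat_comb_diff)
  also have "\<dots> \<le> (\<integral>y. real n * (\<Sum>i<n. (?V (Suc i) y - ?V i y)\<^sup>2) \<partial>lborel)"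
  proof (rule integral_mono)
    fix y
    have "(?V n y - ?V 0 y)\<^sup>2 = (\<Sum>i<n. ?V (Suc i) y - ?V i y)\<^sup>2"
      by (simp only: sum_lessThan_telescope[of "\<lambda>i. ?V i y" n])
    also have "\<dots> \<le> (\<Sum>i<n. (?V (Suc i) y - ?V i y)\<^sup>2) * card {..<n}"
      by (rule sum_squared_le_sum_of_squares)
    finally show "(?V n y - ?V 0 y)\<^sup>2 \<le> real n * (\<Sum>i<n. (?V (Suc i) y - ?V i y)\<^sup>2)" by (simp add: mult.commute)
  qed (intro hat_comb_diff integrable_mult_right Bochner_Integration.integrable_sum)+
  also have "\<dots> = real n * (\<Sum>i<n. 2 * (gram F w 0 - gram F w s))"
  proof -
    have "(\<integral>y. (?V (Suc i) y - ?V i y)\<^sup>2 \<partial>lborel) = 2 * (gram F w 0 - gram F w s)" for i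
      unfolding hat_comb_diff by (simp add: algebra_simps)
    then show ?thesis
      by (simp only: integral_mult_right_zero Bochner_Integration.integral_sum[OF hat_comb_diff(1)])
  qed
  also have "\<dots> = 2 * ((real n)\<^sup>2 * (gram F w 0 - gram F w s))" by (simp add: power2_eq_square)
  finally show ?thesis by (simp only: mult_le_cancel_left_pos[OF zero_less_numeral])
qed

lemma sum_diagonal:
  fixes c :: real
  assumes "finite F"
  shows "(\<Sum>k\<in>F. \<Sum>m\<in>F. a k m * (if k = m then c else 0)) = (\<Sum>k\<in>F. a k k * c)"
proof (rule sum.cong[OF refl])
  fix k assume "k \<in> F"
  have "(\<Sum>m\<in>F. a k m * (if k = m then c else 0)) = (\<Sum>m\<in>F. if k = m then a k m * c else 0)"
    by (rule sum.cong) auto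
  then show "(\<Sum>m\<in>F. a k m * (if k = m then c else 0)) = a k k * c"
    using assms \<open>k \<in> F\<close> by simp
qed

text \<open>Let X be the combination of dual functions with the same coefficients and S the sum of
  their squares. Then <V, X> = S and |X|^2 = 4^d S; expanding |V - 4^(-d) X|^2 \<ge> 0 gives the
  bound, 4^(-d) being the optimal factor.\<close>

lemma gram_mass:
  fixes w :: "int^'d \<Rightarrow> real"
  assumes F: "finite F"
  shows "(\<Sum>k\<in>F. (w k)\<^sup>2) / 4 ^ CARD('d) \<le> gram F w 0"
proof -
  let ?V = "\<lambda>y. \<Sum>k\<in>F. w k * tensor hat (- vec_int k) y"
  let ?X = "\<lambda>y. \<Sum>k\<in>F. w k * tensor chi (- vec_int k) y"
  let ?e = "1 / 4 ^ CARD('d) :: real" and ?S = "\<Sum>k\<in>F. (w k)\<^sup>2"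
  have p: "(\<Prod>j\<in>UNIV. if (k::int^'d) $ j = m $ j then a else 0) = (if k = m then a ^ CARD('d) else 0)"
    for k m and a :: real
    by (auto simp: vec_eq_iff)
  have hc: "(\<Prod>j\<in>UNIV. \<integral>t. hat (t + (- vec_int k) $ j) * chi (t + (- vec_int m) $ j) \<partial>lborel) = (if k = m then 1 else 0)"
    for k m :: "int^'d"
  proof -
    have "(\<integral>t. hat (t + (- vec_int k) $ j) * chi (t + (- vec_int m) $ j) \<partial>lborel) = (if k $ j = m $ j then 1 else 0)" for j
      using hat_chi[of "k $ j" "m $ j"] by (simp add: vec_int_def)
    then show ?thesis using p[of k m 1] by (simp only: power_one)
  qed
  have VX: "(\<integral>y. ?V y * ?X y \<partial>lborel) = ?S"
    by (subst combination_gram(2)[OF integrable_hat_chi])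
      (simp only: hc sum_diagonal[OF F], simp add: power2_eq_square)
  have XX: "(\<integral>y. ?X y * ?X y \<partial>lborel) = 4 ^ CARD('d) * ?S"
    by (subst combination_gram(2)[OF integrable_chi_chi]) (use F in \<open>simp add: vec_int_def chi_chi p power2_eq_square sum_distrib_left mult_ac if_distrib[of "\<lambda>y. _ * y"] cong: if_cong\<close>)
  have VV: "(\<integral>y. ?V y * ?V y \<partial>lborel) = gram F w 0"
    using hat_comb_gram(2)[of F w 0 0] by (simp add: hat_comb_def)
  note i = combination_gram(1)[OF integrable_hat_hat] combination_gram(1)[OF integrable_hat_chi] combination_gram(1)[OF integrable_chi_chi]
  have "0 \<le> (\<integral>y. (?V y - ?e * ?X y)\<^sup>2 \<partial>lborel)" by (rule Bochner_Integration.integral_nonneg) auto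
  also have "(\<lambda>y. (?V y - ?e * ?X y)\<^sup>2) = (\<lambda>y. ?V y * ?V y + ?e * ?e * (?X y * ?X y) - 2 * ?e * (?V y * ?X y))"
    by (simp add: power2_eq_square algebra_simps)
  also have "(\<integral>y. ?V y * ?V y + ?e * ?e * (?X y * ?X y) - 2 * ?e * (?V y * ?X y) \<partial>lborel) =
      (\<integral>y. ?V y * ?V y \<partial>lborel) + ?e * ?e * (\<integral>y. ?X y * ?X y \<partial>lborel) - 2 * ?e * (\<integral>y. ?V y * ?X y \<partial>lborel)"
    by (subst Bochner_Integration.integral_diff Bochner_Integration.integral_add, intro Bochner_Integration.integrable_add integrable_mult_right i, intro integrable_mult_right i)+
      (simp only: integral_mult_right_zero)
  also have "\<dots> = gram F w 0 - ?e * ?S" unfolding VV XX VX by (simp add: field_simps)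
  finally show ?thesis by simp
qed

text \<open>\<open>A\<close> bounds the coordinatewise spread of the nodes. The number of steps is
  at most (D + \<delta>) / |s|, so dividing by its square leaves a factor |s|^2, precisely what the
  second moment of the kernel can integrate.\<close>

lemma gram_coercive:
  fixes h s :: "real^'d" and A H \<delta> :: real
  assumes h: "\<And>j. 0 < h $ j" "\<And>j. h $ j \<le> H" and F: "finite F"
    and A: "0 \<le> A" "\<And>k m j. k \<in> F \<Longrightarrow> m \<in> F \<Longrightarrow> \<bar>grid_pt h k $ j - grid_pt h m $ j\<bar> \<le> A"
    and s: "norm s \<le> \<delta>"
  shows "(norm s)\<^sup>2 / (real CARD('d) * (A + 2 * H) + \<delta>)\<^sup>2 / 4 ^ CARD('d) * (\<Sum>k\<in>F. (w k)\<^sup>2) \<le>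
    (\<Sum>k\<in>F. \<Sum>m\<in>F. w k * w m * (Psi h m (grid_pt h k) - Psi h m (grid_pt h k + s)))"
proof (cases "s = 0")
  case False
  then have ns: "0 < norm s" by simp
  let ?S = "\<Sum>k\<in>F. (w k)\<^sup>2" and ?D = "real CARD('d) * (A + 2 * H)"
  let ?t = "\<chi> j. s $ j / h $ j"
  have H: "0 < H" using h(1)[of undefined] h(2)[of undefined] by linarith
  have D: "0 < ?D" using A(1) H by simp
  have G: "gram F w (a *\<^sub>R ?t) = (\<Sum>k\<in>F. \<Sum>m\<in>F. w k * w m * Psi h m (grid_pt h k + a *\<^sub>R s))" for a
  proof -
    have "(grid_pt h k + a *\<^sub>R s) $ j / h $ j - of_int (m $ j) = (a *\<^sub>R ?t) $ j + of_int (k $ j) - of_int (m $ j)" for k m j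
      using h(1)[of j] by (simp add: grid_pt_def field_simps)
    then show ?thesis unfolding gram_def by (simp add: Psi_bspline[OF h(1)])
  qed
  \<comment> \<open>The least number of steps with n |s| at least D. The bound |s| \<le> \<delta>
    absorbs the loss from rounding up.\<close>
  define n where "n = nat \<lceil>?D / norm s\<rceil>"
  have n: "?D \<le> real n * norm s" "real n \<le> (?D + \<delta>) / norm s"
  proof -
    have "?D / norm s \<le> real n" unfolding n_def by linarith
    then show "?D \<le> real n * norm s" using ns by (simp add: field_simps)
    have "0 < ?D / norm s" using D ns by simp
    then have "real n \<le> ?D / norm s + 1" unfolding n_def by linarith
    also have "\<dots> \<le> (?D + \<delta>) / norm s" using s ns by (simp add: field_simps)
    finally show "real n \<le> (?D + \<delta>) / norm s" .
  qed
  \<comment> \<open>Some coordinate carries at least the fraction 1/d of the length of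
    \<open>s\<close>; separating the supports in that coordinate is enough.\<close>
  have "\<exists>j. norm s \<le> real CARD('d) * \<bar>s $ j\<bar>"
  proof (rule ccontr)
    assume "\<not> ?thesis"
    then have lt: "\<And>j. real CARD('d) * \<bar>s $ j\<bar> < norm s" by (simp add: not_le)
    have "(\<Sum>j\<in>UNIV. real CARD('d) * \<bar>s $ j\<bar>) < (\<Sum>j\<in>(UNIV::'d set). norm s)"
      by (rule sum_strict_mono) (auto simp: lt)
    then have "(\<Sum>j\<in>UNIV. \<bar>s $ j\<bar>) < norm s" by (simp add: sum_distrib_left[symmetric])
    with norm_le_l1_cart[of s] show False by linarith
  qed
  then obtain j where j: "norm s \<le> real CARD('d) * \<bar>s $ j\<bar>" by blast
  have nj: "A + 2 * H \<le> real n * \<bar>s $ j\<bar>"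
  proof -
    note n(1)
    also have "real n * norm s \<le> real n * (real CARD('d) * \<bar>s $ j\<bar>)"
      using j by (intro mult_left_mono) auto
    also have "\<dots> = real CARD('d) * (real n * \<bar>s $ j\<bar>)" by (rule mult.left_commute)
    finally show ?thesis by (simp only: mult_le_cancel_left_pos zero_less_card_finite of_nat_0_less_iff)
  qed
  have "Psi h m (grid_pt h k + real n *\<^sub>R s) = 0" if "k \<in> F" "m \<in> F" for k m
  proof -
    \<comment> \<open>The shift exceeds the spread \<open>A\<close> by 2 H, and 2 H is at least the
      half-width 2 h_j of a basis function.\<close>
    have "2 * H \<le> \<bar>(grid_pt h k + real n *\<^sub>R s) $ j - grid_pt h m $ j\<bar>"
    proof -
      have "\<bar>(real n *\<^sub>R s) $ j\<bar> = real n * \<bar>s $ j\<bar>" by (simp add: abs_mult)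
      moreover have "\<bar>(real n *\<^sub>R s) $ j\<bar> \<le> \<bar>(grid_pt h k + real n *\<^sub>R s) $ j - grid_pt h m $ j\<bar> + \<bar>grid_pt h k $ j - grid_pt h m $ j\<bar>"
        by (simp add: algebra_simps)
      ultimately show ?thesis using nj A(2)[OF that, of j] by linarith
    qed
    also have "(grid_pt h k + real n *\<^sub>R s) $ j - grid_pt h m $ j =
        ((grid_pt h k + real n *\<^sub>R s) $ j / h $ j - of_int (m $ j)) * h $ j"
      using h(1)[of j] by (simp add: grid_pt_def field_simps)
    finally have "2 * h $ j \<le> \<bar>(grid_pt h k + real n *\<^sub>R s) $ j / h $ j - of_int (m $ j)\<bar> * h $ j"
      using h[of j] by (simp only: abs_mult abs_of_pos)
    then have "2 \<le> \<bar>(grid_pt h k + real n *\<^sub>R s) $ j / h $ j - of_int (m $ j)\<bar>"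
      by (rule mult_right_le_imp_le) (rule h(1))
    then have "bspline ((grid_pt h k + real n *\<^sub>R s) $ j / h $ j - of_int (m $ j)) = 0" by (rule bspline_zero)
    then show ?thesis unfolding Psi_bspline[OF h(1)] by (intro prod_zero) auto
  qed
  then have "gram F w (real n *\<^sub>R ?t) = 0" unfolding G by simp
  then have 1: "gram F w 0 \<le> (real n)\<^sup>2 * (gram F w 0 - gram F w ?t)" using gram_steps[of F w n ?t] by simp
  have S: "0 \<le> ?S" by (intro sum_nonneg) auto
  have m: "?S / 4 ^ CARD('d) \<le> gram F w 0" by (rule gram_mass[OF F])
  have n0: "0 < real n" using n(1) D ns by (cases n) auto
  \<comment> \<open>Nonnegativity is needed to replace n^2 by its upper bound in the next
    step.\<close>
  have nn: "0 \<le> gram F w 0 - gram F w ?t"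
  proof -
    have "0 \<le> (real n)\<^sup>2 * (gram F w 0 - gram F w ?t)" using 1 m S by (smt (verit) divide_nonneg_nonneg zero_le_power)
    then show ?thesis using n0 by (simp add: zero_le_mult_iff)
  qed
  have "?S / 4 ^ CARD('d) \<le> ((?D + \<delta>) / norm s)\<^sup>2 * (gram F w 0 - gram F w ?t)"
  proof -
    have "(real n)\<^sup>2 * (gram F w 0 - gram F w ?t) \<le> ((?D + \<delta>) / norm s)\<^sup>2 * (gram F w 0 - gram F w ?t)"
      using n(2) nn by (intro mult_right_mono power_mono) auto
    with 1 m show ?thesis by linarith
  qed
  moreover have "0 < ?D + \<delta>" using D s ns by linarith
  ultimately have "(norm s)\<^sup>2 / (?D + \<delta>)\<^sup>2 / 4 ^ CARD('d) * ?S \<le> gram F w 0 - gram F w ?t"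
    using ns by (simp add: power_divide field_simps)
  moreover have "gram F w 0 - gram F w ?t = (\<Sum>k\<in>F. \<Sum>m\<in>F. w k * w m * (Psi h m (grid_pt h k) - Psi h m (grid_pt h k + s)))"
    using G[of 0] G[of 1] by (simp add: sum_subtractf right_diff_distrib)
  ultimately show ?thesis by simp
qed simp

section \<open>The nonlocal operators\<close>

lemma lborel_integral_scaleR:
  fixes f :: "real^'d \<Rightarrow> 'b::{banach, second_countable_topology}"
  assumes c: "c \<noteq> 0" and f [measurable]: "f \<in> borel_measurable borel"
  shows "integrable lborel (\<lambda>x. f (c *\<^sub>R x)) \<longleftrightarrow> integrable lborel f"
    and "integral\<^sup>L lborel f = \<bar>c\<bar> ^ CARD('d) *\<^sub>R (\<integral>x. f (c *\<^sub>R x) \<partial>lborel)"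
proof -
  have l: "lborel = density (distr lborel borel (\<lambda>x::real^'d. c *\<^sub>R x)) (\<lambda>_. ennreal (\<bar>c\<bar> ^ CARD('d)))"
    using lborel_affine[OF c, where t = "0 :: real^'d"] by (simp add: ennreal_power)
  have "integrable lborel f \<longleftrightarrow> integrable (distr lborel borel (\<lambda>x::real^'d. c *\<^sub>R x)) (\<lambda>x. \<bar>c\<bar> ^ CARD('d) *\<^sub>R f x)"
    by (subst l, subst integrable_density) auto
  also have "\<dots> \<longleftrightarrow> integrable lborel (\<lambda>x. \<bar>c\<bar> ^ CARD('d) *\<^sub>R f (c *\<^sub>R x))"
    by (subst integrable_distr_eq) auto
  also have "\<dots> \<longleftrightarrow> integrable lborel (\<lambda>x. f (c *\<^sub>R x))"
  proof
    assume "integrable lborel (\<lambda>x. \<bar>c\<bar> ^ CARD('d) *\<^sub>R f (c *\<^sub>R x))"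
    from integrable_scaleR_right[OF this, of "1 / \<bar>c\<bar> ^ CARD('d)"] c
    show "integrable lborel (\<lambda>x. f (c *\<^sub>R x))" by simp
  qed (rule integrable_scaleR_right)
  finally show "integrable lborel (\<lambda>x. f (c *\<^sub>R x)) \<longleftrightarrow> integrable lborel f" by simp
  have "integral\<^sup>L lborel f = integral\<^sup>L (distr lborel borel (\<lambda>x::real^'d. c *\<^sub>R x)) (\<lambda>x. \<bar>c\<bar> ^ CARD('d) *\<^sub>R f x)"
    by (subst l, subst integral_density) auto
  also have "\<dots> = (\<integral>x. \<bar>c\<bar> ^ CARD('d) *\<^sub>R f (c *\<^sub>R x) \<partial>lborel)"
    by (subst integral_distr) auto
  finally show "integral\<^sup>L lborel f = \<bar>c\<bar> ^ CARD('d) *\<^sub>R (\<integral>x. f (c *\<^sub>R x) \<partial>lborel)" by simp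
qed

lemma lborel_integral_uminus:
  fixes f :: "real^'d \<Rightarrow> 'b::{banach, second_countable_topology}"
  assumes "f \<in> borel_measurable borel"
  shows "integrable lborel (\<lambda>x. f (- x)) \<longleftrightarrow> integrable lborel f"
    and "integral\<^sup>L lborel f = (\<integral>x. f (- x) \<partial>lborel)"
  using lborel_integral_scaleR[of "- 1" f] assms by simp_all

text \<open>Together with the exchange of two coordinates this determines the second-moment matrix
  of a radial weight: reflections annihilate its off-diagonal entries and exchanges equate the
  diagonal ones.\<close>

lemma lborel_integral_reflect:
  fixes f :: "real^'d \<Rightarrow> real"
  assumes f [measurable]: "f \<in> borel_measurable borel"
  shows "integral\<^sup>L lborel f = (\<integral>x. f (\<chi> k. if k = i then - x $ k else x $ k) \<partial>lborel)"
proof -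
  let ?c = "\<lambda>b::real^'d. if b = axis i 1 then - 1 else (1::real)"
  let ?T = "\<lambda>x::real^'d. 0 + (\<Sum>j\<in>Basis. (?c j * (x \<bullet> j)) *\<^sub>R j)"
  have T: "?T x = (\<chi> k. if k = i then - x $ k else x $ k)" for x
  proof (rule vec_eq_iff[THEN iffD2], rule allI)
    fix k
    have "?T x $ k = ?T x \<bullet> axis k 1" by (simp add: inner_axis)
    also have "\<dots> = ?c (axis k 1) * (x \<bullet> axis k 1)"
      by (simp only: add_0_left, rule inner_sum_left_Basis) (auto simp: Basis_vec_def)
    finally show "?T x $ k = (\<chi> k. if k = i then - x $ k else x $ k) $ k"
      by (simp add: inner_axis axis_eq_axis)
  qed
  have p: "(\<Prod>j\<in>(Basis::(real^'d) set). \<bar>?c j\<bar>) = 1" by (rule prod.neutral) auto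
  have M: "?T \<in> borel_measurable borel" by measurable
  have "lborel = distr lborel borel ?T"
    using lborel_affine_euclidean[of ?c 0] unfolding p by (simp add: density_1)
  then have "integral\<^sup>L lborel f = integral\<^sup>L (distr lborel borel ?T) f" by simp
  also have "\<dots> = (\<integral>x. f (?T x) \<partial>lborel)" by (rule integral_distr) (use M in auto)
  finally show ?thesis unfolding T .
qed

lemma lborel_integral_swap:
  fixes f :: "real^'d \<Rightarrow> real"
  assumes f [measurable]: "f \<in> borel_measurable borel"
  shows "integral\<^sup>L lborel f = (\<integral>x. f (\<chi> k. x $ (Transposition.transpose i j k)) \<partial>lborel)"
proof -
  let ?p = "Transposition.transpose i j" and ?T = "\<lambda>x::real^'d. \<chi> k. x $ (Transposition.transpose i j k)"
  have [measurable]: "?T \<in> borel_measurable borel"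
    by (intro borel_measurable_continuous_onI continuous_intros)
  have B: "(\<Prod>b\<in>Basis. (y::real^'d) \<bullet> b) = (\<Prod>k\<in>UNIV. y $ k)" for y
  proof -
    have r: "Basis = range (\<lambda>j::'d. axis j (1::real))" by (auto simp: Basis_vec_def)
    have i: "inj (\<lambda>j::'d. axis j (1::real))" by (auto simp: inj_on_def axis_eq_axis)
    show ?thesis unfolding r by (subst prod.reindex[OF i]) (simp add: inner_axis)
  qed
  have "lborel = distr lborel borel ?T"
  proof (rule lborel_eqI)
    fix l u :: "real^'d" assume le: "\<And>b. b \<in> Basis \<Longrightarrow> l \<bullet> b \<le> u \<bullet> b"
    have lu: "l $ k \<le> u $ k" for k
      using le[of "axis k 1"] by (auto simp: inner_axis Basis_vec_def)
    have "?T -` box l u = box (?T l) (?T u)"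
    proof (intro set_eqI)
      fix x
      have "(\<forall>k. l $ k < x $ ?p k \<and> x $ ?p k < u $ k) \<longleftrightarrow> (\<forall>k. l $ ?p k < x $ k \<and> x $ k < u $ ?p k)"
        by (metis transpose_involutory)
      then show "x \<in> ?T -` box l u \<longleftrightarrow> x \<in> box (?T l) (?T u)" by (simp add: mem_box_cart)
    qed
    then have "emeasure (distr lborel borel ?T) (box l u) = emeasure lborel (box (?T l) (?T u))"
      by (subst emeasure_distr) auto
    also have "\<dots> = (\<Prod>b\<in>Basis. (?T u - ?T l) \<bullet> b)"
    proof (rule emeasure_lborel_box)
      fix b :: "real^'d" assume "b \<in> Basis"
      then obtain k where "b = axis k 1" by (auto simp: Basis_vec_def)
      then show "?T l \<bullet> b \<le> ?T u \<bullet> b" using lu by (simp add: inner_axis)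
    qed
    also have "(\<Prod>b\<in>Basis. (?T u - ?T l) \<bullet> b) = (\<Prod>k\<in>UNIV. (u - l) $ ?p k)" unfolding B by simp
    also have "\<dots> = (\<Prod>k\<in>UNIV. (u - l) $ k)"
      by (rule prod.reindex_bij_betw) (simp add: bij_betw_def)
    also have "\<dots> = (\<Prod>b\<in>Basis. (u - l) \<bullet> b)" by (rule B[symmetric])
    finally show "emeasure (distr lborel borel ?T) (box l u) = ennreal (\<Prod>b\<in>Basis. (u - l) \<bullet> b)" .
  qed simp
  then have "integral\<^sup>L lborel f = integral\<^sup>L (distr lborel borel ?T) f" by simp
  also have "\<dots> = (\<integral>x. f (?T x) \<partial>lborel)" by (rule integral_distr) auto
  finally show ?thesis .
qed

text \<open>The cutoff to the ball is part of the weight, so all integrals run over the whole space.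
  Its sign at the origin is unknown, since \<rho> is unrestricted there.\<close>

definition wt :: "(real \<Rightarrow> real) \<Rightarrow> real \<Rightarrow> real^'d \<Rightarrow> real" where
  "wt \<rho> \<delta> s = indicat_real (ball 0 \<delta>) s * rho_scaled TYPE('d) \<rho> \<delta> (norm s)"

locale kernel =
  fixes T :: "'d::finite itself" and \<rho> :: "real \<Rightarrow> real" and \<delta> :: real
  assumes adm: "admissible_kernel TYPE('d) \<rho>" and delta_pos: "0 < \<delta>"
begin

text \<open>Monotonicity on the positive reals supplies measurability; the value at the origin is
  patched separately.\<close>

lemma rho_measurable: "(\<lambda>s::real^'d. \<rho> (norm s)) \<in> borel_measurable borel"
proof -
  define g where "g r = (if 0 < r then - \<rho> r else 0)" for r
  have "antimono_on {0<..} \<rho>" using adm by (simp add: admissible_kernel_def)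
  then have "mono_on {0<..} g" "mono_on {..0} g"
    by (auto simp: g_def monotone_on_def)
  then have [measurable]: "g \<in> borel_measurable borel"
    by (intro borel_measurable_piecewise_mono[of "{{0<..}, {..0}}"]) auto
  have "(\<lambda>s::real^'d. \<rho> (norm s)) = (\<lambda>s. if s \<in> {0} then \<rho> 0 else - g (norm s))"
    by (auto simp: g_def)
  then show ?thesis by simp
qed

abbreviation w :: "real^'d \<Rightarrow> real" where "w \<equiv> wt \<rho> \<delta>"

lemma wt_measurable [measurable]: "w \<in> borel_measurable borel"
proof -
  have "(\<lambda>s::real^'d. \<rho> (norm ((1 / \<delta>) *\<^sub>R s))) \<in> borel_measurable borel"
    using rho_measurable by (rule measurable_compose[rotated]) measurable
  then have "(\<lambda>s::real^'d. \<rho> (norm s / \<delta>)) \<in> borel_measurable borel" using delta_pos by simp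
  then show ?thesis unfolding wt_def[abs_def] rho_scaled_def
    by (intro borel_measurable_times borel_measurable_indicator borel_measurable_divide) auto
qed

lemma wt_nonneg: "s \<noteq> 0 \<Longrightarrow> 0 \<le> w s"
  using adm delta_pos by (auto simp: wt_def rho_scaled_def admissible_kernel_def)

lemma wt_uminus: "w (- s) = w s" by (simp add: wt_def indicator_def)

lemma wt_outside: "\<delta> \<le> norm s \<Longrightarrow> w s = 0" by (simp add: wt_def indicator_def)

lemma wt_norm_sq: "\<bar>w s\<bar> * (norm s)\<^sup>2 = w s * (norm s)\<^sup>2"
  by (cases "s = 0") (auto simp: wt_nonneg)

text \<open>The exponent d + 2 in the scaling makes the second moment independent of \<delta>.
  Integrability follows from the moment condition, because the integral of a non-integrable function
  would be 0 and not d.\<close>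

lemma wt_second_moment:
  shows "integrable lborel (\<lambda>s. w s * (norm s)\<^sup>2)" (is ?A)
    and "(\<integral>s. w s * (norm s)\<^sup>2 \<partial>lborel) = real CARD('d)" (is ?B)
proof -
  let ?k = "\<lambda>s::real^'d. indicat_real (ball 0 1) s * (\<rho> (norm s) * (norm s)\<^sup>2)"
  let ?g = "\<lambda>s. w s * (norm s)\<^sup>2"
  have k: "(\<integral>s. ?k s \<partial>lborel) = real CARD('d)"
    using adm by (simp add: admissible_kernel_def set_lebesgue_integral_def)
  have ki: "integrable lborel ?k"
  proof (rule ccontr)
    assume "\<not> integrable lborel ?k"
    then have "(\<integral>s. ?k s \<partial>lborel) = 0" by (rule not_integrable_integral_eq)
    with k show False by simp
  qed
  have e: "?g (\<delta> *\<^sub>R s) = ?k s / \<delta> ^ CARD('d)" for s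
    using delta_pos by (simp add: wt_def rho_scaled_def indicator_def power_add power_mult_distrib power2_eq_square field_simps)
  have gm: "?g \<in> borel_measurable borel" by measurable
  have "integrable lborel (\<lambda>s. ?g (\<delta> *\<^sub>R s))" unfolding e using ki by simp
  then show ?A using lborel_integral_scaleR(1)[OF _ gm, of \<delta>] delta_pos by simp
  have "integral\<^sup>L lborel ?g = \<delta> ^ CARD('d) * (\<integral>s. ?g (\<delta> *\<^sub>R s) \<partial>lborel)"
    using lborel_integral_scaleR(2)[OF _ gm, of \<delta>] delta_pos by simp
  also have "\<dots> = real CARD('d)" unfolding e using k delta_pos by simp
  finally show ?B .
qed

text \<open>The source of uniformity in \<delta>: any integrand of size K |s|^2 costs the factor d,
  whatever the horizon.\<close>

lemma integrable_wt:
  fixes f :: "real^'d \<Rightarrow> 'b::{banach, second_countable_topology}"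
  assumes [measurable]: "f \<in> borel_measurable borel" and b: "\<And>s. norm (f s) \<le> K * (norm s)\<^sup>2"
  shows "integrable lborel (\<lambda>s. w s *\<^sub>R f s)"
    and "norm (\<integral>s. w s *\<^sub>R f s \<partial>lborel) \<le> K * real CARD('d)"
proof -
  have le: "norm (w s *\<^sub>R f s) \<le> K * (w s * (norm s)\<^sup>2)" for s
  proof -
    have "norm (w s *\<^sub>R f s) \<le> \<bar>w s\<bar> * (K * (norm s)\<^sup>2)" using b[of s] by (simp add: mult_left_mono)
    also have "\<dots> = K * (w s * (norm s)\<^sup>2)" unfolding wt_norm_sq[symmetric] by (simp add: mult_ac)
    finally show ?thesis .
  qed
  show i: "integrable lborel (\<lambda>s. w s *\<^sub>R f s)"
    by (rule Bochner_Integration.integrable_bound[OF integrable_mult_right[OF wt_second_moment(1), of K]])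
      (auto intro!: AE_I2 order_trans[OF le] simp del: norm_scaleR)
  have "norm (\<integral>s. w s *\<^sub>R f s \<partial>lborel) \<le> (\<integral>s. norm (w s *\<^sub>R f s) \<partial>lborel)" by (rule integral_norm_bound)
  also have "\<dots> \<le> (\<integral>s. K * (w s * (norm s)\<^sup>2) \<partial>lborel)"
    by (rule integral_mono) (use le i wt_second_moment(1) in \<open>auto intro: integrable_norm integrable_mult_right simp del: norm_scaleR\<close>)
  also have "\<dots> = K * real CARD('d)" by (simp add: wt_second_moment)
  finally show "norm (\<integral>s. w s *\<^sub>R f s \<partial>lborel) \<le> K * real CARD('d)" .
qed

text \<open>By symmetry the moment matrix is a multiple of the identity, and its trace is the second
  moment d.\<close>

lemma wt_coordinate_moments:
  "(\<integral>s. w s * (s $ i * s $ j) \<partial>lborel) = (if i = j then 1 else 0)"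
    and wt_coordinate_integrable: "integrable lborel (\<lambda>s. w s * (s $ i * s $ j))"
proof -
  have int: "integrable lborel (\<lambda>s. w s * (s $ i * s $ j))" for i j
  proof -
    have "norm (s $ i * s $ j) \<le> 1 * (norm s)\<^sup>2" for s :: "real^'d"
      unfolding power2_eq_square real_norm_def abs_mult mult_1
      by (intro mult_mono component_le_norm_cart) auto
    from integrable_wt(1)[of "\<lambda>s. s $ i * s $ j", OF _ this] show ?thesis by simp
  qed
  then show "integrable lborel (\<lambda>s. w s * (s $ i * s $ j))" .
  let ?I = "\<lambda>i j. \<integral>s. w s * (s $ i * s $ j) \<partial>lborel"
  have M: "(\<lambda>s. w s * (s $ i * s $ j)) \<in> borel_measurable borel" for i j by measurable
  have nr: "w (\<chi> k. if k = i then - s $ k else s $ k) = w s" for i s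
  proof -
    have "norm (\<chi> k. if k = i then - s $ k else s $ k) = norm s"
      unfolding norm_vec_def by (intro arg_cong2[where f = L2_set] ext) auto
    then show ?thesis by (simp add: wt_def indicator_def)
  qed
  have ns: "w (\<chi> k. s $ (Transposition.transpose i j k)) = w s" for i j s
  proof -
    have "(\<Sum>k\<in>UNIV. (s $ (Transposition.transpose i j k))\<^sup>2) = (\<Sum>k\<in>UNIV. (s $ k)\<^sup>2)"
      by (rule sum.reindex_bij_betw) (simp add: bij_betw_def)
    then have "norm (\<chi> k. s $ (Transposition.transpose i j k)) = norm s"
      by (simp add: norm_vec_def L2_set_def)
    then show ?thesis by (simp add: wt_def indicator_def)
  qed
  have off: "?I i j = 0" if "i \<noteq> j" for i j
  proof -
    have "?I i j = (\<integral>s. - (w s * (s $ i * s $ j)) \<partial>lborel)"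
      by (subst lborel_integral_reflect[OF M, of i j i]) (use that in \<open>simp add: nr\<close>)
    then show ?thesis by simp
  qed
  have diag: "?I i i = ?I j j" for i j
    by (subst lborel_integral_swap[OF M, of i i i j]) (simp add: ns)
  have "(\<Sum>k\<in>UNIV. ?I k k) = (\<integral>s. (\<Sum>k\<in>UNIV. w s * (s $ k * s $ k)) \<partial>lborel)"
    by (rule Bochner_Integration.integral_sum[symmetric]) (rule int)
  also have "\<dots> = (\<integral>s. w s * (norm s)\<^sup>2 \<partial>lborel)"
    by (simp add: sum_distrib_left[symmetric] power2_norm_eq_inner inner_vec_def)
  also have "\<dots> = real CARD('d)" by (rule wt_second_moment)
  finally have "(\<Sum>k\<in>UNIV. ?I k k) = real CARD('d)" .
  moreover have "(\<Sum>k\<in>UNIV. ?I k k) = (\<Sum>k\<in>(UNIV::'d set). ?I i i)" by (intro sum.cong refl diag)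
  ultimately have "?I i i = 1" by simp
  with off[of i j] show "?I i j = (if i = j then 1 else 0)" by auto
qed

text \<open>Averaging the projections on \<open>s\<close> recovers the full norm of a vector. This
  is how scalar estimates for each direction add up to a vector-valued one.\<close>

lemma wt_isotropic:
  shows "integrable lborel (\<lambda>s. w s * (s \<bullet> c)\<^sup>2)" and "(\<integral>s. w s * (s \<bullet> c)\<^sup>2 \<partial>lborel) = (norm c)\<^sup>2"
proof -
  have e: "w s * (s \<bullet> c)\<^sup>2 = (\<Sum>i\<in>UNIV. \<Sum>j\<in>UNIV. c $ i * c $ j * (w s * (s $ i * s $ j)))" for s
    unfolding power2_eq_square inner_vec_def sum_product by (simp add: sum_distrib_left mult_ac)
  show "integrable lborel (\<lambda>s. w s * (s \<bullet> c)\<^sup>2)"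
    unfolding e by (intro Bochner_Integration.integrable_sum integrable_mult_right wt_coordinate_integrable)
  have "(\<integral>s. w s * (s \<bullet> c)\<^sup>2 \<partial>lborel) = (\<Sum>i\<in>UNIV. \<Sum>j\<in>UNIV. c $ i * c $ j * (\<integral>s. w s * (s $ i * s $ j) \<partial>lborel))"
    unfolding e
    by (simp add: Bochner_Integration.integral_sum Bochner_Integration.integrable_sum wt_coordinate_integrable integrable_mult_right)
  also have "\<dots> = (\<Sum>i\<in>UNIV. c $ i * c $ i)"
    unfolding wt_coordinate_moments by (simp add: if_distrib[of "\<lambda>y. _ * y"] cong: if_cong)
  finally show "(\<integral>s. w s * (s \<bullet> c)\<^sup>2 \<partial>lborel) = (norm c)\<^sup>2"
    by (simp add: power2_norm_eq_inner inner_vec_def)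
qed

section \<open>The operators on Lipschitz functions and the principal value\<close>

lemma D_op_wt: "D_op \<rho> \<delta> u x = (\<integral>s. w s *\<^sub>R (s \<bullet> (u (x + s) - u x)) \<partial>lborel)" for x :: "real^'d"
  unfolding D_op_def set_lebesgue_integral_def wt_def by (simp add: mult.assoc)

lemma G_op_wt: "G_op \<rho> \<delta> \<theta> x = (\<integral>s. w s *\<^sub>R ((\<theta> (x + s) - \<theta> x) *\<^sub>R s) \<partial>lborel)" for x :: "real^'d"
  unfolding G_op_def set_lebesgue_integral_def wt_def by (simp add: mult.assoc)

definition lip :: "(real^'d \<Rightarrow> 'b::real_normed_vector) \<Rightarrow> bool" where
  "lip v \<longleftrightarrow> (\<exists>L. \<forall>x s. norm (v (x + s) - v x) \<le> L * norm s)"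

lemma lip_continuous: "lip v \<Longrightarrow> continuous_on UNIV v"
proof -
  assume "lip v"
  then obtain L where L: "\<And>x s. norm (v (x + s) - v x) \<le> L * norm s" unfolding lip_def by blast
  have "(max L 0)-lipschitz_on UNIV v"
  proof (rule lipschitz_onI)
    fix x y :: "real^'d"
    have "norm (v x - v y) \<le> L * norm (x - y)" using L[of y "x - y"] by simp
    also have "\<dots> \<le> max L 0 * norm (x - y)" by (intro mult_right_mono) auto
    finally show "dist (v x) (v y) \<le> max L 0 * dist x y" by (simp add: dist_norm)
  qed simp
  then show ?thesis by (rule lipschitz_on_continuous_on)
qed

lemma lip_measurable: "lip v \<Longrightarrow> v \<in> borel_measurable borel"
  by (intro borel_measurable_continuous_onI lip_continuous)

lemma lip_measurable_shift:
  assumes "lip v"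
  shows "(\<lambda>s. v (x + s)) \<in> borel_measurable borel" "(\<lambda>s. v (x - s)) \<in> borel_measurable borel"
  using lip_measurable[OF assms] by (auto intro: measurable_compose[rotated])

lemma D_op_integrand:
  fixes u :: "real^'d \<Rightarrow> real^'d"
  assumes "lip u" "\<And>s. norm (u (x + s) - u x) \<le> K * norm s"
  shows "integrable lborel (\<lambda>s. w s *\<^sub>R (s \<bullet> (u (x + s) - u x)))"
    and "\<bar>D_op \<rho> \<delta> u x\<bar> \<le> K * real CARD('d)"
proof -
  have m: "(\<lambda>s. s \<bullet> (u (x + s) - u x)) \<in> borel_measurable borel"
    using lip_measurable_shift(1)[OF assms(1)] by measurable
  have b: "norm (s \<bullet> (u (x + s) - u x)) \<le> K * (norm s)\<^sup>2" for s
    using Cauchy_Schwarz_ineq2[of s "u (x + s) - u x"] mult_left_mono[OF assms(2)[of s], of "norm s"]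
    by (simp add: power2_eq_square mult_ac)
  show "integrable lborel (\<lambda>s. w s *\<^sub>R (s \<bullet> (u (x + s) - u x)))" by (rule integrable_wt(1)[OF m b])
  show "\<bar>D_op \<rho> \<delta> u x\<bar> \<le> K * real CARD('d)"
    using integrable_wt(2)[OF m b] by (simp only: D_op_wt real_norm_def)
qed

lemma D_op_integrable:
  fixes u :: "real^'d \<Rightarrow> real^'d"
  assumes "lip u"
  shows "integrable lborel (\<lambda>s. w s *\<^sub>R (s \<bullet> (u (x + s) - u x)))"
  using assms D_op_integrand(1)[OF assms] unfolding lip_def by blast

lemma G_op_integrand:
  fixes \<theta> :: "real^'d \<Rightarrow> real"
  assumes "lip \<theta>" "\<And>s. \<bar>\<theta> (x + s) - \<theta> x\<bar> \<le> K * norm s"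
  shows "integrable lborel (\<lambda>s. w s *\<^sub>R ((\<theta> (x + s) - \<theta> x) *\<^sub>R s))"
    and "norm (G_op \<rho> \<delta> \<theta> x) \<le> K * real CARD('d)"
proof -
  have m: "(\<lambda>s. (\<theta> (x + s) - \<theta> x) *\<^sub>R s) \<in> borel_measurable borel"
    using lip_measurable_shift(1)[OF assms(1)] by measurable
  have b: "norm ((\<theta> (x + s) - \<theta> x) *\<^sub>R s) \<le> K * (norm s)\<^sup>2" for s
    using mult_right_mono[OF assms(2)[of s], of "norm s"]
    by (simp add: power2_eq_square mult_ac)
  show "integrable lborel (\<lambda>s. w s *\<^sub>R ((\<theta> (x + s) - \<theta> x) *\<^sub>R s))" by (rule integrable_wt(1)[OF m b])
  show "norm (G_op \<rho> \<delta> \<theta> x) \<le> K * real CARD('d)"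
    using integrable_wt(2)[OF m b] by (simp only: G_op_wt)
qed

lemma G_op_integrable:
  fixes \<theta> :: "real^'d \<Rightarrow> real"
  assumes "lip \<theta>"
  shows "integrable lborel (\<lambda>s. w s *\<^sub>R ((\<theta> (x + s) - \<theta> x) *\<^sub>R s))"
  using assms G_op_integrand(1)[OF assms] unfolding lip_def real_norm_def by blast

lemma D_op_diff:
  fixes u v :: "real^'d \<Rightarrow> real^'d"
  assumes "lip u" "lip v"
  shows "D_op \<rho> \<delta> (\<lambda>y. u y - v y) x = D_op \<rho> \<delta> u x - D_op \<rho> \<delta> v x"
  unfolding D_op_wt Bochner_Integration.integral_diff[OF D_op_integrable[OF assms(1)] D_op_integrable[OF assms(2)], symmetric]
  by (rule Bochner_Integration.integral_cong) (auto simp: algebra_simps inner_diff_right)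

lemma G_op_diff:
  fixes \<theta> \<eta> :: "real^'d \<Rightarrow> real"
  assumes "lip \<theta>" "lip \<eta>"
  shows "G_op \<rho> \<delta> (\<lambda>y. \<theta> y - \<eta> y) x = G_op \<rho> \<delta> \<theta> x - G_op \<rho> \<delta> \<eta> x"
  unfolding G_op_wt Bochner_Integration.integral_diff[OF G_op_integrable[OF assms(1)] G_op_integrable[OF assms(2)], symmetric]
  by (rule Bochner_Integration.integral_cong) (auto simp: algebra_simps)

text \<open>Averaging the principal value integrand over \<open>s\<close> and \<open>- s\<close> makes it absolutely integrable.\<close>

definition LB_sym :: "(real^'d \<Rightarrow> real^'d) \<Rightarrow> real^'d \<Rightarrow> real^'d \<Rightarrow> real^'d" where
  "LB_sym v x s = ((s \<bullet> (v (x + s) + v (x - s) - 2 *\<^sub>R v x)) / (2 * (norm s)\<^sup>2)) *\<^sub>R s"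

lemma LB_sym_bound:
  assumes "norm (v (x + s) + v (x - s) - 2 *\<^sub>R v x) \<le> K * (norm s)\<^sup>2"
  shows "norm (LB_sym v x s) \<le> K * (norm s)\<^sup>2"
proof (cases "s = 0")
  case False
  let ?D = "v (x + s) + v (x - s) - 2 *\<^sub>R v x"
  have "norm (LB_sym v x s) = \<bar>s \<bullet> ?D\<bar> / (2 * (norm s)\<^sup>2) * norm s" by (simp add: LB_sym_def)
  also have "\<dots> \<le> (norm s * norm ?D) / (2 * (norm s)\<^sup>2) * norm s"
    by (intro mult_right_mono divide_right_mono Cauchy_Schwarz_ineq2) auto
  also have "\<dots> = norm ?D / 2" using False by (simp add: power2_eq_square)
  also have "\<dots> \<le> norm ?D" by simp
  finally show ?thesis using assms by linarith
qed (simp add: LB_sym_def)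

lemma LB_sym_measurable: "lip v \<Longrightarrow> LB_sym v x \<in> borel_measurable borel"
proof -
  assume "lip v"
  note [measurable] = lip_measurable_shift[OF this]
  show ?thesis unfolding LB_sym_def[abs_def] by measurable
qed

text \<open>Off the ball of radius \<epsilon> the integrand is bounded by (L / \<epsilon>) |s|^2 and
  hence integrable against the weight, so it may be averaged over \<open>s\<close> and - s. The
  averaged integrand is integrable near the origin too, and dominated convergence removes the
  cutoff.\<close>

lemma LB_eq_sym:
  fixes v :: "real^'d \<Rightarrow> real^'d"
  assumes v: "lip v" and K: "\<And>s. norm (v (x + s) + v (x - s) - 2 *\<^sub>R v x) \<le> K * (norm s)\<^sup>2"
  shows "integrable lborel (\<lambda>s. w s *\<^sub>R LB_sym v x s)"
    and "LB \<rho> \<delta> v x = (\<integral>s. w s *\<^sub>R LB_sym v x s \<partial>lborel)"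
    and "norm (LB \<rho> \<delta> v x) \<le> K * real CARD('d)"
proof -
  note [measurable] = lip_measurable_shift[OF v] LB_sym_measurable[OF v, of x]
  note bd = integrable_wt[OF LB_sym_measurable[OF v, of x] LB_sym_bound[OF K]]
  show i: "integrable lborel (\<lambda>s. w s *\<^sub>R LB_sym v x s)" by (rule bd)
  obtain L where L: "\<And>x s. norm (v (x + s) - v x) \<le> L * norm s" using v unfolding lip_def by blast
  let ?F = "\<lambda>s. ((s \<bullet> (v (x + s) - v x)) / (norm s)\<^sup>2) *\<^sub>R s"
  have cut: "(LINT s:ball 0 \<delta> - ball 0 \<epsilon>|lborel. LB_integrand \<rho> \<delta> v x s) =
      (\<integral>s. indicat_real (- ball 0 \<epsilon>) s *\<^sub>R (w s *\<^sub>R LB_sym v x s) \<partial>lborel)" if e: "0 < \<epsilon>" for \<epsilon>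
  proof -
    let ?J = "\<lambda>s. w s *\<^sub>R (indicat_real (- ball 0 \<epsilon>) s *\<^sub>R ?F s)"
    have Jm: "(\<lambda>s. indicat_real (- ball 0 \<epsilon>) s *\<^sub>R ?F s) \<in> borel_measurable borel" by measurable
    have Ji: "integrable lborel ?J"
    proof (rule integrable_wt(1)[OF Jm])
      fix s
      show "norm (indicat_real (- ball 0 \<epsilon>) s *\<^sub>R ?F s) \<le> (L / \<epsilon>) * (norm s)\<^sup>2"
      proof (cases "norm s < \<epsilon>")
        case True
        have "0 \<le> L * norm s" using L[of x s] norm_ge_zero order_trans by blast
        then have "0 \<le> L / \<epsilon> * (norm s * norm s)" using e by (simp add: mult.assoc[symmetric] divide_nonneg_pos)
        then show ?thesis using True by (simp add: indicator_def power2_eq_square)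
      next
        case False
        then have s: "0 < norm s" using e by linarith
        have "norm (?F s) \<le> (norm s * norm (v (x + s) - v x)) / (norm s)\<^sup>2 * norm s"
          unfolding norm_scaleR abs_divide using Cauchy_Schwarz_ineq2[of s "v (x + s) - v x"]
          using s by (intro mult_right_mono frac_le) auto
        also have "\<dots> = norm (v (x + s) - v x)" using s by (simp add: power2_eq_square)
        also have "\<dots> \<le> L * norm s" by (rule L)
        also have "\<dots> \<le> (L * norm s) * (norm s / \<epsilon>)"
        proof -
          have "0 \<le> L * norm s" using L[of x s] norm_ge_zero order_trans by blast
          moreover have "1 \<le> norm s / \<epsilon>" using False e by simp
          ultimately show ?thesis using mult_left_mono[of 1 "norm s / \<epsilon>" "L * norm s"] by simp
        qed
        finally show ?thesis using False by (simp add: indicator_def power2_eq_square)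
      qed
    qed
    have "(LINT s:ball 0 \<delta> - ball 0 \<epsilon>|lborel. LB_integrand \<rho> \<delta> v x s) = (\<integral>s. ?J s \<partial>lborel)"
      unfolding set_lebesgue_integral_def
      by (intro Bochner_Integration.integral_cong refl) (auto simp: indicator_def wt_def LB_integrand_def)
    also have "\<dots> = (1 / 2) *\<^sub>R ((\<integral>s. ?J s \<partial>lborel) + (\<integral>s. ?J (- s) \<partial>lborel))"
    proof -
      have "(\<integral>s. ?J s \<partial>lborel) = (\<integral>s. ?J (- s) \<partial>lborel)"
        by (rule lborel_integral_uminus(2)) measurable
      then show ?thesis by (simp add: scaleR_2[symmetric])
    qed
    also have "(\<integral>s. ?J s \<partial>lborel) + (\<integral>s. ?J (- s) \<partial>lborel) = (\<integral>s. ?J s + ?J (- s) \<partial>lborel)"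
    proof (rule Bochner_Integration.integral_add[symmetric])
      show "integrable lborel (\<lambda>s. ?J (- s))"
        using Ji by (subst lborel_integral_uminus(1)) measurable
    qed (rule Ji)
    also have "(1 / 2) *\<^sub>R \<dots> = (\<integral>s. (1 / 2) *\<^sub>R (?J s + ?J (- s)) \<partial>lborel)" by simp
    also have "\<dots> = (\<integral>s. indicat_real (- ball 0 \<epsilon>) s *\<^sub>R (w s *\<^sub>R LB_sym v x s) \<partial>lborel)"
    proof (intro Bochner_Integration.integral_cong refl)
      fix s
      have F: "?F (- s) = ((s \<bullet> (v (x - s) - v x)) / (norm s)\<^sup>2) *\<^sub>R s" by simp
      have "s \<bullet> (v (x + s) + v (x - s) - 2 *\<^sub>R v x) = s \<bullet> (v (x + s) - v x) + s \<bullet> (v (x - s) - v x)"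
        by (simp add: inner_diff_right inner_add_right)
      then have "LB_sym v x s = (1 / 2) *\<^sub>R (?F s + ?F (- s))"
        unfolding F scaleR_left_distrib[symmetric] LB_sym_def by (simp add: add_divide_distrib[symmetric])
      then show "(1 / 2) *\<^sub>R (?J s + ?J (- s)) = indicat_real (- ball 0 \<epsilon>) s *\<^sub>R (w s *\<^sub>R LB_sym v x s)"
        by (simp add: wt_uminus indicator_def scaleR_add_right)
    qed
    finally show ?thesis .
  qed
  have "((\<lambda>\<epsilon>. LINT s:ball 0 \<delta> - ball 0 \<epsilon>|lborel. LB_integrand \<rho> \<delta> v x s) \<longlongrightarrow> (\<integral>s. w s *\<^sub>R LB_sym v x s \<partial>lborel)) (at_right 0)"
    unfolding tendsto_at_iff_sequentially comp_def
  proof (intro allI impI)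
    fix X :: "nat \<Rightarrow> real"
    assume X: "\<forall>i. X i \<in> {0<..} - {0}" "X \<longlonglongrightarrow> 0"
    have "(\<lambda>n. \<integral>s. indicat_real (- ball 0 (X n)) s *\<^sub>R (w s *\<^sub>R LB_sym v x s) \<partial>lborel) \<longlonglongrightarrow> (\<integral>s. w s *\<^sub>R LB_sym v x s \<partial>lborel)"
    proof (rule integral_dominated_convergence[where w = "\<lambda>s. norm (w s *\<^sub>R LB_sym v x s)"])
      show "integrable lborel (\<lambda>s. norm (w s *\<^sub>R LB_sym v x s))" using i by (rule integrable_norm)
      show "AE s in lborel. norm (indicat_real (- ball 0 (X n)) s *\<^sub>R (w s *\<^sub>R LB_sym v x s)) \<le> norm (w s *\<^sub>R LB_sym v x s)" for n
        by (auto simp: indicator_def)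
      show "AE s in lborel. (\<lambda>n. indicat_real (- ball 0 (X n)) s *\<^sub>R (w s *\<^sub>R LB_sym v x s)) \<longlonglongrightarrow> w s *\<^sub>R LB_sym v x s"
      proof (intro AE_I2)
        fix s
        show "(\<lambda>n. indicat_real (- ball 0 (X n)) s *\<^sub>R (w s *\<^sub>R LB_sym v x s)) \<longlonglongrightarrow> w s *\<^sub>R LB_sym v x s"
        proof (cases "s = 0")
          case False
          then have "\<forall>\<^sub>F n in sequentially. X n < norm s"
            using X(2) by (intro order_tendstoD(2)) auto
          then have "\<forall>\<^sub>F n in sequentially.
              indicat_real (- ball 0 (X n)) s *\<^sub>R (w s *\<^sub>R LB_sym v x s) = w s *\<^sub>R LB_sym v x s"
            by eventually_elim (auto simp: indicator_def)
          then show ?thesis by (rule tendsto_eventually)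
        qed (simp add: LB_sym_def)
      qed
    qed measurable
    then show "(\<lambda>n. LINT s:ball 0 \<delta> - ball 0 (X n)|lborel. LB_integrand \<rho> \<delta> v x s) \<longlonglongrightarrow> (\<integral>s. w s *\<^sub>R LB_sym v x s \<partial>lborel)"
      using X(1) by (simp add: cut)
  qed
  then show e: "LB \<rho> \<delta> v x = (\<integral>s. w s *\<^sub>R LB_sym v x s \<partial>lborel)"
    unfolding LB_def by (intro tendsto_Lim) auto
  show "norm (LB \<rho> \<delta> v x) \<le> K * real CARD('d)" unfolding e by (rule bd)
qed

text \<open>\<open>K\<close> and \<open>M\<close> only make both principal values exist; the
  estimate rests on the bound \<open>E\<close> for the difference, which is the small one in the
  consistency argument.\<close>

lemma LB_diff:
  fixes u v :: "real^'d \<Rightarrow> real^'d"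
  assumes "lip u" "\<And>s. norm (u (x + s) + u (x - s) - 2 *\<^sub>R u x) \<le> K * (norm s)\<^sup>2"
    and "lip v" "\<And>s. norm (v (x + s) + v (x - s) - 2 *\<^sub>R v x) \<le> M * (norm s)\<^sup>2"
    and "\<And>s. norm ((u (x + s) - v (x + s)) + (u (x - s) - v (x - s)) - 2 *\<^sub>R (u x - v x)) \<le> E * (norm s)\<^sup>2"
  shows "LB \<rho> \<delta> (\<lambda>y. u y - v y) x = LB \<rho> \<delta> u x - LB \<rho> \<delta> v x"
    and "norm (LB \<rho> \<delta> u x - LB \<rho> \<delta> v x) \<le> E * real CARD('d)"
proof -
  have l: "lip (\<lambda>y. u y - v y)"
  proof -
    obtain L1 where 1: "\<And>x s. norm (u (x + s) - u x) \<le> L1 * norm s" using assms(1) unfolding lip_def by blast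
    obtain L2 where 2: "\<And>x s. norm (v (x + s) - v x) \<le> L2 * norm s" using assms(3) unfolding lip_def by blast
    have "norm ((u (x + s) - v (x + s)) - (u x - v x)) \<le> (L1 + L2) * norm s" for x s
      using norm_triangle_ineq4[of "u (x + s) - u x" "v (x + s) - v x"] 1[of x s] 2[of x s]
      by (simp add: algebra_simps)
    then show ?thesis unfolding lip_def by blast
  qed
  note a = LB_eq_sym[OF assms(1,2)] and b = LB_eq_sym[OF assms(3,4)]
    and c = LB_eq_sym[OF l, of x E]
  have "LB_sym (\<lambda>y. u y - v y) x s = LB_sym u x s - LB_sym v x s" for s
    unfolding LB_sym_def scaleR_left_diff_distrib[symmetric] diff_divide_distrib[symmetric] inner_diff_right[symmetric]
    by (simp add: algebra_simps)
  then show e: "LB \<rho> \<delta> (\<lambda>y. u y - v y) x = LB \<rho> \<delta> u x - LB \<rho> \<delta> v x"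
    using assms(5) by (simp add: a(2) b(2) c(2) scaleR_right_diff_distrib Bochner_Integration.integral_diff[OF a(1) b(1)])
  show "norm (LB \<rho> \<delta> u x - LB \<rho> \<delta> v x) \<le> E * real CARD('d)"
    unfolding e[symmetric] by (rule c(3)) (use assms(5) in simp)
qed

end

section \<open>Consistency\<close>

lemma inner_bound: "norm b \<le> K * norm s \<Longrightarrow> norm (s \<bullet> b) \<le> K * (norm s)\<^sup>2"
  using Cauchy_Schwarz_ineq2[of s b] mult_left_mono[of "norm b" "K * norm s" "norm s"]
  by (simp add: power2_eq_square mult_ac)

locale scheme = mesh h c H + kernel "TYPE('d)" \<rho> \<delta>
  for h :: "real^'d" and c H :: real and \<rho> \<delta>
begin

lemma lip_add: "lip u \<Longrightarrow> lip v \<Longrightarrow> lip (\<lambda>y. u y + v y)"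
proof -
  assume "lip u" "lip v"
  then obtain K L where K: "\<And>x s. norm (u (x + s) - u x) \<le> K * norm s"
    and L: "\<And>x s. norm (v (x + s) - v x) \<le> L * norm s"
    unfolding lip_def by blast
  have "norm ((u (x + s) + v (x + s)) - (u x + v x)) \<le> (K + L) * norm s" for x s
  proof -
    have "(u (x + s) + v (x + s)) - (u x + v x) = (u (x + s) - u x) + (v (x + s) - v x)" by simp
    then show ?thesis
      using norm_triangle_ineq[of "u (x + s) - u x" "v (x + s) - v x"] K[of x s] L[of x s]
      by (simp only: distrib_right)
  qed
  then show ?thesis unfolding lip_def by blast
qed

lemma lip_minus: "lip u \<Longrightarrow> lip (\<lambda>y. - u y)"
  unfolding lip_def by (simp add: norm_minus_commute)

lemma lip_diff: "lip u \<Longrightarrow> lip v \<Longrightarrow> lip (\<lambda>y. u y - v y)"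
  using lip_add[OF _ lip_minus, of u v] by simp

lemma lip_shift: "lip u \<Longrightarrow> lip (\<lambda>y. u (y + z))"
proof -
  assume "lip u"
  then obtain K where K: "\<And>x s. norm (u (x + s) - u x) \<le> K * norm s" unfolding lip_def by blast
  have "norm (u (x + s + z) - u (x + z)) \<le> K * norm s" for x s
    using K[of "x + z" s] by (simp add: add_ac)
  then show ?thesis unfolding lip_def by blast
qed

lemma D_op_shift: "D_op \<rho> \<delta> u (x + z) = D_op \<rho> \<delta> (\<lambda>y. u (y + z)) x"
  unfolding D_op_def by (simp add: add_ac)

lemma D_op_increment:
  assumes "lip u" "\<And>s. norm ((u (x + s + z) - u (x + s)) - (u (x + z) - u x)) \<le> K * norm s"
  shows "\<bar>D_op \<rho> \<delta> u (x + z) - D_op \<rho> \<delta> u x\<bar> \<le> K * real CARD('d)"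
  unfolding D_op_shift D_op_diff[OF lip_shift[OF assms(1)] assms(1), symmetric]
  by (rule D_op_integrand(2)[OF lip_diff[OF lip_shift[OF assms(1)] assms(1)] assms(2)])

text \<open>Grid points are distinct, so coefficients can be read as nodal values of a function;
  facts about \<Pi> then apply to trial functions.\<close>

lemma i_h_as_Pi_h:
  obtains f where "\<And>k. f (grid_pt h k) = cc k" "i_h h cc = Pi_h h f"
proof -
  have inj: "inj (grid_pt h)"
  proof (rule injI)
    fix k m assume e: "grid_pt h k = grid_pt h m"
    have "k $ j = m $ j" for j
      using arg_cong[OF e, of "\<lambda>x. x $ j"] h_pos[of j] by (simp add: grid_pt_def)
    then show "k = m" by (simp add: vec_eq_iff)
  qed
  define f where "f = cc \<circ> inv (grid_pt h)"
  have f: "f (grid_pt h k) = cc k" for k by (simp add: f_def inj)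
  then have "r_h h f = cc" by (simp add: r_h_def fun_eq_iff)
  then have "i_h h cc = Pi_h h f" by (simp add: Pi_h_def)
  with f that show thesis by blast
qed

text \<open>The constants deteriorate as H tends to 0. They serve only qualitatively, to make the
  operators well defined and linear on such functions.\<close>

lemma Pi_h_bounded_regular:
  fixes f :: "real^'d \<Rightarrow> real^'d"
  assumes B: "\<And>k. norm (f (grid_pt h k)) \<le> B"
  shows "lip (Pi_h h f)"
    and "\<exists>K. \<forall>x s. norm (Pi_h h f (x + s) + Pi_h h f (x - s) - 2 *\<^sub>R Pi_h h f x) \<le> K * (norm s)\<^sup>2"
proof -
  let ?d = "real CARD('d)"
  have b: "\<bar>f (grid_pt h k) $ a\<bar> \<le> B" for k a using B[of k] component_le_norm_cart[of "f (grid_pt h k)" a] by linarith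
  have "norm (Pi_h h f (x + s) - Pi_h h f x) \<le> ?d * (2 * 4 ^ CARD('d) * (?d * norm s / (c * H)) * B)" for x s
  proof (rule norm_le_card)
    fix a
    show "\<bar>(Pi_h h f (x + s) - Pi_h h f x) $ a\<bar> \<le> 2 * 4 ^ CARD('d) * (?d * norm s / (c * H)) * B"
      using Pi_first_diff[of x s "\<lambda>y. f y $ a" B] b by (simp add: Pi_h_component[OF h_pos])
  qed
  then have "norm (Pi_h h f (x + s) - Pi_h h f x) \<le> (?d * (2 * 4 ^ CARD('d) * (?d / (c * H)) * B)) * norm s" for x s
    by (simp add: mult_ac)
  then show "lip (Pi_h h f)" unfolding lip_def by blast
  have "norm (Pi_h h f (x + s) + Pi_h h f (x - s) - 2 *\<^sub>R Pi_h h f x) \<le>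
      ?d * (3 * 4 ^ CARD('d) * (4 * (?d * norm s / (c * H))\<^sup>2) * B)" for x s
  proof (rule norm_le_card)
    fix a
    show "\<bar>(Pi_h h f (x + s) + Pi_h h f (x - s) - 2 *\<^sub>R Pi_h h f x) $ a\<bar> \<le> 3 * 4 ^ CARD('d) * (4 * (?d * norm s / (c * H))\<^sup>2) * B"
      using Pi_second_diff[of x s "\<lambda>y. f y $ a" B] b by (simp add: Pi_h_component[OF h_pos])
  qed
  then have "norm (Pi_h h f (x + s) + Pi_h h f (x - s) - 2 *\<^sub>R Pi_h h f x) \<le>
      (?d * (3 * 4 ^ CARD('d) * (4 * (?d / (c * H))\<^sup>2) * B)) * (norm s)\<^sup>2" for x s
    by (simp add: power_mult_distrib power_divide mult_ac)
  then show "\<exists>K. \<forall>x s. norm (Pi_h h f (x + s) + Pi_h h f (x - s) - 2 *\<^sub>R Pi_h h f x) \<le> K * (norm s)\<^sup>2"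
    by blast
qed

lemma lip_Pi_bounded:
  fixes g :: "real^'d \<Rightarrow> real"
  assumes B: "\<And>k. \<bar>g (grid_pt h k)\<bar> \<le> B"
  shows "lip (Pi_h h g)"
proof -
  let ?d = "real CARD('d)"
  have "norm (Pi_h h g (x + s) - Pi_h h g x) \<le> (2 * 4 ^ CARD('d) * (?d / (c * H)) * B) * norm s" for x s
    using Pi_first_diff[of x s g B] B by (simp add: mult_ac)
  then show ?thesis unfolding lip_def by blast
qed

section \<open>The operators on a smooth displacement\<close>

context
  fixes u :: "real^'d \<Rightarrow> real^'d" and M1 M2 :: real
  assumes u1: "\<And>a. bounded_partials 1 M1 (\<lambda>x. u x $ a)" and u2: "\<And>a. bounded_partials 2 M2 (\<lambda>x. u x $ a)"
begin

lemma smooth_lip: "lip u"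
proof -
  let ?d = "real CARD('d)"
  have "norm (u (x + s) - u x) \<le> ?d * (?d * M1 * norm s)" for x s
    by (rule norm_le_card) (use bounded_partials_lipschitz[OF u1] in simp)
  then have "norm (u (x + s) - u x) \<le> (?d * (?d * M1)) * norm s" for x s by (simp add: mult_ac)
  then show ?thesis unfolding lip_def by blast
qed

lemma smooth_mixed_diff:
  "norm ((u (x + s + z) - u (x + s)) - (u (x + z) - u x)) \<le> (real CARD('d) ^ 3 * M2 * norm z) * norm s"
proof -
  let ?d = "real CARD('d)"
  have "norm ((u (x + s + z) - u (x + s)) - (u (x + z) - u x)) \<le> ?d * (?d * (?d * M2 * norm z) * norm s)"
  proof (rule norm_le_card)
    fix a
    have "bounded_partials 1 (?d * M2 * norm z) (\<lambda>x. u (x + z) $ a - u x $ a)"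
      using bounded_partials_diff[of 1 M2 "\<lambda>x. u x $ a" z] u2 by (simp add: numeral_2_eq_2)
    from bounded_partials_lipschitz[OF this, of x s]
    show "\<bar>((u (x + s + z) - u (x + s)) - (u (x + z) - u x)) $ a\<bar> \<le> ?d * (?d * M2 * norm z) * norm s" by simp
  qed
  then show ?thesis by (simp add: power3_eq_cube mult_ac)
qed

text \<open>A centred second difference is the mixed increment at x - s with both steps equal to
  \<open>s\<close>.\<close>

lemma smooth_second_diff: "norm (u (x + s) + u (x - s) - 2 *\<^sub>R u x) \<le> (real CARD('d) ^ 3 * M2) * (norm s)\<^sup>2"
  using smooth_mixed_diff[of "x - s" s s] by (simp add: scaleR_2 algebra_simps power2_eq_square)

lemma D_op_smooth_lip: "\<bar>D_op \<rho> \<delta> u (x + z) - D_op \<rho> \<delta> u x\<bar> \<le> (real CARD('d) ^ 4 * M2) * norm z"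
proof -
  have "\<bar>D_op \<rho> \<delta> u (x + z) - D_op \<rho> \<delta> u x\<bar> \<le> (real CARD('d) ^ 3 * M2 * norm z) * real CARD('d)"
    by (rule D_op_increment[OF smooth_lip smooth_mixed_diff])
  then show ?thesis by (simp add: eval_nat_numeral mult_ac)
qed

lemma lip_D_op_smooth: "lip (D_op \<rho> \<delta> u)"
  unfolding lip_def real_norm_def using D_op_smooth_lip by blast

text \<open>Bounds the right-hand side of the scheme; with stability this settles meshes with H >
  1.\<close>

lemma LS_smooth_bound:
  "norm (LS lam mu \<rho> \<delta> u x) \<le>
    (\<bar>C_alpha CARD('d) * mu / real CARD('d)\<bar> * real CARD('d) ^ 4
     + \<bar>C_beta CARD('d) * (lam - mu) / real CARD('d)\<bar> * real CARD('d) ^ 5) * M2"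
proof -
  let ?d = "real CARD('d)"
  let ?A = "C_alpha CARD('d) * mu / real CARD('d)" and ?B = "C_beta CARD('d) * (lam - mu) / real CARD('d)"
  have 1: "norm (LB \<rho> \<delta> u x) \<le> (?d ^ 3 * M2) * ?d" by (rule LB_eq_sym(3)[OF smooth_lip smooth_second_diff])
  have 2: "norm (G_op \<rho> \<delta> (D_op \<rho> \<delta> u) x) \<le> (?d ^ 4 * M2) * ?d"
    by (rule G_op_integrand(2)[OF lip_D_op_smooth D_op_smooth_lip])
  have "norm (LS lam mu \<rho> \<delta> u x) \<le> \<bar>?A\<bar> * norm (LB \<rho> \<delta> u x) + \<bar>?B\<bar> * norm (G_op \<rho> \<delta> (D_op \<rho> \<delta> u) x)"
    unfolding LS_def by (rule norm_triangle_le) simp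
  also have "\<dots> \<le> \<bar>?A\<bar> * ((?d ^ 3 * M2) * ?d) + \<bar>?B\<bar> * ((?d ^ 4 * M2) * ?d)"
    by (intro add_mono mult_left_mono 1 2) auto
  also have "a * ((?d ^ 3 * M2) * ?d) + b * ((?d ^ 4 * M2) * ?d) = (a * ?d ^ 4 + b * ?d ^ 5) * M2" for a b
    by (simp add: algebra_simps eval_nat_numeral)
  finally show ?thesis .
qed

section \<open>Consistency for a displacement with bounded fourth derivatives\<close>

context
  fixes M0 M :: real
  assumes u0: "\<And>x. norm (u x) \<le> M0" and u4: "\<And>a. bounded_partials 4 M (\<lambda>x. u x $ a)"
begin

lemma increment_bounded_partials: "bounded_partials 3 (real CARD('d) * M * norm z) (\<lambda>x. u (x + z) $ a - u x $ a)"
  using bounded_partials_diff[of 3 M "\<lambda>x. u x $ a" z] u4 by (simp add: eval_nat_numeral)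

lemma M_nonneg: "0 \<le> M" using bounded_partials_nonneg[OF u4[of undefined]] .

lemma lip_interpolant: "lip (Pi_h h u)" by (rule Pi_h_bounded_regular) (rule u0)

lemma LB_consistency:
  assumes x: "x = grid_pt h k"
  shows "norm (LB \<rho> \<delta> (Pi_h h u) x - LB \<rho> \<delta> u x) \<le> real CARD('d) ^ 2 * second_diff_const * H\<^sup>2 * M"
proof -
  let ?d = "real CARD('d)"
  obtain K where K: "\<And>x s. norm (Pi_h h u (x + s) + Pi_h h u (x - s) - 2 *\<^sub>R Pi_h h u x) \<le> K * (norm s)\<^sup>2"
    using Pi_h_bounded_regular(2)[of u M0] u0 by blast
  have "norm (LB \<rho> \<delta> (Pi_h h u) x - LB \<rho> \<delta> u x) \<le> (?d * (second_diff_const * H\<^sup>2 * M)) * ?d"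
  proof (rule LB_diff(2)[OF lip_interpolant K smooth_lip smooth_second_diff])
    fix s
    have "norm ((Pi_h h u (x + s) - u (x + s)) + (Pi_h h u (x - s) - u (x - s)) - 2 *\<^sub>R (Pi_h h u x - u x)) \<le>
        ?d * (second_diff_const * H\<^sup>2 * (norm s)\<^sup>2 * M)"
    proof (rule norm_le_card)
      fix a
      show "\<bar>((Pi_h h u (x + s) - u (x + s)) + (Pi_h h u (x - s) - u (x - s)) - 2 *\<^sub>R (Pi_h h u x - u x)) $ a\<bar> \<le> second_diff_const * H\<^sup>2 * (norm s)\<^sup>2 * M"
        using interp_error_second_diff[OF u4[of a] x, of s] by (simp add: interp_error_def Pi_h_component[OF h_pos])
    qed
    then show "norm ((Pi_h h u (x + s) - u (x + s)) + (Pi_h h u (x - s) - u (x - s)) - 2 *\<^sub>R (Pi_h h u x - u x)) \<le>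
        ?d * (second_diff_const * H\<^sup>2 * M) * (norm s)\<^sup>2" by (simp add: mult_ac)
  qed
  then show ?thesis by (simp add: power2_eq_square mult_ac)
qed

text \<open>Common Lipschitz constant, of order H^2, of D (\<Pi> u - u) between grid points and of
  \<Pi> D u - D u.\<close>

definition increment_const :: real where "increment_const = real CARD('d) ^ 3 * lip_const * H\<^sup>2 * M"

lemma increment_const_nonneg: "0 \<le> increment_const" using lip_const_nonneg M_nonneg by (simp add: increment_const_def)

text \<open>The shift \<open>z\<close> must be a grid vector to pass from the error to the increment
  of \<open>u\<close>. That increment has third derivatives of order |z|, and the Lipschitz estimate
  in \<open>s\<close> supplies the second factor.\<close>

lemma D_op_error_grid_lipschitz:
  "\<bar>D_op \<rho> \<delta> (\<lambda>y. Pi_h h u y - u y) (grid_pt h k + grid_pt h m) - D_op \<rho> \<delta> (\<lambda>y. Pi_h h u y - u y) (grid_pt h k)\<bar>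
    \<le> increment_const * norm (grid_pt h m)"
proof -
  let ?d = "real CARD('d)" and ?E = "\<lambda>y. Pi_h h u y - u y" and ?z = "grid_pt h m"
  have "\<bar>D_op \<rho> \<delta> ?E (grid_pt h k + ?z) - D_op \<rho> \<delta> ?E (grid_pt h k)\<bar> \<le> (?d * (lip_const * H\<^sup>2 * (?d * M * norm ?z))) * ?d"
  proof (rule D_op_increment)
    show "lip ?E" by (intro lip_diff lip_interpolant smooth_lip)
    fix s
    let ?x = "grid_pt h k"
    have "norm ((?E (?x + s + ?z) - ?E (?x + s)) - (?E (?x + ?z) - ?E ?x)) \<le> ?d * (lip_const * H\<^sup>2 * norm s * (?d * M * norm ?z))"
    proof (rule norm_le_card)
      fix a
      have e: "?E y $ a = interp_error (\<lambda>x. u x $ a) y" for y by (simp add: interp_error_def Pi_h_component[OF h_pos])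
      show "\<bar>((?E (?x + s + ?z) - ?E (?x + s)) - (?E (?x + ?z) - ?E ?x)) $ a\<bar> \<le> lip_const * H\<^sup>2 * norm s * (?d * M * norm ?z)"
        unfolding vector_minus_component e[unfolded vector_minus_component] interp_error_shift
        by (rule interp_error_lipschitz[OF increment_bounded_partials])
    qed
    then show "norm ((?E (?x + s + ?z) - ?E (?x + s)) - (?E (?x + ?z) - ?E ?x)) \<le> ?d * (lip_const * H\<^sup>2 * (?d * M * norm ?z)) * norm s"
      by (simp add: mult_ac)
  qed
  then show ?thesis by (simp add: increment_const_def power3_eq_cube mult_ac)
qed

text \<open>\<Pi> acts on \<open>x\<close> and the integral on \<open>s\<close>, so they commute:
  the error for D u is an average of the errors for the increments of \<open>u\<close>. Thus
  regularity of \<open>u\<close> is used directly, not derivatives of D u.\<close>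

lemma interp_error_D_op: "interp_error (D_op \<rho> \<delta> u) x =
    (\<integral>s. w s *\<^sub>R (s \<bullet> (Pi_h h (\<lambda>y. u (y + s) - u y) x - (u (x + s) - u x))) \<partial>lborel)"
proof -
  let ?I = "\<lambda>y s. w s *\<^sub>R (s \<bullet> (u (y + s) - u y))"
  note i = D_op_integrable[OF smooth_lip]
  have "interp_error (D_op \<rho> \<delta> u) x = (\<Sum>k\<in>nodes h x. Psi h k x *\<^sub>R (\<integral>s. ?I (grid_pt h k) s \<partial>lborel)) - (\<integral>s. ?I x s \<partial>lborel)"
    unfolding interp_error_def Pi_h_nodes[OF h_pos] D_op_wt ..
  also have "\<dots> = (\<integral>s. (\<Sum>k\<in>nodes h x. Psi h k x *\<^sub>R ?I (grid_pt h k) s) - ?I x s \<partial>lborel)"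
  proof (subst Bochner_Integration.integral_diff)
    show "integrable lborel (\<lambda>s. \<Sum>k\<in>nodes h x. Psi h k x *\<^sub>R ?I (grid_pt h k) s)"
      by (intro Bochner_Integration.integrable_sum integrable_scaleR_right i)
    show "integrable lborel (?I x)" by (rule i)
    have "(\<integral>s. (\<Sum>k\<in>nodes h x. Psi h k x *\<^sub>R ?I (grid_pt h k) s) \<partial>lborel) =
        (\<Sum>k\<in>nodes h x. \<integral>s. Psi h k x *\<^sub>R ?I (grid_pt h k) s \<partial>lborel)"
      by (intro Bochner_Integration.integral_sum integrable_scaleR_right i)
    then show "(\<Sum>k\<in>nodes h x. Psi h k x *\<^sub>R (\<integral>s. ?I (grid_pt h k) s \<partial>lborel)) - (\<integral>s. ?I x s \<partial>lborel) =
        (\<integral>s. (\<Sum>k\<in>nodes h x. Psi h k x *\<^sub>R ?I (grid_pt h k) s) \<partial>lborel) - (\<integral>s. ?I x s \<partial>lborel)"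
      by (simp only: integral_scaleR_right)
  qed
  also have "\<dots> = (\<integral>s. w s *\<^sub>R (s \<bullet> (Pi_h h (\<lambda>y. u (y + s) - u y) x - (u (x + s) - u x))) \<partial>lborel)"
    by (intro Bochner_Integration.integral_cong refl)
      (simp add: Pi_h_nodes[OF h_pos] inner_diff_right[of _ "sum _ _"] inner_sum_right sum_distrib_left right_diff_distrib mult_ac)
  finally show ?thesis .
qed

lemma interp_error_D_op_lipschitz: "\<bar>interp_error (D_op \<rho> \<delta> u) (x + t) - interp_error (D_op \<rho> \<delta> u) x\<bar> \<le> increment_const * norm t"
proof -
  let ?d = "real CARD('d)"
  let ?V = "\<lambda>x s. Pi_h h (\<lambda>y. u (y + s) - u y) x - (u (x + s) - u x)"
  let ?b = "?d * (lip_const * H\<^sup>2 * norm t * (?d * M))"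
  note [measurable] = lip_measurable_shift[OF smooth_lip]
  have Vm [measurable]: "?V x \<in> borel_measurable borel" for x
    unfolding Pi_h_nodes[OF h_pos] by measurable
  have Vd: "norm (?V (x + t) s - ?V x s) \<le> ?b * norm s" for s
  proof -
    have "norm (?V (x + t) s - ?V x s) \<le> ?d * (lip_const * H\<^sup>2 * norm t * (?d * M * norm s))"
    proof (rule norm_le_card)
      fix a
      have e: "?V y s $ a = interp_error (\<lambda>y. u (y + s) $ a - u y $ a) y" for y by (simp add: interp_error_def Pi_h_component[OF h_pos])
      show "\<bar>(?V (x + t) s - ?V x s) $ a\<bar> \<le> lip_const * H\<^sup>2 * norm t * (?d * M * norm s)"
        unfolding vector_minus_component[of "?V (x + t) s"] e by (rule interp_error_lipschitz[OF increment_bounded_partials])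
    qed
    then show ?thesis by (simp add: mult_ac)
  qed
  obtain L where L: "\<And>x s. norm (u (x + s) - u x) \<le> L * norm s" using smooth_lip unfolding lip_def by blast
  have i: "integrable lborel (\<lambda>s. w s *\<^sub>R (s \<bullet> ?V y s))" for y
  proof (rule integrable_wt(1))
    fix s
    have "norm (Pi_h h (\<lambda>y. u (y + s) - u y) y) \<le> L * norm s"
      unfolding Pi_h_def by (rule i_h_bound[OF h_pos]) (simp add: r_h_def L)
    then have "norm (?V y s) \<le> 2 * L * norm s"
      using norm_triangle_ineq4[of "Pi_h h (\<lambda>y. u (y + s) - u y) y" "u (y + s) - u y"] L[of y s] by linarith
    then show "norm (s \<bullet> ?V y s) \<le> (2 * L) * (norm s)\<^sup>2"
      using Cauchy_Schwarz_ineq2[of s "?V y s"] mult_left_mono[of "norm (?V y s)" "2 * L * norm s" "norm s"]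
      by (simp add: power2_eq_square mult_ac)
  qed measurable
  have "interp_error (D_op \<rho> \<delta> u) (x + t) - interp_error (D_op \<rho> \<delta> u) x = (\<integral>s. w s *\<^sub>R (s \<bullet> (?V (x + t) s - ?V x s)) \<partial>lborel)"
    unfolding interp_error_D_op Bochner_Integration.integral_diff[OF i i, symmetric]
    by (intro Bochner_Integration.integral_cong refl) (simp only: inner_diff_right[of _ "?V (x + t) _"] scaleR_right_diff_distrib)
  moreover have "norm (\<integral>s. w s *\<^sub>R (s \<bullet> (?V (x + t) s - ?V x s)) \<partial>lborel) \<le> ?b * ?d"
  proof (rule integrable_wt(2))
    fix s
    show "norm (s \<bullet> (?V (x + t) s - ?V x s)) \<le> ?b * (norm s)\<^sup>2"
      by (rule inner_bound) (rule Vd)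
  qed measurable
  ultimately show ?thesis by (simp add: increment_const_def power3_eq_cube mult_ac)
qed

text \<open>\<Pi> D \<Pi> u - D u = \<Pi> D (\<Pi> u - u) + (\<Pi> D u - D u). Both parts have
  Lipschitz constants of order H^2, and G is bounded by a Lipschitz constant of its
  argument.\<close>

lemma G_op_consistency:
  "norm (G_op \<rho> \<delta> (Pi_h h (D_op \<rho> \<delta> (Pi_h h u))) x - G_op \<rho> \<delta> (D_op \<rho> \<delta> u) x) \<le> (interp_lip_const + 1) * increment_const * real CARD('d)"
proof -
  let ?g = "D_op \<rho> \<delta> (\<lambda>y. Pi_h h u y - u y)"
  let ?\<theta> = "\<lambda>y. Pi_h h (D_op \<rho> \<delta> (Pi_h h u)) y - D_op \<rho> \<delta> u y"
  have g: "?g y = D_op \<rho> \<delta> (Pi_h h u) y - D_op \<rho> \<delta> u y" for y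
    by (rule D_op_diff[OF lip_interpolant smooth_lip])
  have e: "?\<theta> y = Pi_h h ?g y + interp_error (D_op \<rho> \<delta> u) y" for y
    unfolding interp_error_def g Pi_h_diff[OF h_pos] by simp
  have l: "\<bar>?\<theta> (y + s) - ?\<theta> y\<bar> \<le> ((interp_lip_const + 1) * increment_const) * norm s" for y s
  proof -
    have "\<bar>Pi_h h ?g (y + s) - Pi_h h ?g y\<bar> \<le> interp_lip_const * norm s * increment_const"
      by (rule Pi_lipschitz_of_grid[OF D_op_error_grid_lipschitz increment_const_nonneg])
    with interp_error_D_op_lipschitz[of y s] show ?thesis unfolding e by (simp add: algebra_simps)
  qed
  then have lt: "lip ?\<theta>" unfolding lip_def real_norm_def by blast
  have "lip (Pi_h h (D_op \<rho> \<delta> (Pi_h h u)))" using lip_add[OF lt lip_D_op_smooth] by simp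
  from G_op_diff[OF this lip_D_op_smooth, of x] G_op_integrand(2)[OF lt l, of x] show ?thesis by simp
qed

lemma LS_consistency:
  assumes x: "x = grid_pt h k"
  shows "norm (LSh lam mu \<rho> h \<delta> (Pi_h h u) x - LS lam mu \<rho> \<delta> u x) \<le>
    (\<bar>C_alpha CARD('d) * mu / real CARD('d)\<bar> * real CARD('d) ^ 2 * second_diff_const
     + \<bar>C_beta CARD('d) * (lam - mu) / real CARD('d)\<bar> * (interp_lip_const + 1) * real CARD('d) ^ 4 * lip_const) * M * H\<^sup>2"
proof -
  let ?d = "real CARD('d)"
  let ?A = "C_alpha CARD('d) * mu / real CARD('d)" and ?B = "C_beta CARD('d) * (lam - mu) / real CARD('d)"
  let ?L = "LB \<rho> \<delta> (Pi_h h u) x - LB \<rho> \<delta> u x"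
  let ?G = "G_op \<rho> \<delta> (Pi_h h (D_op \<rho> \<delta> (Pi_h h u))) x - G_op \<rho> \<delta> (D_op \<rho> \<delta> u) x"
  have "LSh lam mu \<rho> h \<delta> (Pi_h h u) x - LS lam mu \<rho> \<delta> u x = ?A *\<^sub>R ?L + ?B *\<^sub>R ?G"
    unfolding LSh_def LS_def scaleR_right_diff_distrib by (simp only: add_diff_add)
  then have "norm (LSh lam mu \<rho> h \<delta> (Pi_h h u) x - LS lam mu \<rho> \<delta> u x) \<le> \<bar>?A\<bar> * norm ?L + \<bar>?B\<bar> * norm ?G"
    by (simp only:) (rule norm_triangle_le, simp only: norm_scaleR)
  also have "\<dots> \<le> \<bar>?A\<bar> * (?d ^ 2 * second_diff_const * H\<^sup>2 * M) + \<bar>?B\<bar> * ((interp_lip_const + 1) * increment_const * ?d)"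
    by (intro add_mono mult_left_mono LB_consistency[OF x] G_op_consistency) auto
  also have "a * (?d ^ 2 * second_diff_const * H\<^sup>2 * M) + b * ((interp_lip_const + 1) * increment_const * ?d) = (a * ?d ^ 2 * second_diff_const + b * (interp_lip_const + 1) * ?d ^ 4 * lip_const) * M * H\<^sup>2" for a b
    by (simp add: increment_const_def algebra_simps eval_nat_numeral)
  finally show ?thesis .
qed

end

end

end

section \<open>Stability\<close>

lemma inner_sum_scaleR: "(c::real^'d) \<bullet> (\<Sum>m\<in>E. a m *\<^sub>R b m) = (\<Sum>m\<in>E. a m * (c \<bullet> b m))"
  by (simp add: inner_sum_right)

section \<open>Counting grid points and the size of trial functions\<close>

context mesh
begin

lemma grid_ball_box:
  "{m. norm (grid_pt h m) \<le> R} \<subseteq> (\<lambda>g. \<chi> j. g j) ` (\<Pi>\<^sub>E j\<in>UNIV. {\<lceil>- (R / h $ j)\<rceil>..\<lfloor>R / h $ j\<rfloor>})"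
proof
  fix m assume "m \<in> {m. norm (grid_pt h m) \<le> R}"
  then have m: "norm (grid_pt h m) \<le> R" by simp
  have "m $ j \<in> {\<lceil>- (R / h $ j)\<rceil>..\<lfloor>R / h $ j\<rfloor>}" for j
  proof -
    have "\<bar>of_int (m $ j) * h $ j\<bar> \<le> R"
      using component_le_norm_cart[of "grid_pt h m" j] m by (simp add: grid_pt_def)
    then have "\<bar>of_int (m $ j)\<bar> \<le> R / h $ j" using h_pos[of j] by (simp add: abs_mult field_simps)
    then show ?thesis by (simp add: ceiling_le_iff le_floor_iff abs_le_iff)
  qed
  then have "(\<lambda>j. m $ j) \<in> (\<Pi>\<^sub>E j\<in>UNIV. {\<lceil>- (R / h $ j)\<rceil>..\<lfloor>R / h $ j\<rfloor>})" by auto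
  then show "m \<in> (\<lambda>g. \<chi> j. g j) ` (\<Pi>\<^sub>E j\<in>UNIV. {\<lceil>- (R / h $ j)\<rceil>..\<lfloor>R / h $ j\<rfloor>})"
    by (rule rev_image_eqI) simp
qed

lemma finite_grid_ball: "finite {m. norm (grid_pt h m) \<le> R}"
  by (rule finite_subset[OF grid_ball_box]) (intro finite_imageI finite_PiE, auto)

lemma card_grid_ball:
  assumes R: "0 \<le> R"
  shows "real (card {m. norm (grid_pt h m) \<le> R}) \<le> (2 * R / (c * H) + 1) ^ CARD('d)"
proof -
  let ?P = "\<Pi>\<^sub>E j\<in>UNIV. {\<lceil>- (R / h $ j)\<rceil>..\<lfloor>R / h $ j\<rfloor>}"
  have "card {m. norm (grid_pt h m) \<le> R} \<le> card ((\<lambda>g. \<chi> j. g j) ` ?P :: (int^'d) set)"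
    by (rule card_mono[OF _ grid_ball_box]) (intro finite_imageI finite_PiE, auto)
  also have "\<dots> = (\<Prod>j\<in>UNIV. card {\<lceil>- (R / h $ j)\<rceil>..\<lfloor>R / h $ j\<rfloor>})"
    by (simp add: card_image[OF inj_vec_lambda_PiE] card_PiE)
  finally have "real (card {m. norm (grid_pt h m) \<le> R}) \<le> real (\<Prod>j\<in>UNIV. card {\<lceil>- (R / h $ j)\<rceil>..\<lfloor>R / h $ j\<rfloor>})"
    by (rule of_nat_mono)
  also have "\<dots> = (\<Prod>j\<in>UNIV. real (card {\<lceil>- (R / h $ j)\<rceil>..\<lfloor>R / h $ j\<rfloor>}))" by simp
  also have "\<dots> \<le> (\<Prod>j\<in>(UNIV::'d set). 2 * R / (c * H) + 1)"
  proof (rule prod_mono, intro conjI)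
    fix j :: 'd
    have Rj: "0 \<le> R / h $ j" "R / h $ j \<le> R / (c * H)"
      using R h_pos[of j] cH_pos h_ge[of j] by (auto intro: frac_le)
    have "real (card {\<lceil>- (R / h $ j)\<rceil>..\<lfloor>R / h $ j\<rfloor>}) \<le> 2 * (R / h $ j) + 1"
      using Rj(1) by (simp add: ceiling_minus) linarith
    with Rj(2) show "real (card {\<lceil>- (R / h $ j)\<rceil>..\<lfloor>R / h $ j\<rfloor>}) \<le> 2 * R / (c * H) + 1" by simp
  qed simp
  finally show ?thesis by simp
qed

lemma Psi_measurable [measurable]: "Psi h k \<in> borel_measurable borel"
proof -
  have "continuous_on UNIV bspline"
    by (rule DERIV_continuous_on[of _ _ bspline']) (rule has_field_derivative_at_within[OF bspline_deriv])
  then have [measurable]: "bspline \<in> borel_measurable borel" by (rule borel_measurable_continuous_onI)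
  show ?thesis unfolding Psi_bspline[OF h_pos, abs_def] by measurable
qed

text \<open>The bound by the volume of the support is for fine meshes, the bound by the measure of
  \<Omega> for coarse ones.\<close>

lemma integral_Psi:
  assumes \<Omega>: "\<Omega> \<in> sets borel" "emeasure lborel \<Omega> < \<infinity>"
  shows "integrable lborel (\<lambda>x. indicat_real \<Omega> x * Psi h k x)"
    and "(\<integral>x. indicat_real \<Omega> x * Psi h k x \<partial>lborel) \<le> measure lborel \<Omega>"
    and "(\<integral>x. indicat_real \<Omega> x * Psi h k x \<partial>lborel) \<le> (4 * H) ^ CARD('d)"
proof -
  have \<Omega>i: "integrable lborel (indicat_real \<Omega>)" using \<Omega> by (intro integrable_real_indicator) auto
  have b: "indicat_real \<Omega> x * Psi h k x \<le> indicat_real \<Omega> x" for x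
    using Psi_le_1[OF h_pos, of k x] by (simp add: indicator_def)
  have [measurable]: "\<Omega> \<in> sets borel" by (rule \<Omega>)
  show i: "integrable lborel (\<lambda>x. indicat_real \<Omega> x * Psi h k x)"
    by (rule Bochner_Integration.integrable_bound[OF \<Omega>i])
      (use b Psi_nonneg[OF h_pos] in \<open>auto intro!: AE_I2 simp: indicator_def\<close>)
  have "(\<integral>x. indicat_real \<Omega> x * Psi h k x \<partial>lborel) \<le> (\<integral>x. indicat_real \<Omega> x \<partial>lborel)"
    by (rule integral_mono[OF i \<Omega>i b])
  then show "(\<integral>x. indicat_real \<Omega> x * Psi h k x \<partial>lborel) \<le> measure lborel \<Omega>" using \<Omega> by simp
  let ?a = "grid_pt h k - (\<chi> j. 2 * H)" and ?b = "grid_pt h k + (\<chi> j. 2 * H)"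
  have "(\<integral>x. indicat_real \<Omega> x * Psi h k x \<partial>lborel) \<le> (\<integral>x. indicat_real (cbox ?a ?b) x \<partial>lborel)"
  proof (rule integral_mono[OF i])
    show "integrable lborel (indicat_real (cbox ?a ?b))"
      by (intro integrable_real_indicator emeasure_lborel_cbox_finite) auto
    fix x
    show "indicat_real \<Omega> x * Psi h k x \<le> indicat_real (cbox ?a ?b) x"
    proof (cases "x \<in> cbox ?a ?b")
      case True then show ?thesis using Psi_le_1[OF h_pos, of k x] by (simp add: indicator_def)
    next
      case False
      have "\<exists>j. \<not> \<bar>grid_pt h k $ j - x $ j\<bar> \<le> 2 * H"
      proof (rule ccontr)
        assume "\<not> ?thesis"
        then have b: "\<bar>grid_pt h k $ j - x $ j\<bar> \<le> 2 * H" for j by blast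
        have "?a $ j \<le> x $ j \<and> x $ j \<le> ?b $ j" for j using b[of j] by (simp add: abs_le_iff)
        with False show False by (simp add: mem_box_cart)
      qed
      then obtain j where "\<not> \<bar>grid_pt h k $ j - x $ j\<bar> \<le> 2 * H" by blast
      then have "\<not> \<bar>grid_pt h k $ j - x $ j\<bar> \<le> 2 * h $ j" using h_le[of j] by linarith
      then have "k \<notin> nodes h x" using nodes_close[OF h_pos] by blast
      then show ?thesis by (simp add: Psi_inactive[OF h_pos])
    qed
  qed
  also have "\<dots> = (4 * H) ^ CARD('d)"
  proof -
    have "measure lborel (cbox ?a ?b) = (\<Prod>j\<in>(UNIV::'d set). ?b $ j - ?a $ j)"
    proof (rule content_cbox_cart)
      have "grid_pt h k \<in> cbox ?a ?b" using H_pos by (simp add: mem_box_cart)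
      then show "cbox ?a ?b \<noteq> {}" by blast
    qed
    then show ?thesis by simp
  qed
  finally show "(\<integral>x. indicat_real \<Omega> x * Psi h k x \<partial>lborel) \<le> (4 * H) ^ CARD('d)" .
qed

text \<open>Jensen's inequality for the convex weights, via Cauchy-Schwarz with square roots of the
  weights.\<close>

lemma i_h_norm_sq:
  assumes F: "finite F" "\<And>k. k \<notin> F \<Longrightarrow> cc k = 0"
  shows "(norm (i_h h cc x))\<^sup>2 \<le> (\<Sum>k\<in>F. Psi h k x * (norm (cc k))\<^sup>2)"
proof -
  let ?N = "nodes h x"
  have "norm (i_h h cc x) \<le> (\<Sum>k\<in>?N. Psi h k x * norm (cc k))"
    unfolding i_h_nodes[OF h_pos] by (rule sum_norm_le) (simp add: Psi_nonneg[OF h_pos])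
  then have "(norm (i_h h cc x))\<^sup>2 \<le> (\<Sum>k\<in>?N. Psi h k x * norm (cc k))\<^sup>2"
    by (intro power_mono) auto
  also have "\<dots> = (\<Sum>k\<in>?N. sqrt (Psi h k x) * (sqrt (Psi h k x) * norm (cc k)))\<^sup>2"
    by (simp add: mult.assoc[symmetric] Psi_nonneg[OF h_pos])
  also have "\<dots> \<le> (\<Sum>k\<in>?N. (sqrt (Psi h k x))\<^sup>2) * (\<Sum>k\<in>?N. (sqrt (Psi h k x) * norm (cc k))\<^sup>2)"
    by (rule Cauchy_Schwarz_ineq_sum)
  also have "\<dots> = (\<Sum>k\<in>?N. Psi h k x * (norm (cc k))\<^sup>2)"
    by (simp add: Psi_nonneg[OF h_pos] sum_Psi[OF h_pos] power_mult_distrib)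
  also have "\<dots> = (\<Sum>k\<in>?N \<union> F. Psi h k x * (norm (cc k))\<^sup>2)"
    using F(1) by (intro sum.mono_neutral_left) (auto simp: Psi_inactive[OF h_pos])
  also have "\<dots> = (\<Sum>k\<in>F. Psi h k x * (norm (cc k))\<^sup>2)"
    using F by (intro sum.mono_neutral_right) auto
  finally show ?thesis .
qed

end

text \<open>In the application \<open>b\<close> is the sum of the norms of the coefficients,
  \<open>S\<close> the sum of their squares, \<open>N\<close> the number of nodes and
  \<open>T\<close> a bound on the residual.\<close>

lemma coercive_bound:
  fixes \<kappa> S b N T :: real
  assumes \<kappa>: "0 < \<kappa>" and S: "0 \<le> S" and le: "\<kappa> * S \<le> b * T" and b: "b\<^sup>2 \<le> S * N" and N: "0 \<le> N"
  shows "S \<le> N * (T / \<kappa>)\<^sup>2"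
proof (cases "S = 0")
  case False
  with S have S0: "0 < S" by linarith
  have "(\<kappa> * S)\<^sup>2 \<le> (b * T)\<^sup>2" using \<kappa> S le by (intro power_mono) auto
  also have "\<dots> \<le> (S * N) * T\<^sup>2" unfolding power_mult_distrib by (intro mult_right_mono b) auto
  finally have "S * (\<kappa>\<^sup>2 * S) \<le> S * (N * T\<^sup>2)" by (simp add: power2_eq_square mult_ac)
  then have "\<kappa>\<^sup>2 * S \<le> N * T\<^sup>2" using S0 by (rule mult_left_le_imp_le)
  then show ?thesis using \<kappa> by (simp add: power_divide pos_le_divide_eq mult.commute)
qed (use N in simp)

context scheme
begin

context
  fixes F :: "(int^'d) set" and cc :: "int^'d \<Rightarrow> real^'d"
  assumes F: "finite F" "\<And>k. k \<notin> F \<Longrightarrow> cc k = 0"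
begin

lemma trial_eq_sum: "i_h h cc y = (\<Sum>m\<in>F. Psi h m y *\<^sub>R cc m)"
  by (rule i_h_eq_sum) (use F in auto)

lemma trial_regular:
  shows "lip (i_h h cc)"
    and "\<exists>K. \<forall>x s. norm (i_h h cc (x + s) + i_h h cc (x - s) - 2 *\<^sub>R i_h h cc x) \<le> K * (norm s)\<^sup>2"
proof -
  obtain f where f: "\<And>k. f (grid_pt h k) = cc k" "i_h h cc = Pi_h h f" by (rule i_h_as_Pi_h[where cc = cc]) blast
  have "norm (f (grid_pt h k)) \<le> (\<Sum>k\<in>F. norm (cc k))" for k
    unfolding f(1) using F member_le_sum[of k F "\<lambda>k. norm (cc k)"] sum_nonneg[of F "\<lambda>k. norm (cc k)"]
    by (cases "k \<in> F") auto
  from Pi_h_bounded_regular[of f, OF this]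
  show "lip (i_h h cc)" "\<exists>K. \<forall>x s. norm (i_h h cc (x + s) + i_h h cc (x - s) - 2 *\<^sub>R i_h h cc x) \<le> K * (norm s)\<^sup>2"
    unfolding f(2) by auto
qed

text \<open>For a fixed direction \<open>s\<close> only the scalar coefficients \<open>s \<bullet> cc k\<close> and shifts along \<open>s\<close> enter,
  so the scalar estimate \<open>gram_coercive\<close> replaces a Korn inequality.\<close>

lemma LB_coercive:
  assumes A: "0 \<le> A" "\<And>k m j. k \<in> F \<Longrightarrow> m \<in> F \<Longrightarrow> \<bar>grid_pt h k $ j - grid_pt h m $ j\<bar> \<le> A"
    and \<delta>: "\<delta> \<le> \<delta>0"
  shows "1 / (real CARD('d) * (A + 2 * H) + \<delta>0)\<^sup>2 / 4 ^ CARD('d) * (\<Sum>k\<in>F. (norm (cc k))\<^sup>2) \<le>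
    - (\<Sum>k\<in>F. cc k \<bullet> LB \<rho> \<delta> (i_h h cc) (grid_pt h k))"
proof -
  let ?v = "i_h h cc" and ?\<kappa> = "1 / (real CARD('d) * (A + 2 * H) + \<delta>0)\<^sup>2 / 4 ^ CARD('d)"
  let ?S = "\<lambda>k s. LB_sym ?v (grid_pt h k) s"
  obtain K where K: "\<And>x s. norm (?v (x + s) + ?v (x - s) - 2 *\<^sub>R ?v x) \<le> K * (norm s)\<^sup>2"
    using trial_regular(2) by blast
  note LB = LB_eq_sym[OF trial_regular(1) K]
  have pw: "(\<Sum>k\<in>F. cc k \<bullet> (w s *\<^sub>R ?S k s)) \<le> (\<Sum>k\<in>F. - ?\<kappa> * (w s * (s \<bullet> cc k)\<^sup>2))" for s
  proof -
    consider "s = 0" | "\<delta> \<le> norm s" | "s \<noteq> 0" "norm s < \<delta>" by linarith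
    then show ?thesis
    proof cases
      case 3
      let ?w = "\<lambda>k. s \<bullet> cc k"
      let ?P = "\<lambda>t. \<Sum>k\<in>F. \<Sum>m\<in>F. ?w k * ?w m * (Psi h m (grid_pt h k) - Psi h m (grid_pt h k + t))"
      let ?W = "\<Sum>k\<in>F. (?w k)\<^sup>2"
      \<comment> \<open>Applied to \<open>s\<close> and to - s, since the symmetrised integrand
        contains both shifts; the factor |s|^2 then cancels the denominator of
        \<open>LB_sym\<close>.\<close>
      have P: "(norm s)\<^sup>2 * ?\<kappa> * ?W \<le> ?P t" if "norm t = norm s" for t
        using gram_coercive[OF h_pos h_le F(1) A, of t \<delta>0 ?w] that 3 \<delta> by simp
      have "(\<Sum>k\<in>F. cc k \<bullet> ?S k s) = (\<Sum>k\<in>F. ?w k * (\<Sum>m\<in>F. ?w m *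
          (Psi h m (grid_pt h k + s) + Psi h m (grid_pt h k - s) - 2 * Psi h m (grid_pt h k)))) / (2 * (norm s)\<^sup>2)"
        unfolding sum_divide_distrib
      proof (rule sum.cong[OF refl])
        fix k
        have "s \<bullet> (?v (grid_pt h k + s) + ?v (grid_pt h k - s) - 2 *\<^sub>R ?v (grid_pt h k)) = (\<Sum>m\<in>F. ?w m *
            (Psi h m (grid_pt h k + s) + Psi h m (grid_pt h k - s) - 2 * Psi h m (grid_pt h k)))"
          unfolding trial_eq_sum inner_diff_right inner_add_right inner_scaleR_right inner_sum_scaleR
          unfolding sum_distrib_left sum.distrib[symmetric] sum_subtractf[symmetric]
          by (intro sum.cong refl) (simp add: algebra_simps)
        then show "cc k \<bullet> ?S k s = ?w k * (\<Sum>m\<in>F. ?w m *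
            (Psi h m (grid_pt h k + s) + Psi h m (grid_pt h k - s) - 2 * Psi h m (grid_pt h k))) / (2 * (norm s)\<^sup>2)"
          by (simp add: LB_sym_def inner_commute)
      qed
      also have "(\<Sum>k\<in>F. ?w k * (\<Sum>m\<in>F. ?w m *
          (Psi h m (grid_pt h k + s) + Psi h m (grid_pt h k - s) - 2 * Psi h m (grid_pt h k)))) = - (?P s + ?P (- s))"
        unfolding sum.distrib[symmetric] sum_negf[symmetric] sum_distrib_left
        by (intro sum.cong refl) (simp add: algebra_simps)
      also have "- (?P s + ?P (- s)) / (2 * (norm s)\<^sup>2) \<le> - (2 * ((norm s)\<^sup>2 * ?\<kappa> * ?W)) / (2 * (norm s)\<^sup>2)"
        using P[of s] P[of "- s"] by (intro divide_right_mono) auto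
      also have "\<dots> = - ?\<kappa> * ?W" using 3 by simp
      finally have "w s * (\<Sum>k\<in>F. cc k \<bullet> ?S k s) \<le> w s * (- ?\<kappa> * ?W)"
        using wt_nonneg[OF 3(1)] by (rule mult_left_mono)
      moreover have "(\<Sum>k\<in>F. - ?\<kappa> * (w s * (?w k)\<^sup>2)) = w s * (- ?\<kappa> * ?W)"
        unfolding sum_distrib_left by (intro sum.cong refl mult.left_commute)
      moreover have "(\<Sum>k\<in>F. cc k \<bullet> (w s *\<^sub>R ?S k s)) = w s * (\<Sum>k\<in>F. cc k \<bullet> ?S k s)"
        by (simp add: sum_distrib_left)
      ultimately show ?thesis by simp
    qed (auto simp: LB_sym_def wt_outside)
  qed
  have i1: "integrable lborel (\<lambda>s. \<Sum>k\<in>F. cc k \<bullet> (w s *\<^sub>R ?S k s))"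
    by (intro Bochner_Integration.integrable_sum integrable_inner_right LB)
  have i2: "integrable lborel (\<lambda>s. \<Sum>k\<in>F. - ?\<kappa> * (w s * (s \<bullet> cc k)\<^sup>2))"
    by (intro Bochner_Integration.integrable_sum integrable_mult_right wt_isotropic)
  have "(\<Sum>k\<in>F. cc k \<bullet> LB \<rho> \<delta> ?v (grid_pt h k)) = (\<integral>s. (\<Sum>k\<in>F. cc k \<bullet> (w s *\<^sub>R ?S k s)) \<partial>lborel)"
    unfolding LB(2)
    by (subst Bochner_Integration.integral_sum) (intro integrable_inner_right LB(1), intro sum.cong refl integral_inner_right[symmetric] LB(1))
  also have "\<dots> \<le> (\<integral>s. (\<Sum>k\<in>F. - ?\<kappa> * (w s * (s \<bullet> cc k)\<^sup>2)) \<partial>lborel)"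
    by (rule integral_mono[OF i1 i2 pw])
  \<comment> \<open>Isotropy of the weight turns the averaged squares of s \<bullet> c_k into
    |c_k|^2.\<close>
  also have "\<dots> = (\<Sum>k\<in>F. - ?\<kappa> * (norm (cc k))\<^sup>2)"
    by (subst Bochner_Integration.integral_sum)
      (intro integrable_mult_right wt_isotropic, simp only: integral_mult_right_zero wt_isotropic(2))
  finally show ?thesis by (simp add: sum_distrib_left sum_negf)
qed

text \<open>On grid functions \<open>G\<close> is minus the adjoint of \<open>D\<close>, because the vector-valued stencil below is
  odd.\<close>

definition stencil :: "int^'d \<Rightarrow> real^'d" where
  "stencil n = (\<integral>s. w s *\<^sub>R ((Psi h 0 (grid_pt h n + s) - Psi h 0 (grid_pt h n)) *\<^sub>R s) \<partial>lborel)"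

lemma stencil_integrable:
  "integrable lborel (\<lambda>s. w s *\<^sub>R ((Psi h 0 (grid_pt h n + s) - Psi h 0 (grid_pt h n)) *\<^sub>R s))"
proof (rule integrable_wt(1))
  fix s
  show "norm ((Psi h 0 (grid_pt h n + s) - Psi h 0 (grid_pt h n)) *\<^sub>R s) \<le> (real CARD('d) / (c * H)) * (norm s)\<^sup>2"
    using mult_right_mono[OF Psi_lipschitz[OF h_pos cH_pos h_ge, of 0 "grid_pt h n" s], of "norm s"]
    by (simp add: power2_eq_square mult_ac)
qed measurable

text \<open>The basis function at the origin and the weight are even, while the factor
  \<open>s\<close> is odd.\<close>

lemma stencil_uminus: "stencil (- n) = - stencil n"
proof -
  let ?f = "\<lambda>n s. w s *\<^sub>R ((Psi h 0 (grid_pt h n + s) - Psi h 0 (grid_pt h n)) *\<^sub>R s)"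
  have z: "grid_pt h 0 = 0" "grid_pt h (- n) = - grid_pt h n" by (simp_all add: grid_pt_def vec_eq_iff)
  have ev: "Psi h 0 (- y) = Psi h 0 y" for y using Psi_reflect[of h 0 0 y] by (simp add: z)
  have e: "?f (- n) (- s) = - ?f n s" for s
    using ev[of "grid_pt h n + s"] ev[of "grid_pt h n"] by (simp add: z wt_uminus)
  have "stencil (- n) = (\<integral>s. ?f (- n) (- s) \<partial>lborel)"
    unfolding stencil_def by (rule lborel_integral_uminus(2)) measurable
  also have "\<dots> = (\<integral>s. - ?f n s \<partial>lborel)" by (rule Bochner_Integration.integral_cong[OF refl e])
  also have "\<dots> = - stencil n" by (simp only: stencil_def integral_minus)
  finally show ?thesis .
qed

lemma Psi_stencil: "Psi h k (grid_pt h m + s) = Psi h 0 (grid_pt h (m - k) + s)"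
  using Psi_shift[of h k "grid_pt h (m - k) + s" k] by (simp add: grid_pt_simps algebra_simps)

text \<open>On the grid D and G (after \<Pi>) are discrete convolutions with the same kernel, which
  makes their duality a matter of its parity.\<close>

lemma D_op_stencil: "D_op \<rho> \<delta> (i_h h cc) (grid_pt h m) = (\<Sum>k\<in>F. cc k \<bullet> stencil (m - k))"
proof -
  let ?f = "\<lambda>n s. w s *\<^sub>R ((Psi h 0 (grid_pt h n + s) - Psi h 0 (grid_pt h n)) *\<^sub>R s)"
  have "D_op \<rho> \<delta> (i_h h cc) (grid_pt h m) = (\<integral>s. (\<Sum>k\<in>F. cc k \<bullet> ?f (m - k) s) \<partial>lborel)"
    unfolding D_op_wt
  proof (intro Bochner_Integration.integral_cong refl)
    fix s
    have "s \<bullet> (i_h h cc (grid_pt h m + s) - i_h h cc (grid_pt h m)) =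
        (\<Sum>k\<in>F. (Psi h k (grid_pt h m + s) - Psi h k (grid_pt h m + 0)) * (s \<bullet> cc k))"
      unfolding trial_eq_sum inner_diff_right inner_sum_scaleR by (simp add: sum_subtractf left_diff_distrib)
    also have "\<dots> = (\<Sum>k\<in>F. (Psi h 0 (grid_pt h (m - k) + s) - Psi h 0 (grid_pt h (m - k))) * (s \<bullet> cc k))"
      by (intro sum.cong refl, subst Psi_stencil, subst (2) Psi_stencil) simp
    finally show "w s *\<^sub>R (s \<bullet> (i_h h cc (grid_pt h m + s) - i_h h cc (grid_pt h m))) = (\<Sum>k\<in>F. cc k \<bullet> ?f (m - k) s)"
      by (simp add: sum_distrib_left inner_commute mult_ac)
  qed
  also have "\<dots> = (\<Sum>k\<in>F. cc k \<bullet> stencil (m - k))"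
    unfolding stencil_def
    by (subst Bochner_Integration.integral_sum)
      (intro integrable_inner_right stencil_integrable, intro sum.cong refl integral_inner_right stencil_integrable)
  finally show ?thesis .
qed

lemma G_op_stencil:
  assumes E: "finite E" "\<And>s. norm s < \<delta> \<Longrightarrow> nodes h (grid_pt h k + s) \<subseteq> E"
  shows "G_op \<rho> \<delta> (Pi_h h g) (grid_pt h k) = (\<Sum>m\<in>E. g (grid_pt h m) *\<^sub>R stencil (k - m))"
proof -
  let ?f = "\<lambda>n s. w s *\<^sub>R ((Psi h 0 (grid_pt h n + s) - Psi h 0 (grid_pt h n)) *\<^sub>R s)"
  have "G_op \<rho> \<delta> (Pi_h h g) (grid_pt h k) = (\<integral>s. (\<Sum>m\<in>E. g (grid_pt h m) *\<^sub>R ?f (k - m) s) \<partial>lborel)"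
    unfolding G_op_wt
  proof (intro Bochner_Integration.integral_cong refl)
    fix s
    show "w s *\<^sub>R ((Pi_h h g (grid_pt h k + s) - Pi_h h g (grid_pt h k)) *\<^sub>R s) = (\<Sum>m\<in>E. g (grid_pt h m) *\<^sub>R ?f (k - m) s)"
    proof (cases "norm s < \<delta>")
      case True
      have P: "Pi_h h g (grid_pt h k + t) = (\<Sum>m\<in>E. Psi h 0 (grid_pt h (k - m) + t) * g (grid_pt h m))" if "norm t < \<delta>" for t
        unfolding Pi_h_superset[OF h_pos E(1) E(2)[OF that], of g] real_scaleR_def
        by (intro sum.cong refl, subst Psi_stencil) simp
      have "Pi_h h g (grid_pt h k + s) - Pi_h h g (grid_pt h k) =
          (\<Sum>m\<in>E. (Psi h 0 (grid_pt h (k - m) + s) - Psi h 0 (grid_pt h (k - m))) * g (grid_pt h m))"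
        using P[OF True] P[of 0] delta_pos by (simp add: sum_subtractf left_diff_distrib)
      then show ?thesis unfolding scaleR_sum_left scaleR_sum_right by (simp add: mult_ac scaleR_sum_left scaleR_sum_right)
    qed (simp add: wt_outside not_less)
  qed
  also have "\<dots> = (\<Sum>m\<in>E. g (grid_pt h m) *\<^sub>R stencil (k - m))"
    unfolding stencil_def
    by (subst Bochner_Integration.integral_sum)
      (intro integrable_scaleR_right stencil_integrable, intro sum.cong refl integral_scaleR_right)
  finally show ?thesis .
qed

text \<open>Summation by parts with the odd stencil gives minus the sum of the squares of D v over
  the nodes in \<open>E\<close>.\<close>

lemma GD_nonpos: "(\<Sum>k\<in>F. cc k \<bullet> G_op \<rho> \<delta> (Pi_h h (D_op \<rho> \<delta> (i_h h cc))) (grid_pt h k)) \<le> 0"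
proof -
  let ?g = "\<lambda>m. D_op \<rho> \<delta> (i_h h cc) (grid_pt h m)"
  \<comment> \<open>The radius covers every node active within distance \<delta> of a point of
    \<open>F\<close>: 2 d H is the reach of the basis functions.\<close>
  define E where "E = {m. norm (grid_pt h m) \<le> (\<Sum>k\<in>F. norm (grid_pt h k)) + \<delta> + 2 * real CARD('d) * H}"
  have E: "finite E" unfolding E_def by (rule finite_grid_ball)
  have nE: "nodes h (grid_pt h k + s) \<subseteq> E" if "k \<in> F" "norm s < \<delta>" for k s
  proof
    fix m assume "m \<in> nodes h (grid_pt h k + s)"
    then have "norm (grid_pt h m - (grid_pt h k + s)) \<le> 2 * real CARD('d) * H" by (rule nodes_norm)
    moreover have "norm (grid_pt h k) \<le> (\<Sum>k\<in>F. norm (grid_pt h k))"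
      using F(1) that(1) by (intro member_le_sum) auto
    moreover have "norm (grid_pt h m) \<le> norm (grid_pt h m - (grid_pt h k + s)) + (norm (grid_pt h k) + norm s)"
      using norm_triangle_ineq[of "grid_pt h m - (grid_pt h k + s)" "grid_pt h k + s"] norm_triangle_ineq[of "grid_pt h k" s]
      by simp
    ultimately show "m \<in> E" unfolding E_def using that(2) by simp
  qed
  have "(\<Sum>k\<in>F. cc k \<bullet> G_op \<rho> \<delta> (Pi_h h (D_op \<rho> \<delta> (i_h h cc))) (grid_pt h k)) =
      (\<Sum>k\<in>F. \<Sum>m\<in>E. ?g m * (cc k \<bullet> stencil (k - m)))"
    by (intro sum.cong refl) (simp add: G_op_stencil[OF E nE] inner_sum_scaleR)
  also have "\<dots> = (\<Sum>m\<in>E. ?g m * (\<Sum>k\<in>F. cc k \<bullet> stencil (k - m)))"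
    by (subst sum.swap) (simp add: sum_distrib_left)
  also have "\<dots> = (\<Sum>m\<in>E. - (?g m * ?g m))"
  proof (rule sum.cong[OF refl])
    fix m
    have "(\<Sum>k\<in>F. cc k \<bullet> stencil (k - m)) = - (\<Sum>k\<in>F. cc k \<bullet> stencil (m - k))"
      unfolding sum_negf[symmetric]
    proof (rule sum.cong[OF refl])
      fix k
      show "cc k \<bullet> stencil (k - m) = - (cc k \<bullet> stencil (m - k))" using stencil_uminus[of "m - k"] by simp
    qed
    then show "?g m * (\<Sum>k\<in>F. cc k \<bullet> stencil (k - m)) = - (?g m * ?g m)" by (simp add: D_op_stencil)
  qed
  also have "\<dots> \<le> 0" by (intro sum_nonpos) simp
  finally show ?thesis .
qed

text \<open>The condition \<open>mu \<le> lam\<close> makes the coefficient of G \<Pi> D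
  nonnegative, so that term only helps and is dropped.\<close>

lemma scheme_coercive:
  assumes A: "0 \<le> A" "\<And>k m j. k \<in> F \<Longrightarrow> m \<in> F \<Longrightarrow> \<bar>grid_pt h k $ j - grid_pt h m $ j\<bar> \<le> A"
    and \<delta>: "\<delta> \<le> \<delta>0" and mu: "0 < mu" "mu \<le> lam"
  shows "(C_alpha CARD('d) * mu / real CARD('d)) * (1 / (real CARD('d) * (A + 2 * H) + \<delta>0)\<^sup>2 / 4 ^ CARD('d)) * (\<Sum>k\<in>F. (norm (cc k))\<^sup>2) \<le>
    - (\<Sum>k\<in>F. cc k \<bullet> LSh lam mu \<rho> h \<delta> (i_h h cc) (grid_pt h k))"
proof -
  let ?a = "C_alpha CARD('d) * mu / real CARD('d)" and ?b = "C_beta CARD('d) * (lam - mu) / real CARD('d)"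
  have ab: "0 \<le> ?a" "0 \<le> ?b" using mu by (auto simp: C_alpha_def C_beta_def)
  have "(\<Sum>k\<in>F. cc k \<bullet> LSh lam mu \<rho> h \<delta> (i_h h cc) (grid_pt h k)) =
      ?a * (\<Sum>k\<in>F. cc k \<bullet> LB \<rho> \<delta> (i_h h cc) (grid_pt h k)) +
      ?b * (\<Sum>k\<in>F. cc k \<bullet> G_op \<rho> \<delta> (Pi_h h (D_op \<rho> \<delta> (i_h h cc))) (grid_pt h k))"
    unfolding LSh_def inner_add_right inner_scaleR_right sum.distrib sum_distrib_left ..
  then show ?thesis
    using mult_left_mono[OF LB_coercive[OF A \<delta>] ab(1)] mult_left_mono[OF GD_nonpos ab(2)] by (simp add: mult.assoc)
qed

text \<open>The residual is measured in the maximum norm, which brings in the number of nodes; the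
  volume of the basis functions compensates it in the L^2 norm.\<close>

lemma scheme_stable:
  assumes A: "0 \<le> A" "\<And>k m j. k \<in> F \<Longrightarrow> m \<in> F \<Longrightarrow> \<bar>grid_pt h k $ j - grid_pt h m $ j\<bar> \<le> A"
    and \<delta>: "\<delta> \<le> \<delta>0" and mu: "0 < mu" "mu \<le> lam"
    and T: "0 \<le> T" "\<And>k. k \<in> F \<Longrightarrow> norm (LSh lam mu \<rho> h \<delta> (i_h h cc) (grid_pt h k)) \<le> T"
  shows "(\<Sum>k\<in>F. (norm (cc k))\<^sup>2) \<le> real (card F) *
    (T * (4 ^ CARD('d) * (real CARD('d) * (A + 2 * H) + \<delta>0)\<^sup>2 / (C_alpha CARD('d) * mu / real CARD('d))))\<^sup>2"
proof -
  let ?S = "\<Sum>k\<in>F. (norm (cc k))\<^sup>2"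
  let ?W = "real CARD('d) * (A + 2 * H) + \<delta>0"
  let ?a = "C_alpha CARD('d) * mu / real CARD('d)"
  let ?\<kappa> = "?a * (1 / ?W\<^sup>2 / 4 ^ CARD('d))"
  have W: "0 < ?W" using A(1) H_pos \<delta> delta_pos by (intro add_nonneg_pos mult_nonneg_nonneg) auto
  have a: "0 < ?a" using mu by (auto simp: C_alpha_def)
  have \<kappa>: "0 < ?\<kappa>" using W by (intro mult_pos_pos[OF a] divide_pos_pos) auto
  have S: "0 \<le> ?S" by (intro sum_nonneg) auto
  have "?\<kappa> * ?S \<le> (\<Sum>k\<in>F. - (cc k \<bullet> LSh lam mu \<rho> h \<delta> (i_h h cc) (grid_pt h k)))"
    using scheme_coercive[OF A \<delta> mu] by (simp add: sum_negf)
  also have "\<dots> \<le> (\<Sum>k\<in>F. norm (cc k) * T)"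
  proof (rule sum_mono)
    fix k assume k: "k \<in> F"
    have "- (cc k \<bullet> LSh lam mu \<rho> h \<delta> (i_h h cc) (grid_pt h k)) \<le> norm (cc k) * norm (LSh lam mu \<rho> h \<delta> (i_h h cc) (grid_pt h k))"
      using Cauchy_Schwarz_ineq2[of "cc k" "LSh lam mu \<rho> h \<delta> (i_h h cc) (grid_pt h k)"] by linarith
    also have "\<dots> \<le> norm (cc k) * T" using T(2)[OF k] by (intro mult_left_mono) auto
    finally show "- (cc k \<bullet> LSh lam mu \<rho> h \<delta> (i_h h cc) (grid_pt h k)) \<le> norm (cc k) * T" .
  qed
  also have "\<dots> = (\<Sum>k\<in>F. norm (cc k)) * T" by (simp add: sum_distrib_right)
  finally have le: "?\<kappa> * ?S \<le> (\<Sum>k\<in>F. norm (cc k)) * T" .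
  have "?S \<le> real (card F) * (T / ?\<kappa>)\<^sup>2"
    by (rule coercive_bound[OF \<kappa> S le sum_squared_le_sum_of_squares]) simp
  also have "T / ?\<kappa> = T * (4 ^ CARD('d) * ?W\<^sup>2 / ?a)" using a W by simp
  finally show ?thesis .
qed

end

end

section \<open>Regularity of the exact solution\<close>

text \<open>Bridges the axis-wise derivatives of the regularity assumption and the Frechet
  derivatives in \<open>bounded_partials\<close>: the point is moved one coordinate at a time, with
  a mean value estimate for each move.\<close>

lemma has_derivative_of_continuous_partials:
  fixes g :: "real^'d \<Rightarrow> real"
  assumes p: "\<And>i x. has_partial i g x" and c: "\<And>i. continuous_on UNIV (partial_deriv i g)"
  shows "(g has_derivative (\<lambda>v. \<Sum>i\<in>UNIV. v $ i * partial_deriv i g x)) (at x)"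
  unfolding has_derivative_at_alt
proof (intro conjI allI impI)
  show "bounded_linear (\<lambda>v. \<Sum>i\<in>UNIV. v $ i * partial_deriv i g x)"
    by (intro bounded_linear_sum bounded_linear_mult_left[THEN bounded_linear_compose] bounded_linear_vec_nth)
  fix e :: real assume e: "0 < e"
  define e' where "e' = e / real CARD('d)"
  have e': "0 < e'" using e by (simp add: e'_def)
  have "\<exists>r>0. \<forall>y. dist y x < r \<longrightarrow> dist (partial_deriv i g y) (partial_deriv i g x) < e'" for i
    using c[of i] e' unfolding continuous_on_iff by blast
  then obtain r where r: "\<And>i. 0 < r i" "\<And>i y. dist y x < r i \<Longrightarrow> dist (partial_deriv i g y) (partial_deriv i g x) < e'"
    by metis
  let ?r = "Min (range r)"
  have r0: "0 < ?r" using r(1) by simp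
  have line: "((\<lambda>t. g (y + t *\<^sub>R axis i 1)) has_real_derivative partial_deriv i g (y + t *\<^sub>R axis i 1)) (at t)" for y i t
  proof -
    have "((\<lambda>s. g ((y + t *\<^sub>R axis i 1) + s *\<^sub>R axis i 1)) has_real_derivative partial_deriv i g (y + t *\<^sub>R axis i 1)) (at 0)"
      using p[of i "y + t *\<^sub>R axis i 1"] unfolding has_partial_def partial_deriv_def
      by (simp add: DERIV_deriv_iff_field_differentiable)
    then have "((\<lambda>s. g (y + (s + t) *\<^sub>R axis i 1)) has_real_derivative partial_deriv i g (y + t *\<^sub>R axis i 1)) (at 0)"
      by (simp add: scaleR_left_distrib add_ac)
    then show ?thesis using DERIV_shift[of "\<lambda>s. g (y + s *\<^sub>R axis i 1)" _ 0 t] by simp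
  qed
  show "\<exists>d>0. \<forall>y. norm (y - x) < d \<longrightarrow>
      norm (g y - g x - (\<Sum>i\<in>UNIV. (y - x) $ i * partial_deriv i g x)) \<le> e * norm (y - x)"
  proof (intro exI[of _ ?r] conjI allI impI r0)
    fix y assume y: "norm (y - x) < ?r"
    let ?v = "y - x"
    \<comment> \<open>In \<open>?P S\<close> the coordinates in \<open>S\<close> have already been
      moved from \<open>x\<close> to \<open>y\<close>.\<close>
    let ?P = "\<lambda>S. x + (\<chi> i. if i \<in> S then ?v $ i else 0)"
    have ind: "\<bar>g (?P S) - g x - (\<Sum>i\<in>S. ?v $ i * partial_deriv i g x)\<bar> \<le> (\<Sum>i\<in>S. e' * \<bar>?v $ i\<bar>)" if "finite S" for S
      using that
    proof (induction S)
      case empty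
      have "?P {} = x" by (simp add: vec_eq_iff)
      then show ?case by simp
    next
      case (insert j S)
      let ?h = "\<lambda>t. g (?P S + t *\<^sub>R axis j 1) - t * partial_deriv j g x"
      have "norm (?h (?v $ j) - ?h 0) \<le> e' * norm (?v $ j - 0)"
      proof (rule field_differentiable_bound[of "closed_segment 0 (?v $ j)"])
        fix t assume t: "t \<in> closed_segment 0 (?v $ j)"
        show "(?h has_field_derivative partial_deriv j g (?P S + t *\<^sub>R axis j 1) - partial_deriv j g x) (at t within closed_segment 0 (?v $ j))"
          by (rule has_field_derivative_at_within) (auto intro!: derivative_eq_intros line)
        have tb: "\<bar>t\<bar> \<le> \<bar>?v $ j\<bar>" using t by (auto simp: closed_segment_eq_real_ivl split: if_splits)
        have "norm ((\<chi> i. if i \<in> S then ?v $ i else 0) + t *\<^sub>R axis j 1) \<le> norm ?v"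
          by (rule norm_le_componentwise_cart) (use tb insert.hyps in \<open>auto simp: axis_def\<close>)
        then have "dist (?P S + t *\<^sub>R axis j 1) x < r j"
        proof -
          assume "norm ((\<chi> i. if i \<in> S then ?v $ i else 0) + t *\<^sub>R axis j 1) \<le> norm ?v"
          also have "norm ?v < r j" using y by simp
          finally show ?thesis by (simp add: dist_norm add.assoc)
        qed
        then show "norm (partial_deriv j g (?P S + t *\<^sub>R axis j 1) - partial_deriv j g x) \<le> e'"
          using r(2) by (simp add: dist_norm less_imp_le)
      qed auto
      moreover have "?P S + ?v $ j *\<^sub>R axis j 1 = ?P (insert j S)"
        using insert.hyps by (auto simp: vec_eq_iff axis_def)
      moreover have "?P S + 0 *\<^sub>R axis j 1 = ?P S" by simp
      ultimately have "\<bar>g (?P (insert j S)) - ?v $ j * partial_deriv j g x - g (?P S)\<bar> \<le> e' * \<bar>?v $ j\<bar>"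
        by (simp only: real_norm_def mult_zero_left diff_zero)
      with insert.IH show ?case unfolding sum.insert[OF insert.hyps] by linarith
    qed
    have "?P UNIV = y" by (simp add: vec_eq_iff)
    then have "\<bar>g y - g x - (\<Sum>i\<in>UNIV. ?v $ i * partial_deriv i g x)\<bar> \<le> e' * (\<Sum>i\<in>UNIV. \<bar>?v $ i\<bar>)"
      using ind[of UNIV] by (simp add: sum_distrib_left)
    also have "\<dots> \<le> e' * (real CARD('d) * norm ?v)" using e' by (intro mult_left_mono sum_abs_le_norm) auto
    also have "\<dots> = e * norm ?v" by (simp add: e'_def)
    finally show "norm (g y - g x - (\<Sum>i\<in>UNIV. (y - x) $ i * partial_deriv i g x)) \<le> e * norm (y - x)" by simp
  qed
qed

lemma zero_partial:
  fixes f :: "real^'d \<Rightarrow> real"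
  assumes W: "open W" "y \<in> W" "\<And>z. z \<in> W \<Longrightarrow> f z = 0"
  shows "((\<lambda>t. f (y + t *\<^sub>R axis i 1)) has_real_derivative 0) (at 0)"
proof -
  have "((\<lambda>t::real. y + t *\<^sub>R axis i 1) \<longlongrightarrow> y) (nhds 0)"
    by (rule tendsto_eq_intros filterlim_ident refl | simp)+
  then have "\<forall>\<^sub>F t in nhds 0. y + t *\<^sub>R axis i 1 \<in> W" using W(1,2) by (rule topological_tendstoD)
  then have "\<forall>\<^sub>F t in nhds 0. f (y + t *\<^sub>R axis i 1) = 0" by eventually_elim (rule W(3))
  then show ?thesis by (subst DERIV_cong_ev[OF refl _ refl, of _ "\<lambda>_. 0"]) auto
qed

lemma D_multi_zero:
  assumes W: "open W" "\<And>z. z \<in> W \<Longrightarrow> g z = 0" "y \<in> W"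
  shows "D_multi \<beta> g y = 0"
  using W(3)
proof (induction \<beta> arbitrary: y)
  case (Cons i \<beta>)
  show ?case unfolding D_multi.simps partial_deriv_def
    by (rule DERIV_imp_deriv, rule zero_partial[OF W(1) Cons.prems]) (rule Cons.IH)
qed (use W in simp)

text \<open>The closure of \<Omega> lies in the interior of \<open>Omega_delta\<close>, and
  \<open>u\<close> vanishes on the open complement of that closure. These two open sets cover the
  space, so the derivatives exist and are continuous everywhere. Each one vanishes outside the ball
  of radius \<open>R\<close> and is therefore bounded by the next order times d (2 R + 1).\<close>

lemma global_bounds:
  fixes \<Omega> :: "(real^'d) set" and u :: "real^'d \<Rightarrow> real^'d"
  assumes \<Omega>: "\<Omega> \<noteq> {}" "\<Omega> \<subseteq> cball 0 R" and \<delta>: "0 < \<delta>"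
    and z: "\<And>x. x \<notin> \<Omega> \<Longrightarrow> u x = 0"
    and reg: "C_closure_vec 4 (Omega_delta \<Omega> \<delta>) u"
    and sup: "deriv_sup 4 (Omega_delta \<Omega> \<delta>) u \<le> ereal M"
    and p: "p \<le> 4"
  shows "bounded_partials p ((real CARD('d) * (2 * R + 1)) ^ (4 - p) * max M 0) (\<lambda>x. u x $ a)"
proof -
  let ?A = "Omega_delta \<Omega> \<delta>" and ?g = "\<lambda>x. u x $ a" and ?W = "- closure \<Omega>"
  let ?G = "\<lambda>\<beta>. D_multi \<beta> ?g"
  let ?L = "real CARD('d) * (2 * R + 1)"
  have W: "open ?W" by auto
  have zW: "?g y = 0" if "y \<in> ?W" for y
  proof -
    have "y \<notin> \<Omega>" using that closure_subset[of \<Omega>] by blast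
    then show ?thesis by (simp add: z)
  qed
  have zD: "?G \<beta> y = 0" if "y \<in> ?W" for y \<beta>
    by (rule D_multi_zero[OF W _ that]) (rule zW)
  have "open {y. infdist y \<Omega> < 2 * \<delta>}"
    by (intro open_Collect_less continuous_intros)
  moreover have "{y. infdist y \<Omega> < 2 * \<delta>} \<subseteq> ?A" by (auto simp: Omega_delta_def Omega_I_def)
  ultimately have "{y. infdist y \<Omega> < 2 * \<delta>} \<subseteq> interior ?A" by (rule interior_maximal[rotated])
  moreover have "infdist y \<Omega> = 0" if "y \<in> closure \<Omega>" for y using that \<Omega>(1) by (simp add: in_closure_iff_infdist_zero)
  ultimately have "closure \<Omega> \<subseteq> interior ?A" using \<delta> by (metis (mono_tags, lifting) mem_Collect_eq mult_pos_pos subset_iff zero_less_numeral)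
  then have cover: "interior ?A \<union> ?W = UNIV" by blast
  have reg': "C_closure 4 ?A ?g" using reg by (simp add: C_closure_vec_def)
  have partial: "has_partial i (?G \<beta>) x" if "length \<beta> < 4" for i \<beta> x
  proof (cases "x \<in> interior ?A")
    case True then show ?thesis using reg' that by (simp add: C_closure_def)
  next
    case False
    then have "x \<in> ?W" using cover by auto
    have "((\<lambda>t. ?G \<beta> (x + t *\<^sub>R axis i 1)) has_real_derivative 0) (at 0)"
      by (rule zero_partial[OF W \<open>x \<in> ?W\<close>]) (rule zD)
    then show ?thesis unfolding has_partial_def field_differentiable_def by blast
  qed
  have cont: "continuous_on UNIV (?G \<beta>)" if "length \<beta> \<le> 4" for \<beta>
  proof -
    have "\<exists>G. continuous_on (closure ?A) G \<and> (\<forall>x\<in>interior ?A. G x = ?G \<beta> x)"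
      using reg' that unfolding C_closure_def by simp
    then obtain G where G: "continuous_on (closure ?A) G" "\<forall>x\<in>interior ?A. G x = ?G \<beta> x"
      by (elim exE conjE)
    have "continuous_on (interior ?A) (?G \<beta>)"
    proof (rule continuous_on_eq)
      show "continuous_on (interior ?A) G"
        by (rule continuous_on_subset[OF G(1)]) (use interior_subset[of ?A] closure_subset[of ?A] in blast)
    qed (use G(2) in blast)
    moreover have "continuous_on ?W (?G \<beta>)"
      by (rule continuous_on_eq[of _ "\<lambda>_. 0"]) (auto simp: zD)
    ultimately have "continuous_on (interior ?A \<union> ?W) (?G \<beta>)"
      by (intro continuous_on_open_Un W open_interior)
    then show ?thesis by (simp only: cover)
  qed
  have d: "(?G \<beta> has_derivative (\<lambda>v. \<Sum>i\<in>UNIV. v $ i * ?G (i # \<beta>) x)) (at x)" if "length \<beta> < 4" for \<beta> x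
  proof -
    have "continuous_on UNIV (partial_deriv i (?G \<beta>))" for i using cont[of "i # \<beta>"] that by simp
    from has_derivative_of_continuous_partials[OF partial[OF that] this] show ?thesis by (simp only: D_multi.simps)
  qed
  have b4: "\<bar>?G \<beta> x\<bar> \<le> max M 0" if "length \<beta> = 4" for \<beta> x
  proof (cases "x \<in> interior ?A")
    case True
    have "ereal \<bar>?G \<beta> x\<bar> \<le> (SUP y\<in>interior ?A. ereal \<bar>?G \<beta> y\<bar>)" using True by (rule SUP_upper)
    also have "\<dots> \<le> (SUP \<beta>\<in>{\<beta>. length \<beta> = 4}. SUP y\<in>interior ?A. ereal \<bar>?G \<beta> y\<bar>)"
      using that by (intro SUP_upper[of \<beta> _ "\<lambda>\<beta>. SUP y\<in>interior ?A. ereal \<bar>?G \<beta> y\<bar>"]) simp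
    also have "\<dots> \<le> deriv_sup 4 ?A u" unfolding deriv_sup_def
      by (rule SUP_upper[of a UNIV "\<lambda>j. SUP \<beta>\<in>{\<beta>. length \<beta> = 4}. SUP y\<in>interior ?A. ereal \<bar>D_multi \<beta> (\<lambda>x. u x $ j) y\<bar>"]) simp
    also have "\<dots> \<le> ereal M" by (rule sup)
    finally show ?thesis by simp
  next
    case False
    then have "x \<in> ?W" using cover by auto
    then show ?thesis by (simp add: zD)
  qed
  have R: "0 \<le> R" using \<Omega> by auto
  have "closure \<Omega> \<subseteq> cball 0 R" using \<Omega>(2) by (simp add: closure_minimal)
  \<comment> \<open>\<open>n\<close> counts the orders below four, so the induction descends from
    the bounded fourth derivatives.\<close>
  have b: "length \<beta> = 4 - n \<Longrightarrow> n \<le> 4 \<Longrightarrow> \<bar>?G \<beta> x\<bar> \<le> ?L ^ n * max M 0" for n \<beta> x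
  proof (induction n arbitrary: \<beta> x)
    case 0 then show ?case using b4 by simp
  next
    case (Suc n)
    let ?K = "?L ^ n * max M 0"
    have K: "0 \<le> ?K" using R by simp
    show ?case
    proof (cases "x \<in> closure \<Omega>")
      case True
      \<comment> \<open>A step longer than 2 R leads from any point of the ball of radius
        \<open>R\<close> to a point outside it.\<close>
      let ?z = "(2 * R + 1) *\<^sub>R axis undefined (1::real) :: real^'d"
      have nz: "norm ?z = 2 * R + 1" using R by simp
      have "norm x \<le> R" using True \<open>closure \<Omega> \<subseteq> cball 0 R\<close> by auto
      moreover have "norm ?z \<le> norm (x + ?z) + norm x" using norm_triangle_ineq4[of "x + ?z" x] by simp
      ultimately have "\<not> norm (x + ?z) \<le> R" using nz R by linarith
      then have "x + ?z \<in> ?W" using \<open>closure \<Omega> \<subseteq> cball 0 R\<close> by auto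
      then have "?G \<beta> (x + ?z) = 0" by (rule zD)
      moreover have "\<bar>?G \<beta> (x + ?z) - ?G \<beta> x\<bar> \<le> real CARD('d) * ?K * norm ?z"
      proof (rule lipschitz_of_partials[of _ "\<lambda>i. ?G (i # \<beta>)"])
        show "(?G \<beta> has_derivative (\<lambda>v. \<Sum>i\<in>UNIV. v $ i * ?G (i # \<beta>) y)) (at y)" for y
          using Suc.prems by (intro d) simp
        show "\<bar>?G (i # \<beta>) y\<bar> \<le> ?K" for i y
          using Suc.prems by (intro Suc.IH) auto
      qed
      ultimately show ?thesis unfolding nz by (simp add: mult_ac)
    next
      case False
      then have "?G \<beta> x = 0" by (intro zD) auto
      then show ?thesis using R by simp
    qed
  qed
  show ?thesis unfolding bounded_partials_def
    by (rule exI[of _ ?G]) (use d b[of _ "4 - p"] p in auto)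
qed

section \<open>Linearity of the discrete operator and L^2 bounds\<close>

context scheme
begin

lemma LSh_diff:
  assumes "lip u" "\<And>s. norm (u (x + s) + u (x - s) - 2 *\<^sub>R u x) \<le> K * (norm s)\<^sup>2"
    and "lip v" "\<And>s. norm (v (x + s) + v (x - s) - 2 *\<^sub>R v x) \<le> L * (norm s)\<^sup>2"
  shows "LSh lam mu \<rho> h \<delta> (\<lambda>y. u y - v y) x = LSh lam mu \<rho> h \<delta> u x - LSh lam mu \<rho> h \<delta> v x"
proof -
  have LB: "LB \<rho> \<delta> (\<lambda>y. u y - v y) x = LB \<rho> \<delta> u x - LB \<rho> \<delta> v x"
  proof (rule LB_diff(1)[OF assms])
    fix s
    have "(u (x + s) - v (x + s)) + (u (x - s) - v (x - s)) - 2 *\<^sub>R (u x - v x) =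
        (u (x + s) + u (x - s) - 2 *\<^sub>R u x) - (v (x + s) + v (x - s) - 2 *\<^sub>R v x)"
      by (simp add: algebra_simps)
    then show "norm ((u (x + s) - v (x + s)) + (u (x - s) - v (x - s)) - 2 *\<^sub>R (u x - v x)) \<le> (K + L) * (norm s)\<^sup>2"
      using norm_triangle_ineq4[of "u (x + s) + u (x - s) - 2 *\<^sub>R u x" "v (x + s) + v (x - s) - 2 *\<^sub>R v x"] assms(2)[of s] assms(4)[of s]
      by (simp only: distrib_right)
  qed
  have lp: "lip (Pi_h h (D_op \<rho> \<delta> g))" if g: "lip g" for g :: "real^'d \<Rightarrow> real^'d"
  proof -
    obtain J where "\<And>x s. norm (g (x + s) - g x) \<le> J * norm s" using g unfolding lip_def by blast
    from lip_Pi_bounded[of "D_op \<rho> \<delta> g", OF D_op_integrand(2)[OF g this]] show ?thesis .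
  qed
  have "D_op \<rho> \<delta> (\<lambda>y. u y - v y) = (\<lambda>y. D_op \<rho> \<delta> u y - D_op \<rho> \<delta> v y)"
    by (rule ext) (rule D_op_diff[OF assms(1,3)])
  then have "Pi_h h (D_op \<rho> \<delta> (\<lambda>y. u y - v y)) = (\<lambda>y. Pi_h h (D_op \<rho> \<delta> u) y - Pi_h h (D_op \<rho> \<delta> v) y)"
    by (intro ext) (simp only: Pi_h_diff[OF h_pos])
  then have G: "G_op \<rho> \<delta> (Pi_h h (D_op \<rho> \<delta> (\<lambda>y. u y - v y))) x =
      G_op \<rho> \<delta> (Pi_h h (D_op \<rho> \<delta> u)) x - G_op \<rho> \<delta> (Pi_h h (D_op \<rho> \<delta> v)) x"
    using G_op_diff[OF lp[OF assms(1)] lp[OF assms(3)]] by simp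
  show ?thesis unfolding LSh_def LB G scaleR_right_diff_distrib by (rule add_diff_add[symmetric])
qed

lemma L2_norm_split:
  assumes \<Omega>: "\<Omega> \<in> sets borel" "emeasure lborel \<Omega> < \<infinity>"
    and F: "finite F" "\<And>k. k \<notin> F \<Longrightarrow> cc k = 0"
    and B: "\<And>x. x \<in> \<Omega> \<Longrightarrow> norm (e x) \<le> B"
    and V: "\<And>k. (\<integral>x. indicat_real \<Omega> x * Psi h k x \<partial>lborel) \<le> V"
  shows "(L2_norm_on \<Omega> (\<lambda>x. e x - i_h h cc x))\<^sup>2 \<le> 2 * B\<^sup>2 * measure lborel \<Omega> + 2 * (V * (\<Sum>k\<in>F. (norm (cc k))\<^sup>2))"
proof -
  have \<Omega>i: "integrable lborel (indicat_real \<Omega>)" using \<Omega> by (intro integrable_real_indicator) auto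
  let ?P = "\<lambda>x. 2 * B\<^sup>2 * indicat_real \<Omega> x + 2 * (\<Sum>k\<in>F. (norm (cc k))\<^sup>2 * (indicat_real \<Omega> x * Psi h k x))"
  have Pi: "integrable lborel ?P"
    by (intro Bochner_Integration.integrable_add integrable_mult_right Bochner_Integration.integrable_sum \<Omega>i integral_Psi(1)[OF \<Omega>])
  have le: "indicat_real \<Omega> x *\<^sub>R (norm (e x - i_h h cc x))\<^sup>2 \<le> ?P x" for x
  proof (cases "x \<in> \<Omega>")
    case True
    have "(norm (e x - i_h h cc x))\<^sup>2 \<le> (norm (e x) + norm (i_h h cc x))\<^sup>2"
      by (intro power_mono norm_triangle_ineq4) auto
    also have "\<dots> \<le> 2 * (norm (e x))\<^sup>2 + 2 * (norm (i_h h cc x))\<^sup>2"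
      using sum_squares_bound[of "norm (e x)" "norm (i_h h cc x)"] by (simp add: power2_sum)
    also have "\<dots> \<le> 2 * B\<^sup>2 + 2 * (\<Sum>k\<in>F. Psi h k x * (norm (cc k))\<^sup>2)"
      using B[OF True] i_h_norm_sq[OF F, where x = x] by (intro add_mono mult_left_mono power_mono) auto
    finally show ?thesis using True by (simp add: mult_ac)
  qed simp
  have "(LINT x:\<Omega>|lborel. (norm (e x - i_h h cc x))\<^sup>2) \<le> (\<integral>x. ?P x \<partial>lborel)"
    unfolding set_lebesgue_integral_def
  proof (rule integral_mono'[OF Pi le])
    fix x show "0 \<le> ?P x" by (rule order_trans[OF _ le]) (simp add: indicator_def)
  qed
  also have "\<dots> = 2 * B\<^sup>2 * measure lborel \<Omega> + 2 * (\<Sum>k\<in>F. (norm (cc k))\<^sup>2 * (\<integral>x. indicat_real \<Omega> x * Psi h k x \<partial>lborel))"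
    using \<Omega> by (subst Bochner_Integration.integral_add)
      (intro integrable_mult_right Bochner_Integration.integrable_sum \<Omega>i integral_Psi(1)[OF \<Omega>],
       intro integrable_mult_right Bochner_Integration.integrable_sum \<Omega>i integral_Psi(1)[OF \<Omega>],
       simp add: Bochner_Integration.integral_sum integral_Psi(1)[OF \<Omega>] integrable_mult_right)
  also have "\<dots> \<le> 2 * B\<^sup>2 * measure lborel \<Omega> + 2 * (\<Sum>k\<in>F. (norm (cc k))\<^sup>2 * V)"
    by (intro add_left_mono mult_left_mono sum_mono V) auto
  finally have "(LINT x:\<Omega>|lborel. (norm (e x - i_h h cc x))\<^sup>2) \<le>
      2 * B\<^sup>2 * measure lborel \<Omega> + 2 * (V * (\<Sum>k\<in>F. (norm (cc k))\<^sup>2))" by (simp add: sum_distrib_left mult_ac)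
  moreover have "0 \<le> (LINT x:\<Omega>|lborel. (norm (e x - i_h h cc x))\<^sup>2)"
    unfolding set_lebesgue_integral_def by (rule Bochner_Integration.integral_nonneg) simp
  ultimately show ?thesis unfolding L2_norm_on_def by simp
qed

text \<open>The number of nodes times the mass of a basis function stays bounded: for H \<le> 1 the
  powers H^(-d) and H^d cancel, for larger H both factors are bounded separately.\<close>

lemma grid_count_volume:
  assumes \<Omega>: "\<Omega> \<in> sets borel" "emeasure lborel \<Omega> < \<infinity>" and R: "0 \<le> R" and F: "F \<subseteq> {m. norm (grid_pt h m) \<le> R}"
  obtains V where "\<And>k. (\<integral>x. indicat_real \<Omega> x * Psi h k x \<partial>lborel) \<le> V" "0 \<le> V"
    "real (card F) * V \<le> (4 * (2 * R / c + 1)) ^ CARD('d) + (2 * R / c + 1) ^ CARD('d) * measure lborel \<Omega>"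
proof -
  let ?q = "2 * R / c + 1"
  have q: "0 \<le> ?q" using R c_pos by simp
  have "card F \<le> card {m. norm (grid_pt h m) \<le> R}" by (rule card_mono[OF finite_grid_ball F])
  then have N: "real (card F) \<le> (2 * R / (c * H) + 1) ^ CARD('d)" using card_grid_ball[OF R] by linarith
  show thesis
  proof (cases "H \<le> 1")
    case True
    have "real (card F) * (4 * H) ^ CARD('d) \<le> (2 * R / (c * H) + 1) ^ CARD('d) * (4 * H) ^ CARD('d)"
      using N H_pos by (intro mult_right_mono) auto
    also have "\<dots> = (4 * (2 * R / c + H)) ^ CARD('d)"
    proof -
      have "(2 * R / (c * H) + 1) * (4 * H) = 4 * (2 * R / c + H)" using c_pos H_pos by (simp add: field_simps)
      then show ?thesis by (simp only: power_mult_distrib[symmetric])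
    qed
    also have "\<dots> \<le> (4 * ?q) ^ CARD('d)" using True R c_pos H_pos by (intro power_mono) auto
    also have "\<dots> \<le> (4 * ?q) ^ CARD('d) + ?q ^ CARD('d) * measure lborel \<Omega>" using q by simp
    finally show thesis using that[OF integral_Psi(3)[OF \<Omega>]] H_pos by simp
  next
    case False
    have "2 * R / (c * H) \<le> 2 * R / c"
      using False R c_pos by (intro divide_left_mono) (auto simp: mult_le_cancel_left1)
    then have "(2 * R / (c * H) + 1) ^ CARD('d) \<le> ?q ^ CARD('d)"
      using R c_pos H_pos by (intro power_mono) auto
    with N have "real (card F) * measure lborel \<Omega> \<le> ?q ^ CARD('d) * measure lborel \<Omega>"
      by (intro mult_right_mono) auto
    also have "\<dots> \<le> (4 * ?q) ^ CARD('d) + ?q ^ CARD('d) * measure lborel \<Omega>" using q by simp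
    finally show thesis using that[OF integral_Psi(2)[OF \<Omega>]] by simp
  qed
qed

end

section \<open>Convergence\<close>

context mesh
begin

text \<open>The inverse coercivity constant at H = 1, with 2 R for the spread of the nodes.\<close>

definition stab_const :: "real \<Rightarrow> real \<Rightarrow> real \<Rightarrow> real" where
  "stab_const mu R \<delta>0 =
     4 ^ CARD('d) * (real CARD('d) * (2 * R + 2) + \<delta>0)\<^sup>2 / (C_alpha CARD('d) * mu / real CARD('d))"

definition cons_const :: "real \<Rightarrow> real \<Rightarrow> real" where
  "cons_const lam mu =
     \<bar>C_alpha CARD('d) * mu / real CARD('d)\<bar> * real CARD('d) ^ 2 * second_diff_const
     + \<bar>C_beta CARD('d) * (lam - mu) / real CARD('d)\<bar> * (interp_lip_const + 1) * real CARD('d) ^ 4 * lip_const"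

definition op_const :: "real \<Rightarrow> real \<Rightarrow> real" where
  "op_const lam mu =
     \<bar>C_alpha CARD('d) * mu / real CARD('d)\<bar> * real CARD('d) ^ 4
     + \<bar>C_beta CARD('d) * (lam - mu) / real CARD('d)\<bar> * real CARD('d) ^ 5"

text \<open>Each sum serves both regimes: \<open>M2\<close> carries the interpolation error and
  \<open>M\<close> the consistency error for H \<le> 1, while \<open>M0\<close> bounds
  \<open>u\<close> and the other \<open>M2\<close> bounds the operator applied to \<open>u\<close>
  for H > 1. The factors 2 come from (a + b)^2 \<le> 2 a^2 + 2 b^2.\<close>

definition error_const :: "real \<Rightarrow> real \<Rightarrow> real \<Rightarrow> real \<Rightarrow> real \<Rightarrow> real \<Rightarrow> real \<Rightarrow> real \<Rightarrow> real" where
  "error_const lam mu R \<delta>0 vol M0 M2 M = sqrt (2 * (M0 + 4 * real CARD('d) ^ 5 * M2)\<^sup>2 * vol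
     + 2 * (((4 * (2 * R / c + 1)) ^ CARD('d) + (2 * R / c + 1) ^ CARD('d) * vol)
            * ((cons_const lam mu * M + op_const lam mu * M2) * stab_const mu R \<delta>0)\<^sup>2))"

lemma const_nonneg: "0 \<le> cons_const lam mu" "0 \<le> op_const lam mu"
  using lip_const_nonneg second_diff_const_nonneg interp_lip_const_nonneg by (auto simp: cons_const_def op_const_def)

lemma stab_const_nonneg: "0 < mu \<Longrightarrow> 0 \<le> stab_const mu R \<delta>0"
  by (auto simp: stab_const_def C_alpha_def)

end

context scheme
begin

text \<open>Used for two splittings of the error: with e = u - \<Pi> u and the coefficients of u_h -
  \<Pi> u on fine meshes, and with e = u and the coefficients of u_h on coarse ones.\<close>

lemma error_from_residual:
  assumes \<Omega>: "\<Omega> \<in> sets borel" "emeasure lborel \<Omega> < \<infinity>" "\<Omega> \<subseteq> cball 0 R" and R: "0 \<le> R"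
    and \<delta>: "\<delta> \<le> \<delta>0" and mu: "0 < mu" "mu \<le> lam"
    and cc: "\<And>k. grid_pt h k \<notin> \<Omega> \<Longrightarrow> cc k = 0"
    and T: "0 \<le> T" "\<And>k. grid_pt h k \<in> \<Omega> \<Longrightarrow> norm (LSh lam mu \<rho> h \<delta> (i_h h cc) (grid_pt h k)) \<le> T"
    and e: "\<And>x. x \<in> \<Omega> \<Longrightarrow> norm (e x) \<le> B"
    and B: "B \<le> b * H\<^sup>2"
    and t: "T * (4 ^ CARD('d) * (real CARD('d) * (2 * R + 2 * H) + \<delta>0)\<^sup>2 / (C_alpha CARD('d) * mu / real CARD('d))) \<le> t * H\<^sup>2"
  shows "L2_norm_on \<Omega> (\<lambda>x. e x - i_h h cc x) \<le> sqrt (2 * b\<^sup>2 * measure lborel \<Omega>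
     + 2 * (((4 * (2 * R / c + 1)) ^ CARD('d) + (2 * R / c + 1) ^ CARD('d) * measure lborel \<Omega>) * t\<^sup>2)) * H\<^sup>2"
proof -
  define F where "F = {k. grid_pt h k \<in> \<Omega>}"
  let ?S = "4 ^ CARD('d) * (real CARD('d) * (2 * R + 2 * H) + \<delta>0)\<^sup>2 / (C_alpha CARD('d) * mu / real CARD('d))"
  let ?Q = "(4 * (2 * R / c + 1)) ^ CARD('d) + (2 * R / c + 1) ^ CARD('d) * measure lborel \<Omega>"
  have FR: "F \<subseteq> {m. norm (grid_pt h m) \<le> R}" using \<Omega>(3) by (auto simp: F_def)
  have F: "finite F" by (rule finite_subset[OF FR finite_grid_ball])
  have cF: "cc k = 0" if "k \<notin> F" for k using that cc by (simp add: F_def)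
  have A: "\<bar>grid_pt h k $ j - grid_pt h m $ j\<bar> \<le> 2 * R" if "k \<in> F" "m \<in> F" for k m j
  proof -
    have "norm (grid_pt h k) \<le> R" "norm (grid_pt h m) \<le> R" using that FR by auto
    then show ?thesis
      using component_le_norm_cart[of "grid_pt h k" j] component_le_norm_cart[of "grid_pt h m" j] by linarith
  qed
  have A0: "0 \<le> 2 * R" using R by simp
  have TF: "norm (LSh lam mu \<rho> h \<delta> (i_h h cc) (grid_pt h k)) \<le> T" if "k \<in> F" for k
    using T(2) that by (simp add: F_def)
  have S0: "0 \<le> ?S" using mu by (auto simp: C_alpha_def)
  have sum: "(\<Sum>k\<in>F. (norm (cc k))\<^sup>2) \<le> real (card F) * (T * ?S)\<^sup>2"
    by (rule scheme_stable[OF F cF A0 A \<delta> mu T(1) TF])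
  obtain V where V: "\<And>k. (\<integral>x. indicat_real \<Omega> x * Psi h k x \<partial>lborel) \<le> V" "0 \<le> V" "real (card F) * V \<le> ?Q"
    by (rule grid_count_volume[OF \<Omega>(1,2) R FR]) blast
  have Q: "0 \<le> ?Q" using R c_pos by (intro add_nonneg_nonneg zero_le_power mult_nonneg_nonneg) auto
  have "V * (\<Sum>k\<in>F. (norm (cc k))\<^sup>2) \<le> V * (real (card F) * (T * ?S)\<^sup>2)"
    by (rule mult_left_mono[OF sum V(2)])
  also have "\<dots> = (real (card F) * V) * (T * ?S)\<^sup>2" by (simp only: mult_ac)
  also have "\<dots> \<le> ?Q * (t * H\<^sup>2)\<^sup>2"
    using T(1) S0 by (intro mult_mono V power_mono t Q mult_nonneg_nonneg) auto
  finally have 2: "V * (\<Sum>k\<in>F. (norm (cc k))\<^sup>2) \<le> ?Q * (t * H\<^sup>2)\<^sup>2" .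
  have B2: "B\<^sup>2 * measure lborel \<Omega> \<le> (b * H\<^sup>2)\<^sup>2 * measure lborel \<Omega>"
  proof (cases "\<Omega> = {}")
    case False
    then obtain x where "x \<in> \<Omega>" by blast
    then have "0 \<le> B" using e norm_ge_zero order_trans by blast
    then show ?thesis using B by (intro mult_right_mono power_mono) auto
  qed simp
  have "(L2_norm_on \<Omega> (\<lambda>x. e x - i_h h cc x))\<^sup>2 \<le> 2 * B\<^sup>2 * measure lborel \<Omega> + 2 * (V * (\<Sum>k\<in>F. (norm (cc k))\<^sup>2))"
    by (rule L2_norm_split[OF \<Omega>(1,2) F cF e V(1)])
  also have "\<dots> \<le> 2 * ((b * H\<^sup>2)\<^sup>2 * measure lborel \<Omega>) + 2 * (?Q * (t * H\<^sup>2)\<^sup>2)"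
    using B2 2 by linarith
  also have "\<dots> = (2 * b\<^sup>2 * measure lborel \<Omega> + 2 * (?Q * t\<^sup>2)) * (H\<^sup>2)\<^sup>2"
    by (simp add: power_mult_distrib ring_distribs mult_ac)
  finally have "L2_norm_on \<Omega> (\<lambda>x. e x - i_h h cc x) \<le> sqrt ((2 * b\<^sup>2 * measure lborel \<Omega> + 2 * (?Q * t\<^sup>2)) * (H\<^sup>2)\<^sup>2)"
    by (rule real_le_rsqrt)
  then show ?thesis by (simp only: real_sqrt_mult real_sqrt_abs abs_power2)
qed

lemma error_estimate:
  fixes u :: "real^'d \<Rightarrow> real^'d"
  assumes \<Omega>: "\<Omega> \<in> sets borel" "emeasure lborel \<Omega> < \<infinity>" "\<Omega> \<subseteq> cball 0 R" and R: "0 \<le> R"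
    and \<delta>: "\<delta> \<le> \<delta>0" and mu: "0 < mu" "mu \<le> lam"
    and u0: "\<And>x. norm (u x) \<le> M0" and u1: "\<And>a. bounded_partials 1 M1 (\<lambda>x. u x $ a)"
    and u2: "\<And>a. bounded_partials 2 M2 (\<lambda>x. u x $ a)" and u4: "\<And>a. bounded_partials 4 M (\<lambda>x. u x $ a)"
    and zero: "\<And>x. x \<notin> \<Omega> \<Longrightarrow> u x = 0"
    and cc: "\<And>k. grid_pt h k \<notin> \<Omega> \<Longrightarrow> cc k = 0"
    and eq: "\<And>k. grid_pt h k \<in> \<Omega> \<Longrightarrow> LSh lam mu \<rho> h \<delta> (i_h h cc) (grid_pt h k) = LS lam mu \<rho> \<delta> u (grid_pt h k)"
  shows "L2_norm_on \<Omega> (\<lambda>x. u x - i_h h cc x) \<le> error_const lam mu R \<delta>0 (measure lborel \<Omega>) M0 M2 M * H\<^sup>2"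
proof -
  let ?d = "real CARD('d)" and ?a = "C_alpha CARD('d) * mu / real CARD('d)"
  let ?S = "4 ^ CARD('d) * (?d * (2 * R + 2 * H) + \<delta>0)\<^sup>2 / ?a"
  let ?t = "(cons_const lam mu * M + op_const lam mu * M2) * stab_const mu R \<delta>0"
  let ?b = "M0 + 4 * ?d ^ 5 * M2"
  note M = bounded_partials_nonneg[OF u4[of undefined]] and M2 = bounded_partials_nonneg[OF u2[of undefined]]
  have M0: "0 \<le> M0" using u0[of 0] norm_ge_zero order_trans by blast
  note S1 = stab_const_nonneg[OF mu(1), of R \<delta>0]
  have a: "0 < ?a" using mu by (auto simp: C_alpha_def)
  have \<delta>0: "0 < \<delta>0" using \<delta> delta_pos by linarith
  have split: "cons_const lam mu * M * stab_const mu R \<delta>0 \<le> ?t" "op_const lam mu * M2 * stab_const mu R \<delta>0 \<le> ?t"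
    using S1 M M2 const_nonneg by (auto intro!: mult_right_mono)
  show ?thesis
  proof (cases "H \<le> 1")
    case True
    \<comment> \<open>Coefficients of the discrete error. They vanish off \<Omega> because
      \<open>u\<close> does, so stability applies to them.\<close>
    let ?c = "\<lambda>k. cc k - r_h h u k"
    have i: "i_h h ?c = (\<lambda>y. i_h h cc y - Pi_h h u y)"
      by (rule ext) (simp add: Pi_h_def i_h_nodes[OF h_pos] scaleR_right_diff_distrib sum_subtractf)
    have FR: "{k. grid_pt h k \<in> \<Omega>} \<subseteq> {m. norm (grid_pt h m) \<le> R}" using \<Omega>(3) by auto
    have F: "finite {k. grid_pt h k \<in> \<Omega>}" by (rule finite_subset[OF FR finite_grid_ball])
    have cF: "cc k = 0" if "k \<notin> {k. grid_pt h k \<in> \<Omega>}" for k using that cc by simp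
    have lip_trial: "lip (i_h h cc)" by (rule trial_regular(1)[OF F]) (rule cF)
    have "\<exists>K. \<forall>x s. norm (i_h h cc (x + s) + i_h h cc (x - s) - 2 *\<^sub>R i_h h cc x) \<le> K * (norm s)\<^sup>2"
      by (rule trial_regular(2)[OF F]) (rule cF)
    then obtain K where K: "\<And>x s. norm (i_h h cc (x + s) + i_h h cc (x - s) - 2 *\<^sub>R i_h h cc x) \<le> K * (norm s)\<^sup>2"
      by blast
    obtain L where L: "\<And>x s. norm (Pi_h h u (x + s) + Pi_h h u (x - s) - 2 *\<^sub>R Pi_h h u x) \<le> L * (norm s)\<^sup>2"
      using Pi_h_bounded_regular(2)[of u M0] u0 by blast
    have "L2_norm_on \<Omega> (\<lambda>x. (u x - Pi_h h u x) - i_h h ?c x) \<le> sqrt (2 * ?b\<^sup>2 * measure lborel \<Omega>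
       + 2 * (((4 * (2 * R / c + 1)) ^ CARD('d) + (2 * R / c + 1) ^ CARD('d) * measure lborel \<Omega>) * ?t\<^sup>2)) * H\<^sup>2"
    proof (rule error_from_residual[OF \<Omega> R \<delta> mu])
      show "?c k = 0" if "grid_pt h k \<notin> \<Omega>" for k using that cc zero by (simp add: r_h_def)
      show "0 \<le> cons_const lam mu * M * H\<^sup>2" using const_nonneg M by simp
      show "norm (LSh lam mu \<rho> h \<delta> (i_h h ?c) (grid_pt h k)) \<le> cons_const lam mu * M * H\<^sup>2" if "grid_pt h k \<in> \<Omega>" for k
      proof -
        have "LSh lam mu \<rho> h \<delta> (i_h h ?c) (grid_pt h k) =
            - (LSh lam mu \<rho> h \<delta> (Pi_h h u) (grid_pt h k) - LS lam mu \<rho> \<delta> u (grid_pt h k))"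
          unfolding i LSh_diff[OF lip_trial K lip_interpolant[OF u1 u2 u0 u4] L] eq[OF that] by simp
        then show ?thesis
          using LS_consistency[OF u1 u2 u0 u4 refl, of lam mu k] by (simp only: norm_minus_cancel cons_const_def)
      qed
      show "norm (u x - Pi_h h u x) \<le> ?d * (4 * ?d ^ 4 * H\<^sup>2 * M2)" for x
      proof (rule norm_le_card)
        fix j
        show "\<bar>(u x - Pi_h h u x) $ j\<bar> \<le> 4 * ?d ^ 4 * H\<^sup>2 * M2"
          using interp_error_bound[OF u2[of j], of x] by (simp add: interp_error_def Pi_h_component[OF h_pos] abs_minus_commute)
      qed
      show "?d * (4 * ?d ^ 4 * H\<^sup>2 * M2) \<le> ?b * H\<^sup>2"
      proof -
        have "?d * (4 * ?d ^ 4 * H\<^sup>2 * M2) = (4 * ?d ^ 5 * M2) * H\<^sup>2" by (simp add: eval_nat_numeral mult_ac)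
        also have "\<dots> \<le> ?b * H\<^sup>2" using M0 by (intro mult_right_mono) auto
        finally show ?thesis .
      qed
      have "?S \<le> stab_const mu R \<delta>0" unfolding stab_const_def
        using True R H_pos \<delta>0 a by (intro divide_right_mono mult_left_mono power_mono add_mono) auto
      then have "cons_const lam mu * M * H\<^sup>2 * ?S \<le> cons_const lam mu * M * H\<^sup>2 * stab_const mu R \<delta>0"
        using const_nonneg M by (intro mult_left_mono) auto
      also have "\<dots> = (cons_const lam mu * M * stab_const mu R \<delta>0) * H\<^sup>2" by (simp only: mult_ac)
      also have "\<dots> \<le> ?t * H\<^sup>2" using split(1) by (rule mult_right_mono) simp
      finally show "cons_const lam mu * M * H\<^sup>2 * ?S \<le> ?t * H\<^sup>2" .
    qed
    then show ?thesis unfolding error_const_def i by simp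
  next
    case False
    then have H1: "1 \<le> H" by simp
    then have HH: "1 \<le> H\<^sup>2" by simp
    show ?thesis unfolding error_const_def
    proof (rule error_from_residual[OF \<Omega> R \<delta> mu cc])
      show "0 \<le> op_const lam mu * M2" using const_nonneg M2 by simp
      show "norm (LSh lam mu \<rho> h \<delta> (i_h h cc) (grid_pt h k)) \<le> op_const lam mu * M2" if "grid_pt h k \<in> \<Omega>" for k
        unfolding eq[OF that] op_const_def by (rule LS_smooth_bound[OF u1 u2])
      show "norm (u x) \<le> M0" for x by (rule u0)
      have "M0 \<le> ?b" using M2 by simp
      also have "?b \<le> ?b * H\<^sup>2" using HH M0 M2 mult_left_mono[of 1 "H\<^sup>2" ?b] by simp
      finally show "M0 \<le> ?b * H\<^sup>2" .
      \<comment> \<open>For H \<ge> 1 the length scale is at most H times its value at H = 1.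
        Squaring yields the H^2 that the claimed bound allows.\<close>
      have "?S \<le> 4 ^ CARD('d) * ((?d * (2 * R + 2) + \<delta>0) * H)\<^sup>2 / ?a"
      proof (intro divide_right_mono mult_left_mono power_mono)
        have "R \<le> R * H" "\<delta>0 \<le> \<delta>0 * H" using H1 R \<delta>0 mult_left_mono[of 1 H R] mult_left_mono[of 1 H \<delta>0] by auto
        then have "?d * (2 * R + 2 * H) \<le> ?d * ((2 * R + 2) * H)"
          by (intro mult_left_mono) (auto simp: algebra_simps)
        with \<open>\<delta>0 \<le> \<delta>0 * H\<close> show "?d * (2 * R + 2 * H) + \<delta>0 \<le> (?d * (2 * R + 2) + \<delta>0) * H"
          by (simp only: distrib_right mult.assoc)
      qed (use a R H_pos \<delta>0 in auto)
      also have "\<dots> = stab_const mu R \<delta>0 * H\<^sup>2" unfolding stab_const_def power_mult_distrib by simp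
      finally have "op_const lam mu * M2 * ?S \<le> op_const lam mu * M2 * (stab_const mu R \<delta>0 * H\<^sup>2)"
        using const_nonneg M2 by (intro mult_left_mono) auto
      also have "\<dots> = (op_const lam mu * M2 * stab_const mu R \<delta>0) * H\<^sup>2" by (simp only: mult_ac)
      also have "\<dots> \<le> ?t * H\<^sup>2" using split(2) by (rule mult_right_mono) simp
      finally show "op_const lam mu * M2 * ?S \<le> ?t * H\<^sup>2" .
    qed
  qed
qed

end

lemma bounded_partials_0: "bounded_partials 0 K g \<Longrightarrow> \<bar>g x\<bar> \<le> K"
  unfolding bounded_partials_def by auto

theorem theorem4p8:
  fixes \<Omega> :: "(real^'d) set"
    and \<delta>0 lam mu :: real
    and \<rho> :: "real \<Rightarrow> real"
    and hhat :: "real^'d"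
    and u f :: "real \<Rightarrow> real^'d \<Rightarrow> real^'d"
  assumes "CARD('d) = 2 \<or> CARD('d) = 3"
    and "\<delta>0 > 0"
    and "open \<Omega>" and "bounded \<Omega>"
    and "mu > 0"
    and "lam \<ge> mu"
    and "admissible_kernel TYPE('d) \<rho>"
    and "\<forall>j. hhat $ j > 0" and "Max (range (\<lambda>j. hhat $ j)) = 1"
    and solution: "\<forall>\<delta>\<in>{0<..\<delta>0}.
          (\<forall>x\<in>\<Omega>. - LS lam mu \<rho> \<delta> (u \<delta>) x = f \<delta> x) \<and>
          (\<forall>x\<in>Omega_I \<Omega> \<delta>. u \<delta> x = 0)"
    and zero_extension: "\<forall>\<delta>\<in>{0<..\<delta>0}. \<forall>x. x \<notin> Omega_delta \<Omega> \<delta> \<longrightarrow> u \<delta> x = 0"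
    and regularity: "\<forall>\<delta>\<in>{0<..\<delta>0}. C_closure_vec 4 (Omega_delta \<Omega> \<delta>) (u \<delta>)"
    and uniform_bound: "\<exists>M::real. \<forall>\<delta>\<in>{0<..\<delta>0}. deriv_sup 4 (Omega_delta \<Omega> \<delta>) (u \<delta>) \<le> ereal M"
  shows "\<exists>C::real. \<forall>\<delta>\<in>{0<..\<delta>0}. \<forall>hmax>0. \<forall>uh\<in>trial_space (hmax *\<^sub>R hhat) \<Omega>.
           r_h_on (hmax *\<^sub>R hhat) \<Omega> (\<lambda>x. - LSh lam mu \<rho> (hmax *\<^sub>R hhat) \<delta> uh x)
             = r_h_on (hmax *\<^sub>R hhat) \<Omega> (f \<delta>)
           \<longrightarrow> L2_norm_on \<Omega> (\<lambda>x. u \<delta> x - uh x) \<le> C * hmax\<^sup>2"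
proof (cases "\<Omega> = {}")
  case True
  then show ?thesis by (intro exI[of _ 0]) (simp add: L2_norm_on_def set_lebesgue_integral_def)
next
  case False
  \<comment> \<open>The least component of \<open>hhat\<close> is the shape-regularity constant, and
    the largest being 1 makes \<open>hmax\<close> the mesh width.\<close>
  define c where "c = Min (range (\<lambda>j. hhat $ j))"
  have c: "0 < c" unfolding c_def using assms(8) by (subst Min_gr_iff) auto
  have c_le: "c \<le> hhat $ j" for j unfolding c_def by (rule Min_le) auto
  have hhat_le: "hhat $ j \<le> 1" for j
    using Max_ge[of "range (\<lambda>j. hhat $ j)" "hhat $ j"] assms(9) by simp
  obtain M where M: "\<And>\<delta>. \<delta> \<in> {0<..\<delta>0} \<Longrightarrow> deriv_sup 4 (Omega_delta \<Omega> \<delta>) (u \<delta>) \<le> ereal M"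
    using uniform_bound by blast
  obtain R where "\<forall>x\<in>\<Omega>. norm x \<le> R" using assms(4) unfolding bounded_iff by (elim exE)
  then have R: "\<Omega> \<subseteq> cball 0 R" by (simp add: subset_iff)
  obtain x0 where "x0 \<in> \<Omega>" using False by blast
  then have "norm x0 \<le> R" using \<open>\<forall>x\<in>\<Omega>. norm x \<le> R\<close> by blast
  then have R0: "0 \<le> R" using norm_ge_zero[of x0] by linarith
  have \<Omega>: "\<Omega> \<in> sets borel" "emeasure lborel \<Omega> < \<infinity>"
    using assms(3) emeasure_bounded_finite[OF assms(4)] by simp_all
  let ?L = "real CARD('d) * (2 * R + 1)"
  let ?K = "\<lambda>p. ?L ^ (4 - p) * max M 0"
  show ?thesis
  proof (intro exI ballI allI impI)
    fix \<delta> hmax uh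
    assume \<delta>: "\<delta> \<in> {0<..\<delta>0}" and hmax: "(0::real) < hmax"
      and uh: "uh \<in> trial_space (hmax *\<^sub>R hhat) \<Omega>"
      and scheme: "r_h_on (hmax *\<^sub>R hhat) \<Omega> (\<lambda>x. - LSh lam mu \<rho> (hmax *\<^sub>R hhat) \<delta> uh x)
             = r_h_on (hmax *\<^sub>R hhat) \<Omega> (f \<delta>)"
    interpret scheme "hmax *\<^sub>R hhat" c hmax \<rho> \<delta>
    proof unfold_locales
      show "c * hmax \<le> (hmax *\<^sub>R hhat) $ j" for j using c_le[of j] hmax by simp
      show "(hmax *\<^sub>R hhat) $ j \<le> hmax" for j using hhat_le[of j] hmax by simp
      show "0 < \<delta>" using \<delta> by simp
    qed (rule c hmax assms(7))+
    have zero: "u \<delta> x = 0" if "x \<notin> \<Omega>" for x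
    proof (cases "x \<in> Omega_I \<Omega> \<delta>")
      case True
      then show ?thesis using solution \<delta> by blast
    next
      case False
      then have "x \<notin> Omega_delta \<Omega> \<delta>" using that by (simp add: Omega_delta_def)
      then show ?thesis using zero_extension \<delta> by blast
    qed
    have bounded_partials: "bounded_partials p (?K p) (\<lambda>x. u \<delta> x $ a)" if "p \<le> 4" for p a
    proof (rule global_bounds[OF False R])
      show "0 < \<delta>" using \<delta> by simp
      show "C_closure_vec 4 (Omega_delta \<Omega> \<delta>) (u \<delta>)" using regularity \<delta> by blast
      show "deriv_sup 4 (Omega_delta \<Omega> \<delta>) (u \<delta>) \<le> ereal M" by (rule M[OF \<delta>])
      show "u \<delta> x = 0" if "x \<notin> \<Omega>" for x using that by (rule zero)
    qed (rule that)
    have u0: "norm (u \<delta> x) \<le> real CARD('d) * ?K 0" for x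
      by (rule norm_le_card, rule bounded_partials_0[OF bounded_partials]) simp
    obtain cc where cc: "uh = i_h (hmax *\<^sub>R hhat) cc" "\<And>k. grid_pt (hmax *\<^sub>R hhat) k \<notin> \<Omega> \<Longrightarrow> cc k = 0"
      using uh unfolding trial_space_def by blast
    have eq: "LSh lam mu \<rho> (hmax *\<^sub>R hhat) \<delta> (i_h (hmax *\<^sub>R hhat) cc) (grid_pt (hmax *\<^sub>R hhat) k) =
        LS lam mu \<rho> \<delta> (u \<delta>) (grid_pt (hmax *\<^sub>R hhat) k)" if k: "grid_pt (hmax *\<^sub>R hhat) k \<in> \<Omega>" for k
    proof -
      have "- LSh lam mu \<rho> (hmax *\<^sub>R hhat) \<delta> uh (grid_pt (hmax *\<^sub>R hhat) k) = f \<delta> (grid_pt (hmax *\<^sub>R hhat) k)"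
        using fun_cong[OF scheme, of k] k by (simp add: r_h_on_def r_h_def)
      moreover have "- LS lam mu \<rho> \<delta> (u \<delta>) (grid_pt (hmax *\<^sub>R hhat) k) = f \<delta> (grid_pt (hmax *\<^sub>R hhat) k)"
        using solution \<delta> k by blast
      ultimately have "- LSh lam mu \<rho> (hmax *\<^sub>R hhat) \<delta> uh (grid_pt (hmax *\<^sub>R hhat) k) =
          - LS lam mu \<rho> \<delta> (u \<delta>) (grid_pt (hmax *\<^sub>R hhat) k)" by (rule trans[OF _ sym])
      then show ?thesis unfolding cc(1) by (simp only: neg_equal_iff_equal)
    qed
    \<comment> \<open>The witness for \<open>C\<close> is fixed here. It is built from
      \<open>c\<close>, \<open>R\<close>, \<open>M\<close>, \<open>\<delta>0\<close>, the Lame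
      parameters and the measure of \<Omega>, so it involves neither \<open>hmax\<close> nor
      \<delta>.\<close>
    show "L2_norm_on \<Omega> (\<lambda>x. u \<delta> x - uh x) \<le>
      mesh.error_const TYPE('d) c lam mu R \<delta>0 (measure lborel \<Omega>) (real CARD('d) * ?K 0) (?K 2) (?K 4) * hmax\<^sup>2"
      unfolding cc(1)
    proof (rule error_estimate)
      show "bounded_partials 1 (?K 1) (\<lambda>x. u \<delta> x $ a)" "bounded_partials 2 (?K 2) (\<lambda>x. u \<delta> x $ a)" "bounded_partials 4 (?K 4) (\<lambda>x. u \<delta> x $ a)" for a
        by (rule bounded_partials, simp)+
      show "norm (u \<delta> x) \<le> real CARD('d) * ?K 0" for x by (rule u0)
      show "u \<delta> x = 0" if "x \<notin> \<Omega>" for x using that by (rule zero)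
      show "cc k = 0" if "grid_pt (hmax *\<^sub>R hhat) k \<notin> \<Omega>" for k using that by (rule cc(2))
      show "LSh lam mu \<rho> (hmax *\<^sub>R hhat) \<delta> (i_h (hmax *\<^sub>R hhat) cc) (grid_pt (hmax *\<^sub>R hhat) k) =
        LS lam mu \<rho> \<delta> (u \<delta>) (grid_pt (hmax *\<^sub>R hhat) k)" if "grid_pt (hmax *\<^sub>R hhat) k \<in> \<Omega>" for k
        using that by (rule eq)
      show "\<delta> \<le> \<delta>0" using \<delta> by simp
    qed (rule \<Omega> R R0 assms(5,6))+
  qed
qed

end
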